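(* Let $m_{dS}$ be the holographic mass of a de Sitter-type metric $(M,g)\in dS^{+}$, $\dim M=n+1$, with static or stationary Killing field $K$ on $\mathcal I^{+}$, and let $m_{AdS}$ be the mass of the associated AdS metric. If $n$ is odd, then $$m_{dS}=-m_{AdS}\ \text{ if } n\equiv 3 \pmod 4,\qquad m_{dS}=m_{AdS}\ \text{ if } n\equiv 1\pmod 4.$$ Also, $$m_{dS}=-m_{AdS}\ \text{ if } n=2,\qquad m_{dS}=m_{AdS}\ \text{ if } n=4.$$
   Context: Length scale $l=1$. $dS^+$ is the space of Lorentzian solutions of $\mathrm{Ric}_g=n g$ in dimension $n+1$ with a smooth future conformal infinity $\mathcal I^+$, on which the compactified metric $\rho^2 g$ induces a Riemannian boundary metric $\gamma$. In discussing mass, $\mathcal I^+$ may be replaced by a cover or an open subset such as $\mathbb R\times S$. Expansions. With $\rho$ the geodesic defining function determined by $\gamma$, one has $g^{dS}=\rho^{-2}(-d\rho^2+g_\rho)$. Likewise a Riemannian asymptotically hyperbolic (AH) Einstein metric ($\mathrm{Ric}=-ng$) has the form $g^{AH}=\rho^{-2}(d\rho^2+g_\rho)$, and a Lorentzian AdS Einstein metric ($\mathrm{Ric}=-ng$) has the same form with $g_\rho$ Lorentzian. In each case $g_\rho\sim g_{(0)}+\rho^2g_{(2)}+\cdots+\rho^ng_{(n)}+\cdots$, with $g_{(0)}=\gamma$ and, for $n$ even, an additional term $\rho^n\log\rho\,h_{(n)}$. Continuation. The AH continuation of $g^{dS}$ across $\mathcal I^+$ is the AH Einstein metric near $\partial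 M=\mathcal I^+$ with $g^{AH}_{(0)}=g^{dS}_{(0)}$, $g^{AH}_{(2k)}=(-1)^kg^{dS}_{(2k)}$ for $2k<n$, and $g^{AH}_{(n)}=\varepsilon_n g^{dS}_{(n)}$, where $\varepsilon_n=+1$ if $n\equiv0,1 \pmod 4$ and $\varepsilon_n=-1$ if $n\equiv 2,3\pmod 4$. The Killing field $K=\partial_\theta$ on $\mathcal I^+$ ("static" if hypersurface orthogonal, otherwise "stationary") is assumed to give a static or stationary Killing field of the AH continuation. The associated AdS metric is the Lorentzian metric obtained from the AH continuation by the Wick rotation $\theta=it$, with $K$ becoming the timelike Killing field $\partial_t$; in the stationary non-static case it is assumed that this rotation can be carried out. Holographic stress-energy tensors. For AH and dS metrics, $$T=-\frac{n}{16\pi G}\bigl(g_{(n)}+r_{(n)}\bigr),$$ and for AdS metrics $T$ is given by the same formula with the opposite overall sign. The coefficients are those of the metric in question. Here $r_{(n)}=0$ for $n$ odd, and $r_{(n)}$ is a local expression in $\gamma$ for $n$ even; in terms of $g_{(2)}$, with traces and products taken with respect to $\gamma$, $$r_{(2)}=-(\mathrm{tr}\,g_{(2)})\gamma,\qquad r_{(4)}=-\tfrac18\bigl[(\mathrm{tr}\,g_{(2)})^2-\mathrm{tr}(g_{(2)}^2)\bigr]\gamma-\tfrac12 g_{(2)}^2+\tfrac14(\mathrm{tr}\,g_{(2)})\,g_{(2)}.$$ Mass. $m=\int_S\langle T(K),\nu\rangle$, where $S$ is a slice to the orbits of $K$ in the conformal infinity (a spacelike slice in the AdS case), $\nu$ is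 the unit normal to $S$ with respect to $\gamma$ in the direction of $K$, and $\langle T(K),\nu\rangle=T(K,\nu)$. For $n$ even the masses are computed with corresponding choices of representative $\gamma$ in the conformal class. *)

theory Defs
  imports "HOL-Analysis.Analysis"
begin

section \<open>Smooth functions and local differential geometry on open subsets of real coordinate space\<close>

primrec Ck_on :: "nat \<Rightarrow> 'a::euclidean_space set \<Rightarrow> ('a \<Rightarrow> 'b::real_normed_vector) \<Rightarrow> bool" where
  "Ck_on 0 U f \<longleftrightarrow> continuous_on U f"
| "Ck_on (Suc k) U f \<longleftrightarrow>
     (\<forall>x\<in>U. f differentiable (at x)) \<and> (\<forall>v. Ck_on k U (\<lambda>x. frechet_derivative f (at x) v))"

definition smooth_on :: "'a::euclidean_space set \<Rightarrow> ('a \<Rightarrow> 'b::real_normed_vector) \<Rightarrow> bool" where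
  "smooth_on U f \<longleftrightarrow> open U \<and> (\<forall>k. Ck_on k U f)"

definition partial :: "'m::finite \<Rightarrow> (real^'m \<Rightarrow> 'b::real_normed_vector) \<Rightarrow> real^'m \<Rightarrow> 'b" where
  "partial i f x = frechet_derivative f (at x) (axis i 1)"

definition christoffel :: "(real^'m \<Rightarrow> real^'m^'m) \<Rightarrow> 'm::finite \<Rightarrow> 'm \<Rightarrow> 'm \<Rightarrow> real^'m \<Rightarrow> real" where
  "christoffel g k i j x =
     (\<Sum>l\<in>UNIV. matrix_inv (g x) $ k $ l *
        (partial i (\<lambda>y. g y $ j $ l) x + partial j (\<lambda>y. g y $ i $ l) x - partial l (\<lambda>y. g y $ i $ j) x)) / 2"

definition ricci :: "(real^'m \<Rightarrow> real^'m^'m) \<Rightarrow> real^'m \<Rightarrow> real^'m::finite^'m" where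
  "ricci g x = (\<chi> i j.
     (\<Sum>k\<in>UNIV. partial k (christoffel g k i j) x - partial j (christoffel g k i k) x)
     + (\<Sum>k\<in>UNIV. \<Sum>l\<in>UNIV. christoffel g k k l x * christoffel g l i j x
                             - christoffel g k j l x * christoffel g l i k x))"

definition lie_derivative :: "(real^'m \<Rightarrow> real^'m) \<Rightarrow> (real^'m \<Rightarrow> real^'m^'m) \<Rightarrow> real^'m \<Rightarrow> real^'m::finite^'m" where
  "lie_derivative Z g x = (\<chi> i j. \<Sum>k\<in>UNIV.
      Z x $ k * partial k (\<lambda>y. g y $ i $ j) x
      + g x $ k $ j * partial i (\<lambda>y. Z y $ k) x
      + g x $ i $ k * partial j (\<lambda>y. Z y $ k) x)"


section \<open>Manifolds and tensor fields\<close>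

text \<open>
  A chart is a domain together with a coordinate map; a smooth structure is a maximal atlas.
  Tensor fields are given classically, by their components in every chart of the maximal atlas,
  subject to the transformation law.
\<close>

type_synonym ('p, 'n) chart = "'p set \<times> ('p \<Rightarrow> real^'n)"
type_synonym ('p, 'n) vfield = "('p, 'n) chart \<Rightarrow> 'p \<Rightarrow> real^'n"
type_synonym ('k, 'p, 'n) tensor2 = "('p, 'n) chart \<Rightarrow> 'p \<Rightarrow> 'k^'n^'n"

definition chart_image :: "('p, 'n) chart \<Rightarrow> (real^'n) set" where
  "chart_image c = snd c ` fst c"

definition in_chart :: "('p, 'n) chart \<Rightarrow> ('p \<Rightarrow> 'b) \<Rightarrow> real^'n \<Rightarrow> 'b" where
  "in_chart c f x = f (inv_into (fst c) (snd c) x)"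

definition is_chart :: "'p::topological_space set \<Rightarrow> ('p, 'n::finite) chart \<Rightarrow> bool" where
  "is_chart X c \<longleftrightarrow> openin (top_of_set X) (fst c) \<and> open (chart_image c) \<and>
     homeomorphism (fst c) (chart_image c) (snd c) (inv_into (fst c) (snd c))"

definition compatible :: "('p, 'n::finite) chart \<Rightarrow> ('p, 'n) chart \<Rightarrow> bool" where
  "compatible c d \<longleftrightarrow>
     smooth_on (snd c ` (fst c \<inter> fst d)) (in_chart c (snd d)) \<and>
     smooth_on (snd d ` (fst c \<inter> fst d)) (in_chart d (snd c))"

definition smooth_manifold ::
  "'p::{t2_space, second_countable_topology} set \<Rightarrow> ('p, 'n::finite) chart set \<Rightarrow> bool" where
  "smooth_manifold X A \<longleftrightarrow>
     (\<forall>c\<in>A. is_chart X c) \<and> \<Union> (fst ` A) = X \<and> (\<forall>c\<in>A. \<forall>d\<in>A. compatible c d) \<and>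
     (\<forall>c. is_chart X c \<and> (\<forall>d\<in>A. compatible c d) \<longrightarrow> c \<in> A)"

definition smooth_function :: "('p, 'n::finite) chart set \<Rightarrow> ('p \<Rightarrow> real) \<Rightarrow> bool" where
  "smooth_function A f \<longleftrightarrow> (\<forall>c\<in>A. smooth_on (chart_image c) (in_chart c f))"

definition differential :: "('p \<Rightarrow> real) \<Rightarrow> ('p, 'n::finite) vfield" where
  "differential f c p = (\<chi> i. partial i (in_chart c f) (snd c p))"

definition jacobian :: "('p, 'n::finite) chart \<Rightarrow> ('p, 'n) chart \<Rightarrow> 'p \<Rightarrow> real^'n^'n" where
  "jacobian c d p = matrix (frechet_derivative (in_chart c (snd d)) (at (snd c p)))"

definition vector_field :: "('p, 'n::finite) chart set \<Rightarrow> ('p, 'n) vfield \<Rightarrow> bool" where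
  "vector_field A K \<longleftrightarrow>
     (\<forall>c\<in>A. smooth_on (chart_image c) (in_chart c (K c))) \<and>
     (\<forall>c\<in>A. \<forall>d\<in>A. \<forall>p\<in>fst c \<inter> fst d. K d p = jacobian c d p *v K c p)"

definition sym_tensor_field :: "('p, 'n::finite) chart set \<Rightarrow> (real, 'p, 'n) tensor2 \<Rightarrow> bool" where
  "sym_tensor_field A h \<longleftrightarrow>
     (\<forall>c\<in>A. smooth_on (chart_image c) (in_chart c (h c))) \<and>
     (\<forall>c\<in>A. \<forall>p\<in>fst c. transpose (h c p) = h c p) \<and>
     (\<forall>c\<in>A. \<forall>d\<in>A. \<forall>p\<in>fst c \<inter> fst d.
        h c p = transpose (jacobian c d p) ** h d p ** jacobian c d p)"

definition bilin :: "'k::comm_ring_1^'n::finite^'n \<Rightarrow> 'k^'n \<Rightarrow> 'k^'n \<Rightarrow> 'k" where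
  "bilin M u v = (\<Sum>i\<in>UNIV. \<Sum>j\<in>UNIV. u $ i * M $ i $ j * v $ j)"

definition riemannian :: "('p, 'n::finite) chart set \<Rightarrow> (real, 'p, 'n) tensor2 \<Rightarrow> bool" where
  "riemannian A g \<longleftrightarrow> sym_tensor_field A g \<and>
     (\<forall>c\<in>A. \<forall>p\<in>fst c. \<forall>v. v \<noteq> 0 \<longrightarrow> bilin (g c p) v v > 0)"

definition lorentzian :: "('p, 'n::finite) chart set \<Rightarrow> (real, 'p, 'n) tensor2 \<Rightarrow> bool" where
  "lorentzian A g \<longleftrightarrow> sym_tensor_field A g \<and>
     (\<forall>c\<in>A. \<forall>p\<in>fst c. \<exists>u. bilin (g c p) u u < 0 \<and>
        (\<forall>v. v \<noteq> 0 \<and> bilin (g c p) u v = 0 \<longrightarrow> bilin (g c p) v v > 0))"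

definition einstein :: "real \<Rightarrow> ('p, 'n::finite) chart set \<Rightarrow> (real, 'p, 'n) tensor2 \<Rightarrow> bool" where
  "einstein lam A g \<longleftrightarrow>
     (\<forall>c\<in>A. \<forall>p\<in>fst c. ricci (in_chart c (g c)) (snd c p) = lam *\<^sub>R g c p)"

definition killing :: "('p, 'n::finite) chart set \<Rightarrow> (real, 'p, 'n) tensor2 \<Rightarrow> ('p, 'n) vfield \<Rightarrow> bool" where
  "killing A g K \<longleftrightarrow> vector_field A K \<and>
     (\<forall>c\<in>A. \<forall>p\<in>fst c. lie_derivative (in_chart c (K c)) (in_chart c (g c)) (snd c p) = 0)"


section \<open>Conformal infinity and Fefferman--Graham expansions\<close>

text \<open>
  Near infinity a point of the bulk is described by the value of the geodesic defining function
  and by its projection to the boundary along the normal geodesics. Coordinates on the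
  (n+1)-dimensional bulk are indexed by \<^typ>\<open>'n option\<close>, with \<^term>\<open>None\<close> for the defining function.
\<close>

definition bulk_coords :: "real \<Rightarrow> real^'n::finite \<Rightarrow> real^('n option)" where
  "bulk_coords r x = (\<chi> a. case a of None \<Rightarrow> r | Some i \<Rightarrow> x $ i)"

definition fg_chart :: "'q set \<Rightarrow> ('q \<Rightarrow> real) \<Rightarrow> ('q \<Rightarrow> 'p) \<Rightarrow> ('p, 'n::finite) chart \<Rightarrow> ('q, 'n option) chart" where
  "fg_chart V \<rho> \<pi> c = ({q \<in> V. \<pi> q \<in> fst c}, \<lambda>q. bulk_coords (\<rho> q) (snd c (\<pi> q)))"

text \<open>The matrix of \<open>r\<^sup>-\<^sup>2 (s dr\<^sup>2 + h)\<close>.\<close>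

definition fg_metric :: "real \<Rightarrow> real \<Rightarrow> real^'n::finite^'n \<Rightarrow> real^('n option)^('n option)" where
  "fg_metric s r h = (\<chi> a b. case (a, b) of
       (None, None) \<Rightarrow> s / r^2
     | (Some i, Some j) \<Rightarrow> h $ i $ j / r^2
     | _ \<Rightarrow> 0)"

text \<open>
  The part \<open>V\<close> of the bulk manifold with maximal atlas \<open>B\<close> and metric \<open>gM\<close> is a collar of the
  conformal infinity \<open>X\<close> (maximal atlas \<open>A\<close>), on which \<open>gM = \<rho>\<^sup>-\<^sup>2 (s d\<rho>\<^sup>2 + g\<^sub>\<rho>)\<close>.
  The collar may have variable width because \<open>X\<close> need not be compact.
\<close>

definition conformal_infinity ::
  "real \<Rightarrow> ('q, 'n option) chart set \<Rightarrow> (real, 'q, 'n option) tensor2 \<Rightarrow> 'q set \<Rightarrow> ('q \<Rightarrow> real) \<Rightarrow> ('q \<Rightarrow> 'p) \<Rightarrow>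
   'p::topological_space set \<Rightarrow> ('p, 'n::finite) chart set \<Rightarrow> (real \<Rightarrow> (real, 'p, 'n) tensor2) \<Rightarrow> bool" where
  "conformal_infinity s B gM V \<rho> \<pi> X A g \<longleftrightarrow>
     (\<exists>\<epsilon>. continuous_on X \<epsilon> \<and> (\<forall>p\<in>X. \<epsilon> p > 0) \<and>
        bij_betw (\<lambda>q. (\<rho> q, \<pi> q)) V {(r, p). p \<in> X \<and> 0 < r \<and> r < \<epsilon> p}) \<and>
     (\<forall>c\<in>A. fg_chart V \<rho> \<pi> c \<in> B \<and>
        (\<forall>q\<in>fst (fg_chart V \<rho> \<pi> c).
           gM (fg_chart V \<rho> \<pi> c) q = fg_metric s (\<rho> q) (g (\<rho> q) c (\<pi> q))))"

text \<open>
  The expansion \<open>g\<^sub>\<rho> \<sim> a\<^sub>0 + \<rho>\<^sup>2 a\<^sub>2 + \<dots> + \<rho>\<^sup>n a\<^sub>n (+ \<rho>\<^sup>n log \<rho> h if n is even)\<close>, up to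
  a remainder \<open>o(\<rho>\<^sup>n)\<close>. It determines \<open>a\<^sub>0, \<dots>, a\<^sub>n\<close> and \<open>h\<close> on the charts of \<open>A\<close>.
  The scalars are complex for Wick rotated metrics.
\<close>

definition fg_expansion ::
  "('p, 'n::finite) chart set \<Rightarrow> (real \<Rightarrow> ('k::real_normed_field, 'p, 'n) tensor2) \<Rightarrow>
   (nat \<Rightarrow> ('k, 'p, 'n) tensor2) \<Rightarrow> ('k, 'p, 'n) tensor2 \<Rightarrow> bool" where
  "fg_expansion A g a h \<longleftrightarrow> (\<forall>c\<in>A. \<forall>p\<in>fst c.
     (\<forall>j<CARD('n). odd j \<longrightarrow> a j c p = 0) \<and>
     (odd (CARD('n)) \<longrightarrow> h c p = 0) \<and>
     ((\<lambda>r. inverse (r ^ CARD('n)) *\<^sub>R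
        (g r c p - (\<Sum>j\<le>CARD('n). r ^ j *\<^sub>R a j c p) - (r ^ CARD('n) * ln r) *\<^sub>R h c p)) \<longlongrightarrow> 0) (at_right 0))"

text \<open>
  A metric of \<open>dS\<^sup>+\<close> with conformal infinity \<open>(X, a 0)\<close>, in the gauge of the geodesic defining
  function determined by \<open>a 0\<close>.
\<close>

definition dS_plus ::
  "'q::{t2_space, second_countable_topology} set \<Rightarrow> ('q, 'n option) chart set \<Rightarrow> (real, 'q, 'n option) tensor2 \<Rightarrow>
   'q set \<Rightarrow> ('q \<Rightarrow> real) \<Rightarrow> ('q \<Rightarrow> 'p) \<Rightarrow>
   'p::{t2_space, second_countable_topology} set \<Rightarrow> ('p, 'n::finite) chart set \<Rightarrow>
   (real \<Rightarrow> (real, 'p, 'n) tensor2) \<Rightarrow> (nat \<Rightarrow> (real, 'p, 'n) tensor2) \<Rightarrow> (real, 'p, 'n) tensor2 \<Rightarrow> bool" where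
  "dS_plus M B gM V \<rho> \<pi> X A g a h \<longleftrightarrow>
     smooth_manifold M B \<and> lorentzian B gM \<and> einstein (real (CARD('n))) B gM \<and>
     smooth_manifold X A \<and> V \<subseteq> M \<and> conformal_infinity (-1) B gM V \<rho> \<pi> X A g \<and>
     riemannian A (a 0) \<and> (\<forall>j\<le>CARD('n). sym_tensor_field A (a j)) \<and> sym_tensor_field A h \<and>
     fg_expansion A g a h"

text \<open>An AH Einstein metric on a collar \<open>N\<close> of its conformal infinity.\<close>

definition AH_einstein_collar ::
  "'q::{t2_space, second_countable_topology} set \<Rightarrow> ('q, 'n option) chart set \<Rightarrow> (real, 'q, 'n option) tensor2 \<Rightarrow>
   ('q \<Rightarrow> real) \<Rightarrow> ('q \<Rightarrow> 'p) \<Rightarrow>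
   'p::{t2_space, second_countable_topology} set \<Rightarrow> ('p, 'n::finite) chart set \<Rightarrow>
   (real \<Rightarrow> (real, 'p, 'n) tensor2) \<Rightarrow> (nat \<Rightarrow> (real, 'p, 'n) tensor2) \<Rightarrow> (real, 'p, 'n) tensor2 \<Rightarrow> bool" where
  "AH_einstein_collar N B gN \<rho> \<pi> X A g a h \<longleftrightarrow>
     smooth_manifold N B \<and> riemannian B gN \<and> einstein (- real (CARD('n))) B gN \<and>
     smooth_manifold X A \<and> conformal_infinity 1 B gN N \<rho> \<pi> X A g \<and>
     riemannian A (a 0) \<and> (\<forall>j\<le>CARD('n). sym_tensor_field A (a j)) \<and> sym_tensor_field A h \<and>
     fg_expansion A g a h"

definition eps :: "nat \<Rightarrow> real" where
  "eps n = (if n mod 4 = 0 \<or> n mod 4 = 1 then 1 else -1)"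

definition AH_continuation ::
  "('p, 'n::finite) chart set \<Rightarrow> (nat \<Rightarrow> (real, 'p, 'n) tensor2) \<Rightarrow> (nat \<Rightarrow> (real, 'p, 'n) tensor2) \<Rightarrow> bool" where
  "AH_continuation A a b \<longleftrightarrow> (\<forall>c\<in>A. \<forall>p\<in>fst c.
     b 0 c p = a 0 c p \<and>
     (\<forall>k. 2 * k < CARD('n) \<longrightarrow> b (2 * k) c p = (-1) ^ k *\<^sub>R a (2 * k) c p) \<and>
     b (CARD('n)) c p = eps (CARD('n)) *\<^sub>R a (CARD('n)) c p)"


section \<open>Killing coordinate, slice and Wick rotation\<close>

definition integral_curve ::
  "('p::topological_space, 'n::finite) chart set \<Rightarrow> ('p, 'n) vfield \<Rightarrow> (real \<Rightarrow> 'p) \<Rightarrow> real set \<Rightarrow> bool" where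
  "integral_curve A K u I \<longleftrightarrow> continuous_on I u \<and> u ` I \<subseteq> \<Union> (fst ` A) \<and>
     (\<forall>c\<in>A. \<forall>t\<in>I. u t \<in> fst c \<longrightarrow>
        ((\<lambda>\<tau>. snd c (u \<tau>)) has_vector_derivative K c (u t)) (at t within I))"

definition slice :: "'p set \<Rightarrow> ('p \<Rightarrow> real) \<Rightarrow> 'p set" where
  "slice X \<theta> = {p \<in> X. \<theta> p = 0}"

text \<open>
  \<open>K = \<partial>\<^sub>\<theta>\<close> for a coordinate \<open>\<theta>\<close> whose zero set is a slice to the orbits of \<open>K\<close>: since
  \<open>d\<theta>(K) = 1\<close>, each orbit meets the slice at most once, and the last condition says that it does
  meet it. If \<open>K\<close> is complete this means that \<open>X\<close> is the product of the line and the slice.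
\<close>

definition killing_coordinate ::
  "'p::topological_space set \<Rightarrow> ('p, 'n::finite) chart set \<Rightarrow> ('p, 'n) vfield \<Rightarrow> ('p \<Rightarrow> real) \<Rightarrow> bool" where
  "killing_coordinate X A K \<theta> \<longleftrightarrow> smooth_function A \<theta> \<and>
     (\<forall>c\<in>A. \<forall>p\<in>fst c. differential \<theta> c p \<bullet> K c p = 1) \<and>
     (\<forall>p\<in>X. \<exists>u. u (\<theta> p) = p \<and> u 0 \<in> slice X \<theta> \<and> integral_curve A K u (closed_segment 0 (\<theta> p)))"

text \<open>
  The substitution \<open>\<theta> = i t\<close>. The rotated manifold is the original one with \<open>\<theta>\<close> renamed \<open>t\<close> and
  \<open>K = \<partial>\<^sub>t\<close>. In coordinates \<open>(\<theta>, x)\<close>, replacing \<open>d\<theta>\<close> by \<open>i dt\<close> multiplies the \<open>\<theta>\<theta>\<close>-component by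
  \<open>-1\<close> and the mixed components by \<open>i\<close>. Equivalently the form is composed, in both arguments, with
  the complex linear map which is the identity on the kernel of \<open>d\<theta>\<close> and sends \<open>K\<close> to \<open>i K\<close>.
  For a static \<open>K\<close> orthogonal to the level sets of \<open>\<theta>\<close> a Riemannian metric becomes a real Lorentzian
  one (\<open>wick_static\<close>); otherwise the result is in general a complex valued symmetric form.
\<close>

definition wick_map :: "('p \<Rightarrow> real) \<Rightarrow> ('p, 'n::finite) vfield \<Rightarrow> ('p, 'n) chart \<Rightarrow> 'p \<Rightarrow> complex^'n^'n" where
  "wick_map \<theta> K c p = (\<chi> i j. (if i = j then 1 else 0) +
      (\<i> - 1) * complex_of_real (K c p $ i * differential \<theta> c p $ j))"

definition wick :: "('p \<Rightarrow> real) \<Rightarrow> ('p, 'n::finite) vfield \<Rightarrow> (real, 'p, 'n) tensor2 \<Rightarrow> (complex, 'p, 'n) tensor2" where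
  "wick \<theta> K h c p =
     transpose (wick_map \<theta> K c p) ** (\<chi> i j. complex_of_real (h c p $ i $ j)) ** wick_map \<theta> K c p"

lemma wick_static:
  fixes h :: "(real, 'p, 'n::finite) tensor2"
  assumes sym: "transpose (h c p) = h c p"
    and d1: "differential \<theta> c p \<bullet> K c p = 1"
    and orth: "\<And>v. differential \<theta> c p \<bullet> v = 0 \<Longrightarrow> bilin (h c p) v (K c p) = 0"
  shows "wick \<theta> K h c p = (\<chi> i j. complex_of_real (h c p $ i $ j
           - 2 * bilin (h c p) (K c p) (K c p) * differential \<theta> c p $ i * differential \<theta> c p $ j))"
proof -
  define H k d where "H = h c p" and "k = K c p" and "d = differential \<theta> c p"
  define q where "q = bilin H k k"
  have Hs: "H $ i $ j = H $ j $ i" for i j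
    using arg_cong[OF sym, of "\<lambda>M. M $ i $ j"] by (simp add: H_def transpose_def)
  have bl: "bilin H u v = u \<bullet> (H *v v)" for u v
    by (simp add: bilin_def inner_vec_def matrix_vector_mult_def sum_distrib_left mult.assoc)
  have Hk: "(H *v k) $ i = q * d $ i" for i
  proof -
    have "d \<bullet> (axis i 1 - (d $ i) *\<^sub>R k) = 0"
      using d1 by (simp add: d_def k_def inner_diff_right inner_axis)
    then have "bilin H (axis i 1 - (d $ i) *\<^sub>R k) k = 0"
      using orth by (simp add: H_def k_def d_def)
    then show ?thesis
      by (simp add: bl q_def inner_diff_left inner_axis' mult.commute)
  qed
  have row: "(\<Sum>b\<in>UNIV. H $ a $ b * k $ b) = q * d $ a" for a
    using Hk[of a] by (simp add: matrix_vector_mult_def)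
  have rowc: "(\<Sum>b\<in>UNIV. complex_of_real (H $ a $ b) * complex_of_real (k $ b)) = of_real (q * d $ a)" for a
    using arg_cong[OF row[of a], of complex_of_real] by simp
  have dk: "(\<Sum>a\<in>UNIV. complex_of_real (k $ a) * complex_of_real (d $ a)) = 1"
  proof -
    have "(\<Sum>a\<in>UNIV. k $ a * d $ a) = 1"
      using d1 by (simp add: inner_vec_def d_def k_def mult.commute)
    from arg_cong[OF this, of complex_of_real] show ?thesis by simp
  qed
  let ?W = "wick_map \<theta> K c p" and ?H = "\<chi> i j. complex_of_real (H $ i $ j)"
  have W: "?W $ i $ j = (if i = j then 1 else 0) + (\<i> - 1) * of_real (k $ i) * of_real (d $ j)" for i j
    by (simp add: wick_map_def k_def d_def)
  have HW: "(?H ** ?W) $ a $ j = of_real (H $ a $ j) + (\<i> - 1) * of_real (q * d $ a) * of_real (d $ j)" for a j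
  proof -
    have "(?H ** ?W) $ a $ j = (\<Sum>b\<in>UNIV. of_real (H $ a $ b) * ?W $ b $ j)"
      by (simp add: matrix_matrix_mult_def)
    moreover have "of_real (H $ a $ b) * ?W $ b $ j = of_real (H $ a $ b) * (if b = j then 1 else 0)
        + (of_real (H $ a $ b) * of_real (k $ b)) * ((\<i> - 1) * of_real (d $ j))" for b
      unfolding W distrib_left by (simp only: mult_ac)
    ultimately have "(?H ** ?W) $ a $ j = (\<Sum>b\<in>UNIV. of_real (H $ a $ b) * (if b = j then 1 else 0))
        + (\<Sum>b\<in>UNIV. of_real (H $ a $ b) * of_real (k $ b)) * ((\<i> - 1) * of_real (d $ j))"
      by (simp only: sum.distrib sum_distrib_right)
    moreover have "(\<Sum>b\<in>UNIV. complex_of_real (H $ a $ b) * (if b = j then 1 else 0)) = of_real (H $ a $ j)"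
      by (simp add: if_distrib[where f = "\<lambda>x. _ * x"] cong: if_cong)
    ultimately show ?thesis unfolding rowc by (simp only: mult_ac)
  qed
  have "(transpose ?W ** (?H ** ?W)) $ i $ j = of_real (H $ i $ j - 2 * q * d $ i * d $ j)" for i j
  proof -
    define w where "w = (\<lambda>a. (?H ** ?W) $ a $ j)"
    define C where "C = (\<i> - 1) * complex_of_real q * complex_of_real (d $ j)"
    have "of_real (k $ a) * w a = of_real (H $ j $ a) * of_real (k $ a) + of_real (k $ a) * of_real (d $ a) * C" for a
    proof -
      have "w a = of_real (H $ j $ a) + of_real (d $ a) * C"
        unfolding w_def HW C_def Hs[of a j] of_real_mult by (simp only: mult_ac)
      then show ?thesis by (simp only: distrib_left mult_ac)
    qed
    then have "(\<Sum>a\<in>UNIV. of_real (k $ a) * w a)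
        = (\<Sum>a\<in>UNIV. of_real (H $ j $ a) * of_real (k $ a)) + (\<Sum>a\<in>UNIV. of_real (k $ a) * of_real (d $ a)) * C"
      by (simp only: sum.distrib sum_distrib_right)
    also have "\<dots> = \<i> * of_real (q * d $ j)"
      unfolding rowc dk C_def by (simp add: algebra_simps)
    finally have kw: "(\<Sum>a\<in>UNIV. of_real (k $ a) * w a) = \<i> * of_real (q * d $ j)" .
    have entry: "(transpose ?W ** P) $ i $ j = (\<Sum>a\<in>UNIV. ?W $ a $ i * P $ a $ j)" for P :: "complex^'n^'n"
      by (simp add: matrix_matrix_mult_def transpose_def)
    have "(transpose ?W ** (?H ** ?W)) $ i $ j = (\<Sum>a\<in>UNIV. (if a = i then 1 else 0) * w a)
        + (\<i> - 1) * of_real (d $ i) * (\<Sum>a\<in>UNIV. of_real (k $ a) * w a)"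
      unfolding entry w_def W distrib_right sum.distrib by (simp add: sum_distrib_left mult_ac)
    also have "\<dots> = w i + (\<i> - 1) * of_real (d $ i) * (\<i> * of_real (q * d $ j))"
      by (simp add: kw if_distrib[where f = "\<lambda>x. x * _"] cong: if_cong)
    also have "\<dots> = of_real (H $ i $ j - 2 * q * d $ i * d $ j)"
      by (simp add: w_def HW algebra_simps)
    finally show ?thesis .
  qed
  then show ?thesis
    by (simp add: wick_def vec_eq_iff matrix_mul_assoc H_def k_def d_def q_def)
qed


section \<open>Holographic stress-energy tensor and mass\<close>

text \<open>
  The parameter \<open>\<sigma>\<close> is \<open>1\<close> for dS and AH metrics, whose boundary metric is Riemannian, and \<open>-1\<close>
  for AdS metrics, whose boundary metric is Lorentzian with \<open>K\<close> timelike. It is both the sign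
  convention of the stress-energy tensor and the square of the unit normal of the slice.
\<close>

definition scale :: "'k::comm_ring_1 \<Rightarrow> 'k^'n^'n \<Rightarrow> 'k^'n::finite^'n" where
  "scale t M = (\<chi> i j. t * M $ i $ j)"

definition r2 :: "'k::real_normed_field^'n^'n \<Rightarrow> 'k^'n^'n \<Rightarrow> 'k^'n::finite^'n" where
  "r2 \<gamma> g2 = - scale (trace (matrix_inv \<gamma> ** g2)) \<gamma>"

definition r4 :: "'k::real_normed_field^'n^'n \<Rightarrow> 'k^'n^'n \<Rightarrow> 'k^'n::finite^'n" where
  "r4 \<gamma> g2 = (let sq = g2 ** matrix_inv \<gamma> ** g2; tr = (\<lambda>h. trace (matrix_inv \<gamma> ** h)) in
     - scale (((tr g2)\<^sup>2 - tr sq) / 8) \<gamma> - scale (1 / 2) sq + scale (tr g2 / 4) g2)"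

text \<open>The local term for even \<open>n\<close> is specified only in dimensions 2 and 4.\<close>

definition local_term ::
  "(nat \<Rightarrow> ('k::real_normed_field, 'p, 'n::finite) tensor2) \<Rightarrow> ('k, 'p, 'n) tensor2" where
  "local_term a c p =
     (if odd (CARD('n)) then 0
      else if CARD('n) = 2 then r2 (a 0 c p) (a 2 c p)
      else if CARD('n) = 4 then r4 (a 0 c p) (a 2 c p)
      else undefined)"

definition stress_energy ::
  "real \<Rightarrow> real \<Rightarrow> (nat \<Rightarrow> ('k::real_normed_field, 'p, 'n::finite) tensor2) \<Rightarrow> ('k, 'p, 'n) tensor2" where
  "stress_energy \<sigma> G a c p =
     (- \<sigma> * real (CARD('n)) / (16 * pi * G)) *\<^sub>R (a (CARD('n)) c p + local_term a c p)"

definition scalar_vec :: "real^'n \<Rightarrow> 'k::real_normed_field^'n::finite" where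
  "scalar_vec v = (\<chi> i. of_real (v $ i))"

text \<open>\<open>\<nu> = s K + X\<close> with \<open>s > 0\<close> and \<open>X\<close> tangent to the slice, expressed by \<open>d\<theta>(\<nu>) = s\<close>.\<close>

definition unit_normal ::
  "real \<Rightarrow> ('p \<Rightarrow> real) \<Rightarrow> ('k::real_normed_field, 'p, 'n::finite) tensor2 \<Rightarrow> ('p, 'n) chart \<Rightarrow> 'p \<Rightarrow> 'k^'n" where
  "unit_normal \<sigma> \<theta> \<gamma> c p = (THE \<nu>.
     (\<forall>v. differential \<theta> c p \<bullet> v = 0 \<longrightarrow> bilin (\<gamma> c p) (scalar_vec v) \<nu> = 0) \<and>
     bilin (\<gamma> c p) \<nu> \<nu> = of_real \<sigma> \<and>
     (\<exists>s>0. (\<Sum>i\<in>UNIV. of_real (differential \<theta> c p $ i) * \<nu> $ i) = of_real s))"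

text \<open>
  Volume measure of the metric induced on the slice. In a chart whose \<open>k\<close>-th coordinate is \<open>\<theta>\<close>,
  the remaining coordinates are coordinates on the slice, and \<open>slice_gram k\<close> has the same
  determinant as the matrix of the induced metric in them. The absolute value in the density does
  nothing on a spacelike slice; it makes the definition available for complex scalars.
\<close>

definition slice_point :: "'n::finite \<Rightarrow> ('n \<Rightarrow> real) \<Rightarrow> real^'n" where
  "slice_point k y = (\<chi> i. if i = k then 0 else y i)"

definition slice_gram :: "'n::finite \<Rightarrow> 'k::comm_ring_1^'n^'n \<Rightarrow> 'k^'n^'n" where
  "slice_gram k M = (\<chi> i j. if i = k \<or> j = k then (if i = j then 1 else 0) else M $ i $ j)"

definition is_slice_volume ::
  "'p::topological_space set \<Rightarrow> ('p, 'n::finite) chart set \<Rightarrow> ('p \<Rightarrow> real) \<Rightarrow>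
   ('k::real_normed_field, 'p, 'n) tensor2 \<Rightarrow> 'p measure \<Rightarrow> bool" where
  "is_slice_volume X A \<theta> \<gamma> \<mu> \<longleftrightarrow>
     sets \<mu> = sets (restrict_space borel (slice X \<theta>)) \<and>
     (\<forall>c\<in>A. \<forall>k. (\<forall>p\<in>fst c. snd c p $ k = \<theta> p) \<longrightarrow>
        (\<forall>E\<in>sets \<mu>. E \<subseteq> fst c \<longrightarrow>
           emeasure \<mu> E = (\<integral>\<^sup>+ y. ennreal (sqrt (norm (det (slice_gram k (in_chart c (\<gamma> c) (slice_point k y))))))
              * indicator (snd c ` E) (slice_point k y) \<partial>(PiM (UNIV - {k}) (\<lambda>_. lborel)))))"

definition slice_volume ::
  "'p::topological_space set \<Rightarrow> ('p, 'n::finite) chart set \<Rightarrow> ('p \<Rightarrow> real) \<Rightarrow>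
   ('k::real_normed_field, 'p, 'n) tensor2 \<Rightarrow> 'p measure" where
  "slice_volume X A \<theta> \<gamma> = (THE \<mu>. is_slice_volume X A \<theta> \<gamma> \<mu>)"

definition chart_at :: "('p, 'n::finite) chart set \<Rightarrow> 'p \<Rightarrow> ('p, 'n) chart" where
  "chart_at A p = (SOME c. c \<in> A \<and> p \<in> fst c)"

text \<open>The integrand is a scalar, hence independent of the chart used to evaluate it.\<close>

definition holographic_mass ::
  "real \<Rightarrow> real \<Rightarrow> 'p::topological_space set \<Rightarrow> ('p, 'n::finite) chart set \<Rightarrow> ('p, 'n) vfield \<Rightarrow> ('p \<Rightarrow> real) \<Rightarrow>
   (nat \<Rightarrow> ('k::{real_normed_field, banach, second_countable_topology}, 'p, 'n) tensor2) \<Rightarrow> 'k" where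
  "holographic_mass \<sigma> G X A K \<theta> a =
     (LINT p | slice_volume X A \<theta> (a 0).
        (let c = chart_at A p in
           bilin (stress_energy \<sigma> G a c p) (scalar_vec (K c p)) (unit_normal \<sigma> \<theta> (a 0) c p)))"

end

(* The Wick rotation is the pointwise congruence by W = I + (i - 1) K d\<theta>, which fixes the kernel of
   d\<theta> and maps K to iK. Uniqueness of the coefficients of an expansion gives a_AdS j = W^T a_AH j W,
   and the local terms r_(2), r_(4) are natural under congruence. The unit normals satisfy
   W \<nu>_AdS = i \<nu>, so the two factors i produced by K and \<nu> cancel the opposite sign convention
   for T, and T_AdS(K, \<nu>_AdS) = T_AH(K, \<nu>) pointwise. The continuation turns T_AH into
   eps(n) T_dS, since r_(2) is linear and r_(4) quadratic in g_(2).

   The rotation does not change the metric tangential to the slice, so the masses are integrals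
   against the same measure. As slice_volume is a definite description, that the measure lives
   on the slice requires its existence and uniqueness. *)
theory Submission
  imports Defs "HOL-Real_Asymp.Real_Asymp"
begin

section \<open>Naturality of the stress-energy tensor under the Wick rotation\<close>

text \<open>Three objects are known only through a description: the coefficients of an expansion
  through a limit, the unit normal and the volume measure through \<open>THE\<close>. Each needs its
  own uniqueness argument. For the normal of the rotated metric the scalars are complex and
  positivity has no meaning; requiring d\<theta>(\<nu>) to be a positive real singles out one of two
  opposite vectors. For the measure, an undetermined \<open>THE\<close> could have any underlying
  space, while the integrands are compared only at points of \<open>X\<close>. The defining
  condition speaks of charts having \<theta> as a coordinate, so such charts have to be produced
  (inverse function theorem, maximality of the atlas) and their local volumes compared on overlaps.
  That comparison lives on a hyperplane, with coordinates indexed by \<open>UNIV - {k}\<close>, a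
  set and not a type; a factor [0,1] in the direction of \<theta> moves it to
  \<open>real^'n\<close>, where change of variables applies.\<close>

definition complex_matrix :: "real^'n^'m \<Rightarrow> complex^'n^'m" where
  "complex_matrix M = (\<chi> i j. complex_of_real (M $ i $ j))"

lemma complex_matrix_nth [simp]: "complex_matrix M $ i $ j = complex_of_real (M $ i $ j)"
  by (simp add: complex_matrix_def)

lemma complex_matrix_mult: "complex_matrix (A ** B) = complex_matrix A ** complex_matrix B"
  by (simp add: vec_eq_iff matrix_matrix_mult_def)

lemma complex_matrix_one: "complex_matrix (mat 1) = mat 1"
  by (simp add: vec_eq_iff mat_def)

lemma complex_matrix_0: "complex_matrix 0 = 0"
  by (simp add: vec_eq_iff)

lemma complex_matrix_add: "complex_matrix (A + B) = complex_matrix A + complex_matrix B"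
  by (simp add: vec_eq_iff)

lemma complex_matrix_scaleR: "complex_matrix (r *\<^sub>R A) = r *\<^sub>R complex_matrix A"
  unfolding vec_eq_iff by (simp add: scaleR_conv_of_real[where 'a = complex])

lemma trace_complex_matrix: "trace (complex_matrix A) = of_real (trace A)"
  by (simp add: trace_def)

section \<open>Inverse matrices and contractions under congruence\<close>

lemma matrix_inv_eqI:
  fixes A B :: "'k::semiring_1^'n^'n"
  assumes "A ** B = mat 1" "B ** A = mat 1"
  shows "matrix_inv A = B"
proof -
  let ?C = "matrix_inv A"
  have C: "A ** ?C = mat 1 \<and> ?C ** A = mat 1"
    unfolding matrix_inv_def by (rule someI[of _ B]) (simp add: assms)
  have "?C = ?C ** (A ** B)"
    by (simp add: assms matrix_mul_rid)
  also have "\<dots> = B"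
    by (simp add: matrix_mul_assoc C matrix_mul_lid)
  finally show ?thesis .
qed

lemma matrix_inv_inverse:
  fixes A :: "'k::semiring_1^'n^'n"
  assumes "invertible A"
  shows "A ** matrix_inv A = mat 1" "matrix_inv A ** A = mat 1"
proof -
  obtain B where "A ** B = mat 1" "B ** A = mat 1"
    using assms by (auto simp: invertible_def)
  then show "A ** matrix_inv A = mat 1" "matrix_inv A ** A = mat 1"
    using matrix_inv_eqI by blast+
qed

lemma invertible_complex_matrix: "invertible A \<Longrightarrow> invertible (complex_matrix A)"
  unfolding invertible_def by (metis complex_matrix_mult complex_matrix_one)

lemma matrix_inv_complex_matrix:
  fixes A :: "real^'n^'n"
  shows "invertible A \<Longrightarrow> matrix_inv (complex_matrix A) = complex_matrix (matrix_inv A)"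
  by (rule matrix_inv_eqI) (simp_all flip: complex_matrix_mult add: matrix_inv_inverse complex_matrix_one)

lemma invertible_transpose:
  fixes W :: "'k::comm_semiring_1^'n^'n"
  assumes "invertible W"
  shows "invertible (transpose W)"
  using assms unfolding invertible_def
  by (metis matrix_transpose_mul transpose_mat)

lemma transpose_matrix_inv_mult:
  fixes W :: "'k::comm_semiring_1^'n^'n"
  assumes "invertible W"
  shows "transpose W ** transpose (matrix_inv W) = mat 1" "transpose (matrix_inv W) ** transpose W = mat 1"
  using matrix_inv_inverse[OF assms] by (metis matrix_transpose_mul transpose_mat)+

lemma matrix_inv_congruence:
  fixes \<gamma> W :: "'k::comm_semiring_1^'n^'n"
  assumes W: "invertible W" and \<gamma>: "invertible \<gamma>"
  shows "matrix_inv (transpose W ** \<gamma> ** W) = matrix_inv W ** matrix_inv \<gamma> ** transpose (matrix_inv W)"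
proof (rule matrix_inv_eqI)
  note i = matrix_inv_inverse[OF W] matrix_inv_inverse[OF \<gamma>] transpose_matrix_inv_mult[OF W]
  have "transpose W ** \<gamma> ** W ** (matrix_inv W ** matrix_inv \<gamma> ** transpose (matrix_inv W))
    = transpose W ** (\<gamma> ** (W ** matrix_inv W) ** matrix_inv \<gamma>) ** transpose (matrix_inv W)"
    by (simp only: matrix_mul_assoc)
  then show "transpose W ** \<gamma> ** W ** (matrix_inv W ** matrix_inv \<gamma> ** transpose (matrix_inv W)) = mat 1"
    by (simp add: i matrix_mul_rid)
  have "matrix_inv W ** matrix_inv \<gamma> ** transpose (matrix_inv W) ** (transpose W ** \<gamma> ** W)
    = matrix_inv W ** (matrix_inv \<gamma> ** (transpose (matrix_inv W) ** transpose W) ** \<gamma>) ** W"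
    by (simp only: matrix_mul_assoc)
  then show "matrix_inv W ** matrix_inv \<gamma> ** transpose (matrix_inv W) ** (transpose W ** \<gamma> ** W) = mat 1"
    by (simp add: i matrix_mul_rid)
qed

text \<open>The inverse metric contributes the inverses of \<open>W\<close> and of its transpose:
  one pair cancels inside the product, the other is a conjugation, which the trace does not
  see.\<close>

lemma trace_matrix_inv_congruence:
  fixes \<gamma> W h :: "'k::comm_semiring_1^'n^'n"
  assumes W: "invertible W" and \<gamma>: "invertible \<gamma>"
  shows "trace (matrix_inv (transpose W ** \<gamma> ** W) ** (transpose W ** h ** W)) = trace (matrix_inv \<gamma> ** h)"
proof -
  have "matrix_inv (transpose W ** \<gamma> ** W) ** (transpose W ** h ** W)
    = matrix_inv W ** (matrix_inv \<gamma> ** (transpose (matrix_inv W) ** transpose W) ** h ** W)"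
    unfolding matrix_inv_congruence[OF assms] by (simp only: matrix_mul_assoc)
  also have "\<dots> = matrix_inv W ** (matrix_inv \<gamma> ** h ** W)"
    by (simp add: transpose_matrix_inv_mult[OF W] matrix_mul_rid)
  finally show ?thesis
    by (simp only: trace_mul_sym[of "matrix_inv W"]) (simp add: matrix_inv_inverse[OF W] matrix_mul_rid flip: matrix_mul_assoc)
qed

lemma square_congruence:
  fixes \<gamma> W h :: "'k::comm_semiring_1^'n^'n"
  assumes W: "invertible W" and \<gamma>: "invertible \<gamma>"
  shows "transpose W ** h ** W ** matrix_inv (transpose W ** \<gamma> ** W) ** (transpose W ** h ** W)
    = transpose W ** (h ** matrix_inv \<gamma> ** h) ** W"
proof -
  have "transpose W ** h ** W ** matrix_inv (transpose W ** \<gamma> ** W) ** (transpose W ** h ** W)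
    = transpose W ** h ** (W ** matrix_inv W) ** matrix_inv \<gamma> ** (transpose (matrix_inv W) ** transpose W) ** h ** W"
    unfolding matrix_inv_congruence[OF assms] by (simp only: matrix_mul_assoc)
  also have "\<dots> = transpose W ** (h ** matrix_inv \<gamma> ** h) ** W"
    by (simp add: transpose_matrix_inv_mult[OF W] matrix_inv_inverse[OF W] matrix_mul_rid matrix_mul_assoc)
  finally show ?thesis .
qed

lemma matrix_diff_ldistrib: "(A::'k::ring_1^'n^'m) ** (B - C) = A ** B - A ** C"
  by (simp add: vec_eq_iff matrix_matrix_mult_def right_diff_distrib sum_subtractf)

lemma matrix_diff_rdistrib: "((A::'k::ring_1^'n^'m) - B) ** C = A ** C - B ** C"
  by (simp add: vec_eq_iff matrix_matrix_mult_def left_diff_distrib sum_subtractf)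

lemma matrix_minus_left: "(- (A::'k::ring_1^'n^'m)) ** C = - (A ** C)"
  by (simp add: vec_eq_iff matrix_matrix_mult_def sum_negf)

lemma matrix_minus_right: "(A::'k::ring_1^'n^'m) ** (- C) = - (A ** C)"
  by (simp add: vec_eq_iff matrix_matrix_mult_def sum_negf)

lemma matrix_add_rdistrib: "((A::'k::semiring_1^'n^'m) + B) ** C = A ** C + B ** C"
  by (simp add: vec_eq_iff matrix_matrix_mult_def distrib_right sum.distrib)

lemma scale_mult_left: "scale t A ** B = scale t (A ** B)"
  by (simp add: vec_eq_iff matrix_matrix_mult_def scale_def sum_distrib_left mult_ac)

lemma scale_mult_right: "A ** scale t B = scale t (A ** B)"
  by (simp add: vec_eq_iff matrix_matrix_mult_def scale_def sum_distrib_left mult_ac)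

lemma matrix_mult_scaleR_left: "(r *\<^sub>R A) ** B = r *\<^sub>R (A ** (B::'k::real_normed_field^'n^'m))"
  by (simp add: vec_eq_iff matrix_matrix_mult_def scaleR_sum_right)

lemma matrix_mult_scaleR_right: "A ** (r *\<^sub>R B) = r *\<^sub>R (A ** (B::'k::real_normed_field^'n^'m))"
  by (simp add: vec_eq_iff matrix_matrix_mult_def scaleR_sum_right)

lemma r2_congruence:
  fixes W \<gamma> h :: "'k::real_normed_field^'n^'n"
  assumes "invertible W" "invertible \<gamma>"
  shows "r2 (transpose W ** \<gamma> ** W) (transpose W ** h ** W) = transpose W ** r2 \<gamma> h ** W"
  unfolding r2_def trace_matrix_inv_congruence[OF assms]
  by (simp add: matrix_minus_left matrix_minus_right scale_mult_left scale_mult_right)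

lemma r4_congruence:
  fixes W \<gamma> h :: "'k::real_normed_field^'n^'n"
  assumes "invertible W" "invertible \<gamma>"
  shows "r4 (transpose W ** \<gamma> ** W) (transpose W ** h ** W) = transpose W ** r4 \<gamma> h ** W"
  unfolding r4_def Let_def square_congruence[OF assms] trace_matrix_inv_congruence[OF assms]
  by (simp add: matrix_minus_left matrix_minus_right matrix_diff_ldistrib matrix_diff_rdistrib
      matrix_add_ldistrib matrix_add_rdistrib scale_mult_left scale_mult_right)

lemma scale_complex_matrix: "scale (of_real t) (complex_matrix M) = complex_matrix (scale t M)"
  by (simp add: vec_eq_iff scale_def)

lemma complex_matrix_minus: "complex_matrix (- A) = - complex_matrix A"
  by (simp add: vec_eq_iff)

lemma complex_matrix_diff: "complex_matrix (A - B) = complex_matrix A - complex_matrix B"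
  by (simp add: vec_eq_iff)

text \<open>The rotation embeds the real metric into complex matrices before the congruence acts, so
  the local terms must also commute with this embedding. Invertibility of \<gamma> is what ties the
  complex \<open>matrix_inv\<close> to the real one.\<close>

lemma r2_complex_matrix:
  "invertible \<gamma> \<Longrightarrow> r2 (complex_matrix \<gamma>) (complex_matrix h) = complex_matrix (r2 \<gamma> h)"
  by (simp only: r2_def matrix_inv_complex_matrix trace_complex_matrix scale_complex_matrix
      flip: complex_matrix_mult complex_matrix_minus)

lemma r4_complex_matrix:
  assumes "invertible \<gamma>"
  shows "r4 (complex_matrix \<gamma>) (complex_matrix h) = complex_matrix (r4 \<gamma> h)"
proof -
  have s: "complex_of_real t / numeral k = of_real (t / numeral k)" for t k by simp
  have s2: "1 / 2 = complex_of_real (1 / 2)" by simp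
  show ?thesis
    by (simp only: r4_def Let_def matrix_inv_complex_matrix[OF assms] trace_complex_matrix s s2 scale_complex_matrix
        flip: complex_matrix_mult complex_matrix_minus complex_matrix_diff complex_matrix_add of_real_power of_real_diff)
qed

lemma r2_minus: "r2 \<gamma> (- h) = - r2 \<gamma> h"
  by (simp add: r2_def matrix_minus_right trace_def sum_negf) (simp add: vec_eq_iff scale_def)

lemma r4_minus: "r4 \<gamma> (- h) = r4 \<gamma> h"
  by (simp add: r4_def Let_def matrix_minus_right matrix_minus_left trace_def sum_negf) (simp add: vec_eq_iff scale_def)

section \<open>Bilinear forms and the unit normal\<close>

lemma bilin_alt: "bilin M u v = (\<Sum>i\<in>UNIV. u $ i * (M *v v) $ i)"
  by (simp add: bilin_def matrix_vector_mult_def sum_distrib_left mult.assoc)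

lemma bilin_congruence:
  "bilin (transpose W ** M ** W) u v = bilin M (W *v u) (W *v v)"
proof -
  have "bilin (transpose W ** M ** W) u v = (\<Sum>i\<in>UNIV. u $ i * (transpose W *v (M *v (W *v v))) $ i)"
    by (simp add: bilin_alt matrix_vector_mul_assoc matrix_mul_assoc)
  also have "\<dots> = (\<Sum>i\<in>UNIV. \<Sum>j\<in>UNIV. W $ j $ i * u $ i * (M *v (W *v v)) $ j)"
    by (subst matrix_vector_mult_def) (simp add: transpose_def sum_distrib_left mult_ac)
  also have "\<dots> = (\<Sum>j\<in>UNIV. (\<Sum>i\<in>UNIV. W $ j $ i * u $ i) * (M *v (W *v v)) $ j)"
    by (subst sum.swap) (simp add: sum_distrib_right)
  moreover have Wu: "(W *v u) $ j = (\<Sum>i\<in>UNIV. W $ j $ i * u $ i)" for j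
    by (simp add: matrix_vector_mult_def)
  ultimately show ?thesis
    by (simp add: bilin_alt[of M "W *v u"] Wu)
qed

lemma bilin_complex_matrix:
  "bilin (complex_matrix M) (scalar_vec u) (scalar_vec v) = of_real (bilin M u v)"
  by (simp add: bilin_def scalar_vec_def)

lemma bilin_scaleR_matrix: "bilin (r *\<^sub>R M) u v = r *\<^sub>R bilin M u (v::'k::real_normed_field^'n)"
  by (simp add: bilin_def scaleR_sum_right)

lemma bilin_vector_scalar: "bilin M (a *s u) (b *s v) = a * b * bilin M u v"
  by (simp add: bilin_def sum_distrib_left mult_ac)

lemma scalar_vec_real [simp]: "scalar_vec v = v"
  by (simp add: scalar_vec_def)

text \<open>After extension of scalars the kernel of \<open>d\<close> is still spanned by real
  vectors, so real test vectors suffice. The projections of the basis vectors to the kernel along an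
  axis with \<open>d $ k\<close> nonzero express every entry of \<open>w\<close> through
  \<open>w $ k\<close>.\<close>

lemma annihilator_of_kernel:
  fixes d :: "real^'n::finite" and w :: "'k::real_normed_field^'n"
  assumes "d \<noteq> 0"
    and "\<And>v. d \<bullet> v = 0 \<Longrightarrow> (\<Sum>i\<in>UNIV. of_real (v $ i) * w $ i) = 0"
  shows "\<exists>\<mu>. w = \<mu> *s scalar_vec d"
proof -
  obtain k where k: "d $ k \<noteq> 0"
    using \<open>d \<noteq> 0\<close> by (auto simp: vec_eq_iff)
  have wi: "w $ i = w $ k / of_real (d $ k) * of_real (d $ i)" for i
  proof -
    define v where "v = axis i 1 - (d $ i / d $ k) *\<^sub>R axis k (1::real)"
    have "d \<bullet> v = 0"
      using k by (simp add: v_def inner_diff_right inner_axis)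
    then have "(\<Sum>j\<in>UNIV. of_real (v $ j) * w $ j) = 0"
      by (rule assms(2))
    moreover have *: "of_real (v $ j) * w $ j = (if i = j then w $ j else 0) - of_real (d $ i / d $ k) * (if k = j then w $ j else 0)" for j
      by (simp add: v_def axis_def)
    moreover have "(\<Sum>j\<in>UNIV. of_real (v $ j) * w $ j) = w $ i - of_real (d $ i / d $ k) * w $ k"
      unfolding * sum_subtractf sum_distrib_left[symmetric] by simp
    ultimately have "w $ i - of_real (d $ i / d $ k) * w $ k = 0"
      by simp
    then show ?thesis by (simp add: mult_ac)
  qed
  have "w = (w $ k / of_real (d $ k)) *s scalar_vec d"
    unfolding vec_eq_iff
  proof
    show "w $ i = ((w $ k / of_real (d $ k)) *s scalar_vec d) $ i" for i
      by (subst wi) (simp add: scalar_vec_def)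
  qed
  then show ?thesis ..
qed

text \<open>Orthogonality to the kernel of d\<theta> forces \<Gamma>\<nu> to be a multiple of
  d\<theta>, so any two candidates are proportional. With factors \<mu>, \<open>l\<close> and values
  \<open>s\<close>, \<open>t\<close> under d\<theta>, proportionality gives \<mu>t = ls and equality
  of squares gives \<mu>s = lt. Eliminating \<open>l\<close> yields t^2 = s^2, and \<open>s\<close>,
  \<open>t\<close> are positive reals whatever the scalar field is.\<close>

lemma unit_normal_eqI:
  fixes \<gamma> :: "('k::real_normed_field, 'p, 'n::finite) tensor2" and \<nu> :: "'k^'n"
  assumes inv: "invertible (\<gamma> c p)" and d: "differential \<theta> c p \<noteq> 0"
    and orth: "\<And>v. differential \<theta> c p \<bullet> v = 0 \<Longrightarrow> bilin (\<gamma> c p) (scalar_vec v) \<nu> = 0"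
    and sq: "bilin (\<gamma> c p) \<nu> \<nu> = of_real \<sigma>"
    and pos: "s > 0" "(\<Sum>i\<in>UNIV. of_real (differential \<theta> c p $ i) * \<nu> $ i) = of_real s"
  shows "unit_normal \<sigma> \<theta> \<gamma> c p = \<nu>"
  unfolding unit_normal_def
proof (rule the_equality)
  show "(\<forall>v. differential \<theta> c p \<bullet> v = 0 \<longrightarrow> bilin (\<gamma> c p) (scalar_vec v) \<nu> = 0) \<and>
     bilin (\<gamma> c p) \<nu> \<nu> = of_real \<sigma> \<and>
     (\<exists>s>0. (\<Sum>i\<in>UNIV. of_real (differential \<theta> c p $ i) * \<nu> $ i) = of_real s)"
    using assms by blast
next
  define d where "d = differential \<theta> c p"
  define \<Gamma> where "\<Gamma> = \<gamma> c p"
  note defs = d_def[symmetric] \<Gamma>_def[symmetric]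
  have normal: "\<exists>\<mu>. \<Gamma> *v \<eta> = \<mu> *s scalar_vec d"
    if "\<forall>v. d \<bullet> v = 0 \<longrightarrow> bilin \<Gamma> (scalar_vec v) \<eta> = 0" for \<eta>
    using annihilator_of_kernel[of d "\<Gamma> *v \<eta>"] that assms(2)
    by (auto simp: bilin_alt defs scalar_vec_def)
  define dot where "dot \<eta> = (\<Sum>i\<in>UNIV. of_real (d $ i) * \<eta> $ i)" for \<eta> :: "'k^'n"
  obtain \<mu> where \<mu>: "\<Gamma> *v \<nu> = \<mu> *s scalar_vec d"
    using normal orth by (auto simp: defs)
  have sq_eq: "bilin \<Gamma> \<eta> \<eta> = \<mu> * dot \<eta>" if "\<Gamma> *v \<eta> = \<mu> *s scalar_vec d" for \<eta> \<mu>
    by (simp add: bilin_alt that scalar_vec_def dot_def sum_distrib_left mult_ac)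
  fix \<eta>
  assume \<eta>: "(\<forall>v. differential \<theta> c p \<bullet> v = 0 \<longrightarrow> bilin (\<gamma> c p) (scalar_vec v) \<eta> = 0) \<and>
     bilin (\<gamma> c p) \<eta> \<eta> = of_real \<sigma> \<and>
     (\<exists>s>0. (\<Sum>i\<in>UNIV. of_real (differential \<theta> c p $ i) * \<eta> $ i) = of_real s)"
  then obtain t where t: "t > 0" "dot \<eta> = of_real t"
    by (auto simp: dot_def defs)
  obtain l where l: "\<Gamma> *v \<eta> = l *s scalar_vec d"
    using normal \<eta> by (auto simp: defs)
  have s: "dot \<nu> = of_real s"
    using pos by (simp add: dot_def defs)
  have "invertible \<Gamma>" using inv by (simp add: defs)
  have zero: "x = 0" if "\<Gamma> *v x = 0" for x
    using arg_cong[OF that, of "(*v) (matrix_inv \<Gamma>)"]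
    by (simp add: matrix_vector_mul_assoc matrix_inv_inverse[OF \<open>invertible \<Gamma>\<close>])
  have "\<mu> \<noteq> 0"
    using \<mu> zero[of \<nu>] s \<open>s > 0\<close> by (auto simp: dot_def)
  have "\<Gamma> *v (\<mu> *s \<eta> - l *s \<nu>) = 0"
    by (simp add: matrix_vector_mult_diff_distrib vector_scalar_commute \<mu> l)
  then have lin: "\<mu> *s \<eta> = l *s \<nu>"
    using zero by force
  then have "\<mu> * \<eta> $ i = l * \<nu> $ i" for i
    by (simp add: vec_eq_iff)
  then have "\<mu> * dot \<eta> = l * dot \<nu>"
    by (simp add: dot_def sum_distrib_left mult.left_commute[of _ "of_real _"])
  \<comment> \<open>Both sides are the common square \<sigma>: by \<open>sq_eq\<close> the square of
    a normal is its covector factor times its value under d\<theta>.\<close>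
  moreover have "\<mu> * dot \<nu> = l * dot \<eta>"
    using sq_eq[OF \<mu>] sq_eq[OF l] sq \<eta> by (simp add: defs)
  ultimately have 1: "\<mu> * of_real t = l * of_real s" "\<mu> * of_real s = l * of_real t"
    by (simp_all add: s t)
  then have "\<mu> * (of_real t * of_real t) = \<mu> * (of_real s * of_real s)"
    by (metis mult.assoc mult.commute)
  then have "(of_real (t * t) :: 'k) = of_real (s * s)"
    using \<open>\<mu> \<noteq> 0\<close> by simp
  then have "t * t = s * s" 
    by (simp only: of_real_eq_iff)
  then have "t = s"
    using \<open>t > 0\<close> \<open>s > 0\<close> by (metis abs_of_pos real_sqrt_abs2)
  then have "l = \<mu>"
    using 1 \<open>s > 0\<close> by simp
  then show "\<eta> = \<nu>"
    using lin \<open>\<mu> \<noteq> 0\<close> by (simp add: vec_eq_iff)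
qed

lemma invertible_if_positive:
  fixes \<gamma> :: "real^'n^'n"
  assumes "\<And>v. v \<noteq> 0 \<Longrightarrow> bilin \<gamma> v v > 0"
  shows "invertible \<gamma>"
proof -
  have "x = 0" if "\<gamma> *v x = 0" for x
    using assms[of x] that by (force simp: bilin_alt)
  then show ?thesis
    by (metis invertible_left_inverse matrix_left_invertible_ker)
qed

text \<open>The normal is the gradient \<open>n\<close> of \<theta> divided by its length
  \<open>sqrt q\<close>. Pairing with \<open>n\<close> is d\<theta>, so the positive number
  d\<theta>(\<nu>) is that same length.\<close>

lemma riemannian_unit_normal:
  fixes \<gamma> :: "(real, 'p, 'n::finite) tensor2"
  assumes pos: "\<And>v. v \<noteq> 0 \<Longrightarrow> bilin (\<gamma> c p) v v > 0"
    and d: "differential \<theta> c p \<noteq> 0"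
  obtains \<nu> s where "unit_normal 1 \<theta> \<gamma> c p = \<nu>" "\<And>v. differential \<theta> c p \<bullet> v = 0 \<Longrightarrow> bilin (\<gamma> c p) v \<nu> = 0"
    "bilin (\<gamma> c p) \<nu> \<nu> = 1" "s > 0" "differential \<theta> c p \<bullet> \<nu> = s"
proof -
  define d where "d = differential \<theta> c p"
  define \<Gamma> where "\<Gamma> = \<gamma> c p"
  have inv: "invertible \<Gamma>"
    using pos invertible_if_positive by (auto simp: \<Gamma>_def)
  define n where "n = matrix_inv \<Gamma> *v d"
  have \<Gamma>n: "\<Gamma> *v n = d"
    by (simp add: n_def matrix_vector_mul_assoc matrix_inv_inverse[OF inv])
  then have "n \<noteq> 0"
    using d by (auto simp: d_def)
  define q where "q = bilin \<Gamma> n n"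
  have q: "q > 0"
    using pos \<open>n \<noteq> 0\<close> by (simp add: q_def \<Gamma>_def)
  have bl: "bilin \<Gamma> v n = d \<bullet> v" for v
    by (simp add: bilin_alt \<Gamma>n inner_vec_def mult.commute)
  define \<nu> where "\<nu> = (1 / sqrt q) *s n"
  have 1: "bilin \<Gamma> v \<nu> = 1 / sqrt q * (d \<bullet> v)" for v
    using bilin_vector_scalar[of \<Gamma> 1 v "1 / sqrt q" n] by (simp add: \<nu>_def bl)
  have 2: "bilin \<Gamma> \<nu> \<nu> = 1"
    using q by (simp add: \<nu>_def bilin_vector_scalar real_div_sqrt flip: q_def) 
  have 3: "d \<bullet> \<nu> = sqrt q"
    using 1[of \<nu>] 2 q by (simp add: field_simps)
  have orth: "bilin (\<gamma> c p) v \<nu> = 0" if "differential \<theta> c p \<bullet> v = 0" for v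
    using 1[of v] that by (simp add: \<Gamma>_def d_def)
  have pos': "sqrt q > 0" using q by simp
  have "unit_normal 1 \<theta> \<gamma> c p = \<nu>"
  proof (rule unit_normal_eqI[OF _ d _ _ pos'])
    show "(\<Sum>i\<in>UNIV. of_real (differential \<theta> c p $ i) * \<nu> $ i) = of_real (sqrt q)"
      using 3 by (simp add: inner_vec_def d_def)
    show "invertible (\<gamma> c p)" using inv by (simp add: \<Gamma>_def)
    show "bilin (\<gamma> c p) \<nu> \<nu> = of_real 1" using 2 by (simp add: \<Gamma>_def)
  qed (simp add: orth)
  then show thesis
    using that orth 2[unfolded \<Gamma>_def] pos' 3[unfolded d_def] by blast
qed

section \<open>The rotation matrix and the rotated unit normal\<close>

lemma wick_map_vector:
  fixes K :: "('p, 'n::finite) vfield" and x :: "complex^'n"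
  shows "wick_map \<theta> K c p *v x = x + ((\<i> - 1) * (\<Sum>j\<in>UNIV. of_real (differential \<theta> c p $ j) * x $ j)) *s scalar_vec (K c p)"
proof -
  have "(\<Sum>j\<in>UNIV. ((if i = j then 1 else 0) + (\<i> - 1) * complex_of_real (K c p $ i * differential \<theta> c p $ j)) * x $ j)
     = (\<Sum>j\<in>UNIV. (if i = j then x $ j else 0)) + (\<i> - 1) * (\<Sum>j\<in>UNIV. of_real (differential \<theta> c p $ j) * x $ j) * of_real (K c p $ i)" for i
    unfolding sum_distrib_left sum_distrib_right sum.distrib[symmetric]
    by (rule sum.cong) (auto simp: algebra_simps)
  then show ?thesis
    by (simp add: vec_eq_iff matrix_vector_mult_def wick_map_def scalar_vec_def)
qed

text \<open>The inverse is the same rank-one perturbation of the identity with -i in place of i,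
  namely the map \<open>L\<close>: it fixes the kernel of d\<theta> and sends \<open>K\<close> to
  -iK.\<close>

lemma invertible_wick_map:
  fixes K :: "('p, 'n::finite) vfield"
  assumes "differential \<theta> c p \<bullet> K c p = 1"
  shows "invertible (wick_map \<theta> K c p)"
proof -
  have dK: "(\<Sum>j\<in>UNIV. complex_of_real (differential \<theta> c p $ j) * of_real (K c p $ j)) = 1"
    using arg_cong[OF assms, of complex_of_real] by (simp add: inner_vec_def)
  define L where "L x = x + ((- \<i> - 1) * (\<Sum>j\<in>UNIV. of_real (differential \<theta> c p $ j) * x $ j)) *s scalar_vec (K c p)" for x :: "complex^'n"
  have "L (wick_map \<theta> K c p *v x) = x" for x
  proof -
    define s where "s = (\<Sum>j\<in>UNIV. of_real (differential \<theta> c p $ j) * x $ j)"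
    have "(\<Sum>j\<in>UNIV. of_real (differential \<theta> c p $ j) * (wick_map \<theta> K c p *v x) $ j)
        = s + (\<i> - 1) * s * (\<Sum>j\<in>UNIV. of_real (differential \<theta> c p $ j) * of_real (K c p $ j))"
      unfolding wick_map_vector s_def[symmetric] sum_distrib_left
      by (subst s_def) (simp add: scalar_vec_def distrib_left sum.distrib mult_ac)
    also have "\<dots> = \<i> * s"
      unfolding dK by (simp add: algebra_simps)
    finally show ?thesis
      by (simp add: L_def wick_map_vector flip: s_def) (simp add: vec_eq_iff algebra_simps)
  qed
  then have "wick_map \<theta> K c p *v x = 0 \<Longrightarrow> x = 0" for x
    by (metis L_def add.right_neutral matrix_vector_mult_0_right)
  then show ?thesis
    by (metis invertible_left_inverse matrix_left_invertible_ker)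
qed

lemma wick_congruence:
  "wick \<theta> K h c p = transpose (wick_map \<theta> K c p) ** complex_matrix (h c p) ** wick_map \<theta> K c p"
  by (simp add: wick_def complex_matrix_def)

text \<open>Since the rotated metric is the congruence by W, its normals are the preimages under W
  of multiples of \<nu>, and the square -1 leaves the multiples i and -i. The inverse of W
  multiplies values of d\<theta> by -i, so i\<nu> is sent to a vector with value \<open>s\<close>
  and -i\<nu> to one with value -\<open>s\<close>; the factor i is the positive choice.\<close>

lemma wick_unit_normal:
  fixes \<gamma> :: "(real, 'p, 'n::finite) tensor2"
  assumes pos: "\<And>v. v \<noteq> 0 \<Longrightarrow> bilin (\<gamma> c p) v v > 0"
    and dK: "differential \<theta> c p \<bullet> K c p = 1"
    and \<gamma>': "\<gamma>' c p = wick \<theta> K \<gamma> c p"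
  shows "wick_map \<theta> K c p *v unit_normal (-1) \<theta> \<gamma>' c p = \<i> *s scalar_vec (unit_normal 1 \<theta> \<gamma> c p)"
proof -
  define d W where "d = differential \<theta> c p" and "W = wick_map \<theta> K c p"
  have d0: "d \<noteq> 0" using dK by (auto simp: d_def)
  obtain \<nu> s where \<nu>: "unit_normal 1 \<theta> \<gamma> c p = \<nu>" "\<And>v. d \<bullet> v = 0 \<Longrightarrow> bilin (\<gamma> c p) v \<nu> = 0"
    "bilin (\<gamma> c p) \<nu> \<nu> = 1" "s > 0" "d \<bullet> \<nu> = s"
    using riemannian_unit_normal[where \<gamma> = \<gamma>, OF pos, where \<theta> = \<theta>] d0 unfolding d_def by metis
  have dKc: "(\<Sum>j\<in>UNIV. complex_of_real (d $ j) * of_real (K c p $ j)) = 1"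
    using arg_cong[OF dK, of complex_of_real] by (simp add: inner_vec_def d_def)
  have d\<nu>: "(\<Sum>j\<in>UNIV. complex_of_real (d $ j) * of_real (\<nu> $ j)) = of_real s"
    using arg_cong[OF \<nu>(5), of complex_of_real] by (simp add: inner_vec_def)
  \<comment> \<open>This is the inverse of W applied to i\<nu>: the coefficient of \<open>K\<close>
    is (-i - 1) times i\<open>s\<close>.\<close>
  define \<eta> where "\<eta> = \<i> *s scalar_vec \<nu> + ((1 - \<i>) * of_real s) *s scalar_vec (K c p)"
  have "(\<Sum>j\<in>UNIV. of_real (d $ j) * \<eta> $ j)
     = \<i> * (\<Sum>j\<in>UNIV. complex_of_real (d $ j) * of_real (\<nu> $ j))
       + (1 - \<i>) * of_real s * (\<Sum>j\<in>UNIV. complex_of_real (d $ j) * of_real (K c p $ j))"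
    by (simp add: \<eta>_def scalar_vec_def distrib_left sum.distrib sum_distrib_left mult_ac)
  then have d\<eta>: "(\<Sum>j\<in>UNIV. of_real (d $ j) * \<eta> $ j) = of_real s"
    unfolding dKc d\<nu> by (simp add: algebra_simps)
  have W\<eta>: "W *v \<eta> = \<i> *s scalar_vec \<nu>"
    unfolding W_def wick_map_vector d_def[symmetric] d\<eta> by (simp add: \<eta>_def vec_eq_iff algebra_simps)
  have W: "invertible W"
    using invertible_wick_map[where K = K, OF dK] by (simp add: W_def)
  have inv: "invertible (\<gamma>' c p)"
    unfolding \<gamma>' wick_congruence W_def[symmetric]
    by (intro invertible_mult invertible_transpose W invertible_complex_matrix invertible_if_positive pos)
  have "unit_normal (-1) \<theta> \<gamma>' c p = \<eta>"
  proof (rule unit_normal_eqI[where \<gamma> = \<gamma>', OF inv])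
    fix v assume v: "differential \<theta> c p \<bullet> v = 0"
    have "(\<Sum>j\<in>UNIV. complex_of_real (d $ j) * scalar_vec v $ j) = 0"
      using arg_cong[OF v, of complex_of_real] by (simp add: inner_vec_def d_def scalar_vec_def)
    then have "W *v scalar_vec v = scalar_vec v"
      by (simp add: W_def wick_map_vector d_def vec_eq_iff)
    then show "bilin (\<gamma>' c p) (scalar_vec v) \<eta> = 0"
      using \<nu>(2)[of v] v bilin_vector_scalar[of "complex_matrix (\<gamma> c p)" 1 "scalar_vec v" \<i> "scalar_vec \<nu>"]
      by (simp add: \<gamma>' wick_congruence bilin_congruence W_def[symmetric] W\<eta> bilin_complex_matrix d_def)
  next
    show "bilin (\<gamma>' c p) \<eta> \<eta> = of_real (- 1)"
      by (simp add: \<gamma>' wick_congruence bilin_congruence W_def[symmetric] W\<eta> bilin_vector_scalar bilin_complex_matrix \<nu>)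
  qed (use d0 d\<eta> \<open>s > 0\<close> in \<open>auto simp: d_def\<close>)
  then show ?thesis
    using W\<eta> by (simp add: W_def \<nu>)
qed

lemma wick_bilin_normal:
  fixes \<gamma> :: "(real, 'p, 'n::finite) tensor2"
  assumes pos: "\<And>v. v \<noteq> 0 \<Longrightarrow> bilin (\<gamma> c p) v v > 0"
    and dK: "differential \<theta> c p \<bullet> K c p = 1"
    and \<gamma>': "\<gamma>' c p = wick \<theta> K \<gamma> c p"
  shows "bilin (wick \<theta> K T c p) (scalar_vec (K c p)) (unit_normal (-1) \<theta> \<gamma>' c p)
    = - of_real (bilin (T c p) (K c p) (unit_normal 1 \<theta> \<gamma> c p))"
proof -
  have dKc: "(\<Sum>j\<in>UNIV. complex_of_real (differential \<theta> c p $ j) * of_real (K c p $ j)) = 1"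
    using arg_cong[OF dK, of complex_of_real] by (simp add: inner_vec_def)
  have "wick_map \<theta> K c p *v scalar_vec (K c p) = \<i> *s scalar_vec (K c p)"
    unfolding wick_map_vector scalar_vec_def using dKc by (simp add: vec_eq_iff algebra_simps)
  then show ?thesis
    using wick_unit_normal[where \<gamma> = \<gamma> and \<gamma>' = \<gamma>' and \<theta> = \<theta>, OF pos dK \<gamma>']
    by (simp add: wick_congruence bilin_congruence bilin_vector_scalar bilin_complex_matrix)
qed

section \<open>Fefferman--Graham coefficients of the rotated metric\<close>

text \<open>Coefficients vanish from the lowest order upwards, because for m < n the logarithmic
  term r^(n-m) ln r still tends to 0. At order n only D_n + (ln r) H is left; dividing by ln r
  isolates \<open>H\<close>, and then D_n follows.\<close>

lemma fg_coefficients_zero: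
  fixes D :: "nat \<Rightarrow> 'a::real_normed_vector"
  assumes lim: "((\<lambda>r. inverse (r ^ n) *\<^sub>R ((\<Sum>j\<le>n. r ^ j *\<^sub>R D j) + (r ^ n * ln r) *\<^sub>R H)) \<longlongrightarrow> 0) (at_right 0)"
  shows "j \<le> n \<Longrightarrow> D j = 0" and "H = 0"
proof -
  have ev: "eventually (\<lambda>r::real. r > 0) (at_right 0)"
    by (rule eventually_at_right_less)
  have pow: "((\<lambda>r::real. r ^ k) \<longlongrightarrow> 0) (at_right 0)" if "k > 0" for k
    using that by real_asymp
  have powln: "((\<lambda>r::real. r ^ k * ln r) \<longlongrightarrow> 0) (at_right 0)" if "k > 0" for k
    using that by real_asymp
  have low: "D m = 0" if "m < n" for m
    using that
  proof (induction m rule: less_induct)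
    case (less m)
    \<comment> \<open>The factor r^(n-m) weakens the normalisation from r^(-n) to r^(-m). The limit
      stays 0, while the terms below order m vanish by induction and those above it tend to
      0.\<close>
    have "((\<lambda>r. r ^ (n - m) *\<^sub>R (inverse (r ^ n) *\<^sub>R ((\<Sum>j\<le>n. r ^ j *\<^sub>R D j) + (r ^ n * ln r) *\<^sub>R H))) \<longlongrightarrow> 0 *\<^sub>R 0) (at_right 0)"
      by (rule tendsto_scaleR[OF pow lim]) (use less in simp)
    moreover have "((\<lambda>r. r ^ (n - m) *\<^sub>R (inverse (r ^ n) *\<^sub>R ((\<Sum>j\<le>n. r ^ j *\<^sub>R D j) + (r ^ n * ln r) *\<^sub>R H))) \<longlongrightarrow> D m) (at_right 0)"
    proof (rule Lim_transform_eventually)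
      have "((\<lambda>r. D m + (\<Sum>j\<in>{m<..n}. r ^ (j - m) *\<^sub>R D j) + (r ^ (n - m) * ln r) *\<^sub>R H) \<longlongrightarrow> D m + (\<Sum>j\<in>{m<..n}. 0 *\<^sub>R D j) + 0 *\<^sub>R H) (at_right 0)"
        by (intro tendsto_intros pow powln) (use less in auto)
      then show "((\<lambda>r. D m + (\<Sum>j\<in>{m<..n}. r ^ (j - m) *\<^sub>R D j) + (r ^ (n - m) * ln r) *\<^sub>R H) \<longlongrightarrow> D m) (at_right 0)"
        by simp
      have "D m + (\<Sum>j\<in>{m<..n}. r ^ (j - m) *\<^sub>R D j) + (r ^ (n - m) * ln r) *\<^sub>R H
         = r ^ (n - m) *\<^sub>R (inverse (r ^ n) *\<^sub>R ((\<Sum>j\<le>n. r ^ j *\<^sub>R D j) + (r ^ n * ln r) *\<^sub>R H))" if "r > 0" for r :: real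
      proof -
        have i: "r ^ (n - m) * inverse (r ^ n) = inverse (r ^ m)"
          using that less.prems by (simp add: power_diff field_simps)
        have split: "{..n} = {..<m} \<union> {m} \<union> {m<..n}" using less.prems by auto
        have "(\<Sum>j\<le>n. r ^ j *\<^sub>R D j) = (\<Sum>j<m. r ^ j *\<^sub>R D j) + r ^ m *\<^sub>R D m + (\<Sum>j\<in>{m<..n}. r ^ j *\<^sub>R D j)"
          unfolding split by (subst sum.union_disjoint; auto)+
        also have "(\<Sum>j<m. r ^ j *\<^sub>R D j) = 0"
          using less by simp
        finally have s: "(\<Sum>j\<le>n. r ^ j *\<^sub>R D j) = r ^ m *\<^sub>R D m + (\<Sum>j\<in>{m<..n}. r ^ j *\<^sub>R D j)"
          by simp
        have t: "inverse (r ^ m) *\<^sub>R (\<Sum>j\<in>{m<..n}. r ^ j *\<^sub>R D j) = (\<Sum>j\<in>{m<..n}. r ^ (j - m) *\<^sub>R D j)"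
          unfolding scaleR_sum_right
        proof (rule sum.cong[OF refl])
          fix j assume "j \<in> {m<..n}"
          then have "inverse (r ^ m) * r ^ j = r ^ (j - m)"
            using that by (simp add: power_diff field_simps)
          then show "inverse (r ^ m) *\<^sub>R r ^ j *\<^sub>R D j = r ^ (j - m) *\<^sub>R D j"
            by simp
        qed
        have u: "inverse (r ^ m) * r ^ m = 1" "inverse (r ^ m) * (r ^ n * ln r) = r ^ (n - m) * ln r"
          using that less.prems by (simp_all add: power_diff field_simps)
        show ?thesis
          unfolding scaleR_scaleR[of "r ^ (n - m)"] i unfolding s scaleR_add_right t unfolding scaleR_scaleR u by simp
      qed
      then show "\<forall>\<^sub>F r in at_right 0. D m + (\<Sum>j\<in>{m<..n}. r ^ (j - m) *\<^sub>R D j) + (r ^ (n - m) * ln r) *\<^sub>R H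
         = r ^ (n - m) *\<^sub>R (inverse (r ^ n) *\<^sub>R ((\<Sum>j\<le>n. r ^ j *\<^sub>R D j) + (r ^ n * ln r) *\<^sub>R H))"
        by (intro eventually_mono[OF ev])
    qed
    ultimately show "D m = 0"
      using tendsto_unique[OF trivial_limit_at_right_real] by force
  qed
  have top: "((\<lambda>r. D n + ln r *\<^sub>R H) \<longlongrightarrow> 0) (at_right 0)"
  proof (rule Lim_transform_eventually[OF lim])
    have "inverse (r ^ n) *\<^sub>R ((\<Sum>j\<le>n. r ^ j *\<^sub>R D j) + (r ^ n * ln r) *\<^sub>R H) = D n + ln r *\<^sub>R H" if "r > 0" for r :: real
    proof -
      have "(\<Sum>j\<le>n. r ^ j *\<^sub>R D j) = (\<Sum>j<n. r ^ j *\<^sub>R D j) + r ^ n *\<^sub>R D n"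
        by (simp flip: lessThan_Suc_atMost)
      then have "(\<Sum>j\<le>n. r ^ j *\<^sub>R D j) = r ^ n *\<^sub>R D n"
        using low by simp
      then show ?thesis
        using that by (simp add: scaleR_add_right)
    qed
    then show "\<forall>\<^sub>F r in at_right 0. inverse (r ^ n) *\<^sub>R ((\<Sum>j\<le>n. r ^ j *\<^sub>R D j) + (r ^ n * ln r) *\<^sub>R H) = D n + ln r *\<^sub>R H"
      by (intro eventually_mono[OF ev])
  qed
  have il: "((\<lambda>r::real. inverse (ln r)) \<longlongrightarrow> 0) (at_right 0)"
    by real_asymp
  have "((\<lambda>r. inverse (ln r) *\<^sub>R (D n + ln r *\<^sub>R H) - inverse (ln r) *\<^sub>R D n) \<longlongrightarrow> 0 *\<^sub>R 0 - 0 *\<^sub>R D n) (at_right 0)"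
    by (intro tendsto_intros il top)
  \<comment> \<open>The restriction to r < 1 keeps ln r away from 0, where \<open>inverse\<close>
    would return 0 instead of cancelling.\<close>
  moreover have "\<forall>\<^sub>F r in at_right 0. inverse (ln r) *\<^sub>R (D n + ln r *\<^sub>R H) - inverse (ln r) *\<^sub>R D n = H"
    using eventually_at_right_less[of "0::real"] eventually_at_right_real[of 0 "1::real", simplified]
    by eventually_elim (simp add: scaleR_add_right)
  ultimately have "((\<lambda>r::real. H) \<longlongrightarrow> 0) (at_right 0)"
    using Lim_transform_eventually by force
  then show H: "H = 0"
    by (simp add: tendsto_const_iff)
  have "D n = 0"
    using top by (simp add: H tendsto_const_iff)
  then show "j \<le> n \<Longrightarrow> D j = 0"
    using low by (cases "j = n") auto
qed

lemma
  shows wick_add: "wick \<theta> K (\<lambda>c p. h c p + k c p) c p = wick \<theta> K h c p + wick \<theta> K k c p"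
    and wick_diff: "wick \<theta> K (\<lambda>c p. h c p - k c p) c p = wick \<theta> K h c p - wick \<theta> K k c p"
    and wick_scaleR: "wick \<theta> K (\<lambda>c p. r *\<^sub>R h c p) c p = r *\<^sub>R wick \<theta> K h c p"
  by (simp_all add: wick_congruence complex_matrix_add complex_matrix_diff complex_matrix_scaleR
      matrix_add_ldistrib matrix_add_rdistrib matrix_diff_ldistrib matrix_diff_rdistrib
      matrix_mult_scaleR_left matrix_mult_scaleR_right)

lemma wick_zero: "h c p = 0 \<Longrightarrow> wick \<theta> K h c p = 0"
  by (simp add: wick_congruence complex_matrix_0)

lemma wick_sum: "wick \<theta> K (\<lambda>c p. \<Sum>j\<in>J. h j c p) c p = (\<Sum>j\<in>J. wick \<theta> K (h j) c p)"
  by (induction J rule: infinite_finite_induct) (simp_all add: wick_zero wick_add)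

lemma continuous_wick: "continuous_on UNIV (\<lambda>M. wick \<theta> K (\<lambda>c p. M) c p)"
  unfolding wick_congruence
  by (auto simp: complex_matrix_def matrix_matrix_mult_def intro!: continuous_intros continuous_on_vec_lambda)

text \<open>At a fixed point the rotation is a continuous real-linear map independent of r, so it
  can be applied to the remainder of the unrotated expansion. Subtracting the given expansion of the
  rotated metric leaves an expansion of zero, whose coefficients all vanish.\<close>

lemma fg_expansion_wick:
  fixes A :: "('p, 'n::finite) chart set"
  assumes exp: "fg_expansion A g a h" and exp': "fg_expansion A (\<lambda>r. wick \<theta> K (g r)) a' h'"
    and "c \<in> A" "p \<in> fst c" "j \<le> CARD('n)"
  shows "a' j c p = wick \<theta> K (a j) c p"
proof -
  let ?n = "CARD('n)"
  define L where "L M = wick \<theta> K (\<lambda>c p. M) c p" for M :: "real^'n^'n"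
  have LL: "wick \<theta> K u c p = L (u c p)" for u
    by (simp add: L_def wick_congruence)
  have L: "L (x + y) = L x + L y" "L (x - y) = L x - L y" "L (r *\<^sub>R x) = r *\<^sub>R L x" "L (sum f J) = (\<Sum>j\<in>J. L (f j))" "L 0 = 0"
    for x y r and f :: "nat \<Rightarrow> real^'n^'n" and J
    unfolding L_def by (rule wick_add wick_diff wick_scaleR wick_sum wick_zero refl)+
  have "isCont L 0"
    using continuous_wick[of \<theta> K c p] by (simp add: L_def[abs_def] continuous_on_eq_continuous_at)
  have "((\<lambda>r. inverse (r ^ ?n) *\<^sub>R (g r c p - (\<Sum>j\<le>?n. r ^ j *\<^sub>R a j c p) - (r ^ ?n * ln r) *\<^sub>R h c p)) \<longlongrightarrow> 0) (at_right 0)"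
    using exp assms by (auto simp: fg_expansion_def)
  then have "((\<lambda>r. L (inverse (r ^ ?n) *\<^sub>R (g r c p - (\<Sum>j\<le>?n. r ^ j *\<^sub>R a j c p) - (r ^ ?n * ln r) *\<^sub>R h c p))) \<longlongrightarrow> L 0) (at_right 0)"
    by (rule isCont_tendsto_compose[OF \<open>isCont L 0\<close>])
  moreover have "((\<lambda>r. inverse (r ^ ?n) *\<^sub>R (L (g r c p) - (\<Sum>j\<le>?n. r ^ j *\<^sub>R a' j c p) - (r ^ ?n * ln r) *\<^sub>R h' c p)) \<longlongrightarrow> 0) (at_right 0)"
    unfolding LL[of "g _", symmetric] using exp' assms(3,4) unfolding fg_expansion_def by blast
  ultimately have "((\<lambda>r. L (inverse (r ^ ?n) *\<^sub>R (g r c p - (\<Sum>j\<le>?n. r ^ j *\<^sub>R a j c p) - (r ^ ?n * ln r) *\<^sub>R h c p))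
     - inverse (r ^ ?n) *\<^sub>R (L (g r c p) - (\<Sum>j\<le>?n. r ^ j *\<^sub>R a' j c p) - (r ^ ?n * ln r) *\<^sub>R h' c p)) \<longlongrightarrow> L 0 - 0) (at_right 0)"
    by (rule tendsto_diff)
  moreover have "L (inverse (r ^ ?n) *\<^sub>R (g r c p - (\<Sum>j\<le>?n. r ^ j *\<^sub>R a j c p) - (r ^ ?n * ln r) *\<^sub>R h c p))
     - inverse (r ^ ?n) *\<^sub>R (L (g r c p) - (\<Sum>j\<le>?n. r ^ j *\<^sub>R a' j c p) - (r ^ ?n * ln r) *\<^sub>R h' c p)
     = inverse (r ^ ?n) *\<^sub>R ((\<Sum>j\<le>?n. r ^ j *\<^sub>R (a' j c p - L (a j c p))) + (r ^ ?n * ln r) *\<^sub>R (h' c p - L (h c p)))" for r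
  proof -
    have "L (g r c p - (\<Sum>j\<le>?n. r ^ j *\<^sub>R a j c p) - (r ^ ?n * ln r) *\<^sub>R h c p)
     - (L (g r c p) - (\<Sum>j\<le>?n. r ^ j *\<^sub>R a' j c p) - (r ^ ?n * ln r) *\<^sub>R h' c p)
     = (\<Sum>j\<le>?n. r ^ j *\<^sub>R (a' j c p - L (a j c p))) + (r ^ ?n * ln r) *\<^sub>R (h' c p - L (h c p))"
      by (simp only: L scaleR_diff_right sum_subtractf) simp
    then show ?thesis
      by (simp only: L(3) scaleR_diff_right[symmetric])
  qed
  ultimately have "((\<lambda>r. inverse (r ^ ?n) *\<^sub>R ((\<Sum>j\<le>?n. r ^ j *\<^sub>R (a' j c p - L (a j c p))) + (r ^ ?n * ln r) *\<^sub>R (h' c p - L (h c p)))) \<longlongrightarrow> 0) (at_right 0)"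
    by (simp add: L(5))
  from fg_coefficients_zero(1)[OF this \<open>j \<le> ?n\<close>] show ?thesis
    by (simp add: LL)
qed

section \<open>Local terms and stress-energy tensors\<close>

lemma local_term_wick:
  fixes a :: "nat \<Rightarrow> (real, 'p, 'n::finite) tensor2"
  assumes inv: "invertible (a 0 c p)" and dK: "differential \<theta> c p \<bullet> K c p = 1"
    and wick: "\<And>j. j \<le> CARD('n) \<Longrightarrow> a' j c p = wick \<theta> K (a j) c p"
    and n: "odd (CARD('n)) \<or> CARD('n) = 2 \<or> CARD('n) = 4"
  shows "local_term a' c p = wick \<theta> K (local_term a) c p"
proof -
  have W: "invertible (wick_map \<theta> K c p)"
    using invertible_wick_map[where K = K, OF dK] .
  note inv' = invertible_complex_matrix[OF inv]
  consider "odd (CARD('n))" | "CARD('n) = 2" | "CARD('n) = 4"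
    using n by blast
  then show ?thesis
  proof cases
    case 1
    then show ?thesis
      by (simp add: local_term_def wick_congruence complex_matrix_0)
  next
    case 2
    then have "local_term a' c p = r2 (wick \<theta> K (a 0) c p) (wick \<theta> K (a 2) c p)"
      by (simp add: local_term_def wick)
    also have "\<dots> = wick \<theta> K (\<lambda>c p. r2 (a 0 c p) (a 2 c p)) c p"
      by (simp only: wick_congruence r2_congruence[OF W inv'] r2_complex_matrix[OF inv])
    finally show ?thesis
      using 2 by (simp add: local_term_def wick_congruence)
  next
    case 3
    then have "local_term a' c p = r4 (wick \<theta> K (a 0) c p) (wick \<theta> K (a 2) c p)"
      by (simp add: local_term_def wick)
    also have "\<dots> = wick \<theta> K (\<lambda>c p. r4 (a 0 c p) (a 2 c p)) c p"
      by (simp only: wick_congruence r4_congruence[OF W inv'] r4_complex_matrix[OF inv])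
    finally show ?thesis
      using 3 by (simp add: local_term_def wick_congruence)
  qed
qed

text \<open>The minus sign is only the opposite sign convention of AdS metrics; the rotation itself
  acts on the top coefficient and on the local term by one and the same congruence.\<close>

lemma stress_energy_wick:
  fixes a :: "nat \<Rightarrow> (real, 'p, 'n::finite) tensor2"
  assumes inv: "invertible (a 0 c p)" and dK: "differential \<theta> c p \<bullet> K c p = 1"
    and wick: "\<And>j. j \<le> CARD('n) \<Longrightarrow> a' j c p = wick \<theta> K (a j) c p"
    and n: "odd (CARD('n)) \<or> CARD('n) = 2 \<or> CARD('n) = 4"
  shows "stress_energy (-1) G a' c p = - wick \<theta> K (stress_energy 1 G a) c p"
proof -
  have "wick \<theta> K (stress_energy 1 G a) c p = (- real (CARD('n)) / (16 * pi * G)) *\<^sub>R (wick \<theta> K (a (CARD('n))) c p + wick \<theta> K (local_term a) c p)"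
    unfolding stress_energy_def[abs_def] wick_scaleR wick_add by simp
  then show ?thesis
    using local_term_wick[where a = a and a' = a' and K = K, OF assms] wick[of "CARD('n)"]
    by (simp add: stress_energy_def)
qed

text \<open>The two summands acquire \<open>eps\<close> for different reasons: the top coefficient
  by definition of the continuation, the local term by its parity in g_(2). In dimension 2, g_(2) is
  itself the top coefficient and changes sign by eps(2) = -1; in dimension 4 it is a lower
  coefficient and changes sign by (-1)^1, which the quadratic \<open>r4\<close> does not
  notice.\<close>

lemma stress_energy_continuation:
  fixes a :: "nat \<Rightarrow> (real, 'p, 'n::finite) tensor2"
  assumes "AH_continuation A a b" "c \<in> A" "p \<in> fst c"
    and n: "odd (CARD('n)) \<or> CARD('n) = 2 \<or> CARD('n) = 4"
  shows "stress_energy 1 G b c p = eps (CARD('n)) *\<^sub>R stress_energy 1 G a c p"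
proof -
  have b: "b 0 c p = a 0 c p" "\<And>k. 2 * k < CARD('n) \<Longrightarrow> b (2 * k) c p = (-1) ^ k *\<^sub>R a (2 * k) c p"
    "b (CARD('n)) c p = eps (CARD('n)) *\<^sub>R a (CARD('n)) c p"
    using assms by (auto simp: AH_continuation_def)
  have "local_term b c p = eps (CARD('n)) *\<^sub>R local_term a c p"
    using n
  proof (elim disjE)
    assume "CARD('n) = 2"
    then show ?thesis using b(1,3) by (simp add: local_term_def eps_def r2_minus)
  next
    assume "CARD('n) = 4"
    then show ?thesis using b(1) b(2)[of 1] by (simp add: local_term_def eps_def r4_minus)
  qed (simp add: local_term_def)
  then show ?thesis
    by (simp add: stress_energy_def b algebra_simps)
qed

section \<open>Change of variables\<close>

text \<open>
  The library states the change of variables formula for wellordered index types. The type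
  \<open>'n wo\<close> is a copy of a finite type \<open>'n\<close> with an arbitrary wellorder.
\<close>

typedef 'n wo = "UNIV :: 'n set"
  by simp

lemma surj_Rep_wo: "range Rep_wo = UNIV"
  using type_definition.Rep_range[OF type_definition_wo] .

lemma UNIV_wo: "(UNIV :: 'n wo set) = range Abs_wo"
  by (rule surjI[symmetric]) (rule Rep_wo_inverse)

instance wo :: (finite) finite
  by standard (simp add: UNIV_wo)

definition wo_index :: "'n::finite wo \<Rightarrow> nat" where
  "wo_index = (SOME f. inj f)"

lemma inj_wo_index: "inj (wo_index :: 'n::finite wo \<Rightarrow> nat)"
proof -
  have "\<exists>(f :: 'n wo \<Rightarrow> nat) n. f ` UNIV = {i. i < n} \<and> inj f"
    by (rule finite_imp_inj_to_nat_seg) simp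
  then have "\<exists>f :: 'n wo \<Rightarrow> nat. inj f"
    by (elim exE conjE) (rule exI)
  then show ?thesis
    unfolding wo_index_def by (rule someI_ex)
qed

instantiation wo :: (finite) wellorder
begin

definition less_eq_wo :: "'a wo \<Rightarrow> 'a wo \<Rightarrow> bool" where
  "x \<le> y \<longleftrightarrow> wo_index x \<le> wo_index y"

definition less_wo :: "'a wo \<Rightarrow> 'a wo \<Rightarrow> bool" where
  "x < y \<longleftrightarrow> wo_index x < wo_index y"

instance
proof
  fix x y z :: "'a wo"
  show "x < y \<longleftrightarrow> x \<le> y \<and> \<not> y \<le> x"
    by (auto simp: less_eq_wo_def less_wo_def)
  show "x \<le> x"
    by (simp add: less_eq_wo_def)
  show "x \<le> y \<Longrightarrow> y \<le> z \<Longrightarrow> x \<le> z"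
    by (simp add: less_eq_wo_def)
  show "x \<le> y \<Longrightarrow> y \<le> x \<Longrightarrow> x = y"
    unfolding less_eq_wo_def using inj_wo_index by (metis injD order_antisym)
  show "x \<le> y \<or> y \<le> x"
    by (auto simp: less_eq_wo_def)
next
  fix P :: "'a wo \<Rightarrow> bool" and a
  assume *: "\<And>x. (\<And>y. y < x \<Longrightarrow> P y) \<Longrightarrow> P x"
  show "P a"
  proof (induction a rule: measure_induct_rule[of wo_index])
    case (less x)
    show ?case
      by (rule *) (rule less, simp add: less_wo_def)
  qed
qed

end

section \<open>Determinants under relabelling of the indices\<close>

lemma swapidseq_conjugate:
  assumes "swapidseq n p" "bij e"
  shows "swapidseq n (inv e \<circ> p \<circ> e)"
  using assms(1)
proof induction
  case id
  then show ?case
    using \<open>bij e\<close> by (simp add: bij_is_inj fun_eq_iff)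
next
  case (comp_Suc n p a b)
  have s: "e (inv e x) = x" for x
    using \<open>bij e\<close> by (simp add: bij_is_surj surj_f_inv_f)
  have i: "inv e x = inv e y \<longleftrightarrow> x = y" for x y
    by (metis s)
  \<comment> \<open>Conjugation turns a transposition into the transposition of the preimages, so
    the number of factors is preserved even though \<open>e\<close> may change the type.\<close>
  have "inv e \<circ> (Transposition.transpose a b \<circ> p) \<circ> e = Transposition.transpose (inv e a) (inv e b) \<circ> (inv e \<circ> p \<circ> e)"
    by (auto simp: fun_eq_iff Transposition.transpose_def i)
  moreover have "inv e a \<noteq> inv e b"
    using comp_Suc i by simp
  ultimately show ?case
    using comp_Suc by (metis swapidseq.comp_Suc)
qed

lemma sign_conjugate:
  assumes "permutation p" "bij e"
  shows "sign (inv e \<circ> p \<circ> e) = sign p"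
proof -
  obtain n where n: "swapidseq n p"
    using assms by (auto simp: permutation_def)
  show ?thesis
    using evenperm_unique[OF n refl] evenperm_unique[OF swapidseq_conjugate[OF n \<open>bij e\<close>] refl]
    by (simp add: sign_def)
qed

text \<open>Conjugation by \<open>e\<close> matches the permutations of the two index types and
  keeps their signs, so the Leibniz sums agree term by term.\<close>

lemma det_reindex:
  fixes M :: "'k::comm_ring_1^'n::finite^'n" and e :: "'m::finite \<Rightarrow> 'n"
  assumes "bij e"
  shows "det (\<chi> i j. M $ e i $ e j) = det M"
proof -
  have ie: "inv e (e x) = x" and ei: "e (inv e y) = y" for x y
    using \<open>bij e\<close> by (simp_all add: bij_is_inj bij_is_surj surj_f_inv_f)
  let ?c = "\<lambda>p. inv e \<circ> p \<circ> e" and ?d = "\<lambda>q. e \<circ> q \<circ> inv e"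
  have bij': "bij (inv e)"
    using \<open>bij e\<close> by (rule bij_imp_bij_inv)
  have "det M = (\<Sum>p | p permutes UNIV. of_int (sign p) * (\<Prod>i\<in>UNIV. M $ i $ p i))"
    by (simp add: det_def)
  also have "\<dots> = (\<Sum>q | q permutes UNIV. of_int (sign q) * (\<Prod>i\<in>UNIV. (\<chi> i j. M $ e i $ e j) $ i $ q i))"
  proof (rule sum.reindex_bij_witness[where i = ?d and j = ?c])
    fix p :: "'n \<Rightarrow> 'n" assume "p \<in> {p. p permutes UNIV}"
    then have p: "bij p" by (simp add: permutes_univ bij_iff)
    show "?d (?c p) = p"
      by (simp add: fun_eq_iff ei)
    show "?c p \<in> {q. q permutes UNIV}"
      using p \<open>bij e\<close> bij' by (simp add: permutes_univ bij_comp flip: bij_iff)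
    have "(\<Prod>i\<in>UNIV. M $ e i $ e (?c p i)) = (\<Prod>i\<in>UNIV. M $ i $ p i)"
      using prod.reindex_bij_betw[OF \<open>bij e\<close>, of "\<lambda>i. M $ i $ p i"] by (simp add: ei)
    moreover have "permutation p"
      using p by (simp add: permutation)
    ultimately show "of_int (sign (?c p)) * (\<Prod>i\<in>UNIV. (\<chi> i j. M $ e i $ e j) $ i $ ?c p i) =
         of_int (sign p) * (\<Prod>i\<in>UNIV. M $ i $ p i)"
      using sign_conjugate[OF _ \<open>bij e\<close>] by simp
  next
    fix q :: "'m \<Rightarrow> 'm" assume "q \<in> {p. p permutes UNIV}"
    then have q: "bij q" by (simp add: permutes_univ bij_iff)
    show "?c (?d q) = q"
      by (simp add: fun_eq_iff ie)
    show "?d q \<in> {q. q permutes UNIV}"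
      using q \<open>bij e\<close> bij' by (simp add: permutes_univ bij_comp flip: bij_iff)
  qed
  finally show ?thesis
    by (simp add: det_def)
qed

text \<open>For nonnegative functions integrability is absolute, and a finite gauge integral is the
  Lebesgue integral. The equivalence is stated for each real value \<open>b\<close>, which lets
  infinite integrals be handled by exclusion.\<close>

lemma absolutely_integrable_iff_nn_integral:
  fixes F :: "'a::euclidean_space \<Rightarrow> real"
  assumes nonneg: "\<And>x. x \<in> S \<Longrightarrow> 0 \<le> F x" and meas: "(\<lambda>x. F x * indicator S x) \<in> borel_measurable borel"
  shows "F absolutely_integrable_on S \<and> integral S F = b \<longleftrightarrow>
    (\<integral>\<^sup>+ x. ennreal (F x) * indicator S x \<partial>lborel) = ennreal b \<and> 0 \<le> b"
proof -
  let ?F = "\<lambda>x. F x * indicator S x"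
  have "F absolutely_integrable_on S \<and> integral S F = b \<longleftrightarrow> (F has_integral b) S"
    by (simp add: absolutely_integrable_on_iff_nonneg[OF nonneg] has_integral_iff)
  also have "\<dots> \<longleftrightarrow> ((\<lambda>x. if x \<in> S then F x else 0) has_integral b) UNIV"
    by (rule has_integral_restrict_UNIV[symmetric])
  also have "(\<lambda>x. if x \<in> S then F x else 0) = ?F"
    by (auto simp: indicator_def)
  also have "(?F has_integral b) UNIV \<longleftrightarrow> ?F \<in> lebesgue \<rightarrow>\<^sub>M borel \<and> integral\<^sup>N lebesgue ?F = b \<and> 0 \<le> b"
    by (rule has_integral_iff_nn_integral_lebesgue) (auto simp: indicator_def nonneg)
  also have "integral\<^sup>N lebesgue ?F = (\<integral>\<^sup>+ x. ennreal (F x) * indicator S x \<partial>lborel)"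
    by (subst nn_integral_completion, intro nn_integral_cong) (auto simp: indicator_def)
  finally show ?thesis
    using meas by (simp add: measurable_completion)
qed

text \<open>The formula for absolutely integrable functions says that both sides take a given finite
  value simultaneously; hence they are also infinite simultaneously.\<close>

lemma nn_integral_change_of_variables_wo:
  fixes g :: "real^'n::{finite,wellorder} \<Rightarrow> real^'n::_" and f :: "real^'n::_ \<Rightarrow> real"
  assumes S: "S \<in> sets borel"
    and der: "\<And>x. x \<in> S \<Longrightarrow> (g has_derivative g' x) (at x within S)"
    and inj: "inj_on g S"
    and nonneg: "\<And>y. y \<in> g ` S \<Longrightarrow> 0 \<le> f y"
    and meas: "(\<lambda>x. \<bar>det (matrix (g' x))\<bar> * f (g x) * indicator S x) \<in> borel_measurable borel"
      "(\<lambda>y. f y * indicator (g ` S) y) \<in> borel_measurable borel"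
  shows "(\<integral>\<^sup>+ x. ennreal (\<bar>det (matrix (g' x))\<bar> * f (g x)) * indicator S x \<partial>lborel)
    = (\<integral>\<^sup>+ y. ennreal (f y) * indicator (g ` S) y \<partial>lborel)" (is "?L = ?R")
proof -
  have "S \<in> sets lebesgue"
    using S by simp
  \<comment> \<open>The formula is for vector-valued integrands, so the scalar one is read as a
    vector in \<open>real^1\<close>.\<close>
  then have cov: "(\<lambda>x. \<bar>det (matrix (g' x))\<bar> * f (g x)) absolutely_integrable_on S \<and> integral S (\<lambda>x. \<bar>det (matrix (g' x))\<bar> * f (g x)) = b
    \<longleftrightarrow> f absolutely_integrable_on (g ` S) \<and> integral (g ` S) f = b" for b
    using has_absolute_integral_change_of_variables[OF _ der inj, of "\<lambda>x. vec (f x) :: real^1" "vec b"]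
    by (simp add: absolutely_integrable_on_1_iff integral_on_1_eq)
  have *: "?L = ennreal b \<longleftrightarrow> ?R = ennreal b" if "b \<ge> 0" for b
    using that cov[of b]
      absolutely_integrable_iff_nn_integral[OF _ meas(1), of b]
      absolutely_integrable_iff_nn_integral[OF _ meas(2), of b] nonneg
    by (simp only: imageI mult_nonneg_nonneg abs_ge_zero simp_thms)
  show ?thesis
  proof (cases ?L)
    case (real r)
    then show ?thesis using *[of r] by simp
  next
    \<comment> \<open>A finite right-hand side would by \<open>*\<close> be the value of the
      left-hand side as well.\<close>
    case top
    show ?thesis
    proof (cases ?R)
      case (real r)
      then show ?thesis using *[of r] by simp
    qed (simp add: top)
  qed
qed

section \<open>Lebesgue measure and integrals under relabelling of the axes\<close>

lemma prod_Basis_vec: "(\<Prod>b\<in>Basis. (x :: real^'n::finite) \<bullet> b) = (\<Prod>i\<in>UNIV. x $ i)"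
proof -
  have B: "Basis = range (\<lambda>i :: 'n. axis i (1::real))"
    by (auto simp: Basis_vec_def)
  have inj: "inj (\<lambda>i :: 'n. axis i (1::real))"
    by (auto simp: inj_def axis_eq_axis)
  show ?thesis
    unfolding B prod.reindex[OF inj] by (simp add: inner_axis)
qed

definition to_wo :: "real^'n \<Rightarrow> real^('n::finite wo)" where
  "to_wo x = (\<chi> a. x $ Rep_wo a)"

definition of_wo :: "real^('n wo) \<Rightarrow> real^'n::finite" where
  "of_wo y = (\<chi> i. y $ Abs_wo i)"

lemma of_to_wo [simp]: "of_wo (to_wo x) = x"
  by (simp add: of_wo_def to_wo_def Abs_wo_inverse)

lemma to_of_wo [simp]: "to_wo (of_wo x) = x"
  by (simp add: of_wo_def to_wo_def Rep_wo_inverse)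

lemma linear_to_wo: "linear to_wo" and linear_of_wo: "linear of_wo"
  by (auto intro!: linearI simp: of_wo_def to_wo_def vec_eq_iff)

lemma measurable_wo [measurable]: "to_wo \<in> borel_measurable borel" "of_wo \<in> borel_measurable borel"
  by (intro borel_measurable_continuous_onI linear_continuous_on linear_conv_bounded_linear[THEN iffD1] linear_to_wo linear_of_wo)+

lemma bij_Rep_wo: "bij Rep_wo"
  by (simp add: bij_def surj_Rep_wo inj_def Rep_wo_inject)

text \<open>Lebesgue measure is characterised by its values on boxes, and relabelling the axes only
  permutes the side lengths of a box.\<close>

lemma lborel_wo: "lborel = distr lborel borel (to_wo :: real^'n::finite \<Rightarrow> _)"
proof (rule lborel_eqI)
  fix l u :: "real^('n wo)" assume le: "\<And>b. b \<in> Basis \<Longrightarrow> l \<bullet> b \<le> u \<bullet> b"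
  have "l $ a \<le> u $ a" for a
    using le[of "axis a 1"] by (simp add: inner_axis axis_in_Basis_iff)
  then have "\<And>b. b \<in> Basis \<Longrightarrow> of_wo l \<bullet> b \<le> of_wo u \<bullet> b"
    by (auto simp: Basis_vec_def inner_axis of_wo_def)
  then have "emeasure lborel (box (of_wo l) (of_wo u)) = (\<Prod>b\<in>Basis. (of_wo u - of_wo l) \<bullet> b)"
    by (rule emeasure_lborel_box)
  also have "(\<Prod>b\<in>Basis. (of_wo u - of_wo l) \<bullet> b) = (\<Prod>i\<in>UNIV. (u - l) $ Abs_wo i)"
    unfolding prod_Basis_vec by (simp add: of_wo_def)
  also have "\<dots> = (\<Prod>b\<in>Basis. (u - l) \<bullet> b)"
    unfolding prod_Basis_vec
    using prod.reindex_bij_betw[OF bij_Rep_wo, of "\<lambda>i. (u - l) $ Abs_wo i"] by (simp add: Rep_wo_inverse)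
  also have "box (of_wo l) (of_wo u) = to_wo -` box l u"
    by (auto simp: mem_box_cart of_wo_def to_wo_def) (metis Rep_wo_inverse Abs_wo_inverse UNIV_I)+
  finally show "emeasure (distr lborel borel to_wo) (box l u) = (\<Prod>b\<in>Basis. (u - l) \<bullet> b)"
    by (simp add: emeasure_distr)
qed simp

text \<open>Everything is conjugated by the relabelling \<open>to_wo\<close>: it preserves Lebesgue
  measure and, by \<open>det_reindex\<close>, the Jacobian determinant.\<close>

lemma nn_integral_change_of_variables:
  fixes g :: "real^'n::finite \<Rightarrow> real^'n" and f :: "real^'n \<Rightarrow> real"
  assumes S: "S \<in> sets borel"
    and der: "\<And>x. x \<in> S \<Longrightarrow> (g has_derivative g' x) (at x within S)"
    and inj: "inj_on g S"
    and nonneg: "\<And>y. y \<in> g ` S \<Longrightarrow> 0 \<le> f y"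
    and meas: "(\<lambda>x. \<bar>det (matrix (g' x))\<bar> * f (g x) * indicator S x) \<in> borel_measurable borel"
      "(\<lambda>y. f y * indicator (g ` S) y) \<in> borel_measurable borel"
  shows "(\<integral>\<^sup>+ x. ennreal (\<bar>det (matrix (g' x))\<bar> * f (g x)) * indicator S x \<partial>lborel)
    = (\<integral>\<^sup>+ y. ennreal (f y) * indicator (g ` S) y \<partial>lborel)"
proof -
  define T where "T = of_wo -` S"
  define G where "G = to_wo \<circ> g \<circ> of_wo"
  define G' where "G' y = to_wo \<circ> g' (of_wo y) \<circ> of_wo" for y
  have T: "T = to_wo ` S"
    by (auto simp: T_def image_iff) (metis to_of_wo)
  have GT: "G ` T = of_wo -` (g ` S)"
  proof safe
    fix y z assume "of_wo y = g z" "z \<in> S"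
    then have "y = G (to_wo z)" "to_wo z \<in> T"
      by (auto simp: G_def T_def) (metis to_of_wo)
    then show "y \<in> G ` T" by blast
  qed (auto simp: G_def T_def)
  have det: "det (matrix (G' y)) = det (matrix (g' (of_wo y)))" for y
  proof -
    have ax: "of_wo (axis a (1::real)) = axis (Rep_wo a) 1" for a :: "'n wo"
      by (auto simp: of_wo_def axis_def vec_eq_iff) (metis Abs_wo_inverse Rep_wo_inverse UNIV_I)+
    have "matrix (G' y) = (\<chi> a b. matrix (g' (of_wo y)) $ Rep_wo a $ Rep_wo b)"
      by (simp add: matrix_def G'_def to_wo_def ax)
    then show ?thesis
      by (simp add: det_reindex[OF bij_Rep_wo])
  qed
  have ind: "indicator T y = indicator S (of_wo y)" "indicator (G ` T) y = indicator (g ` S) (of_wo y)" for y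
    unfolding GT by (simp_all add: T_def indicator_def)
  have Gy: "of_wo (G y) = g (of_wo y)" for y
    by (simp add: G_def)
  have main: "(\<integral>\<^sup>+ y. ennreal (\<bar>det (matrix (G' y))\<bar> * f (of_wo (G y))) * indicator T y \<partial>lborel)
    = (\<integral>\<^sup>+ y. ennreal (f (of_wo y)) * indicator (G ` T) y \<partial>lborel)"
  proof (rule nn_integral_change_of_variables_wo)
    show "T \<in> sets borel"
      unfolding T_def using measurable_sets[OF measurable_wo(2) S] by simp
    show "(G has_derivative G' y) (at y within T)" if "y \<in> T" for y
    proof -
      have "(g has_derivative g' (of_wo y)) (at (of_wo y) within of_wo ` T)"
        using der[of "of_wo y"] that by (auto simp: T image_image)
      then have "(g \<circ> of_wo has_derivative g' (of_wo y) \<circ> of_wo) (at y within T)"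
        by (rule diff_chain_within[OF linear_imp_has_derivative[OF linear_of_wo]])
      then show ?thesis
        unfolding G_def G'_def comp_assoc
        by (rule diff_chain_within[OF _ linear_imp_has_derivative[OF linear_to_wo]])
    qed
    show "inj_on G T"
      using inj by (auto simp: G_def T_def inj_on_def) (metis of_to_wo to_of_wo)
    show "0 \<le> f (of_wo y)" if "y \<in> G ` T" for y
      using that nonneg by (simp add: GT)
    have "(\<lambda>x. \<bar>det (matrix (g' (of_wo x)))\<bar> * f (g (of_wo x)) * indicator S (of_wo x)) \<in> borel_measurable borel"
      using measurable_compose[OF measurable_wo(2) meas(1)] .
    then show "(\<lambda>y. \<bar>det (matrix (G' y))\<bar> * f (of_wo (G y)) * indicator T y) \<in> borel_measurable borel"
      by (simp add: det ind G_def)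
    show "(\<lambda>y. f (of_wo y) * indicator (G ` T) y) \<in> borel_measurable borel"
      using measurable_compose[OF measurable_wo(2) meas(2)] by (simp add: ind)
  qed
  have transfer: "(\<integral>\<^sup>+ y. h (of_wo y) \<partial>lborel) = (\<integral>\<^sup>+ x. h x \<partial>lborel)"
    if "h \<in> borel_measurable borel" for h :: "real^'n \<Rightarrow> ennreal"
    by (subst lborel_wo) (use that in \<open>simp add: nn_integral_distr\<close>)
  have m: "(\<lambda>x. ennreal (F x) * indicator B x) \<in> borel_measurable borel"
    if "(\<lambda>x. F x * indicator B x) \<in> borel_measurable borel" for F and B :: "(real^'n) set"
  proof -
    have "(\<lambda>x. ennreal (F x) * indicator B x) = (\<lambda>x. ennreal (F x * indicator B x))"
      by (auto simp: indicator_def)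
    then show ?thesis using that by simp
  qed
  show ?thesis
    using main transfer[OF m[OF meas(1)]] transfer[OF m[OF meas(2)]] by (simp only: det ind Gy)
qed

section \<open>Smooth functions\<close>

lemma Ck_on_cong:
  assumes "open U" "\<And>x. x \<in> U \<Longrightarrow> f x = g x" "Ck_on k U f"
  shows "Ck_on k U g"
  using assms(2,3)
proof (induction k arbitrary: f g)
  case 0
  then show ?case
    using continuous_on_cong[of U U f g] by simp
next
  case (Suc k)
  have d: "f differentiable (at x)" if "x \<in> U" for x
    using Suc.prems that by simp
  have eq: "frechet_derivative f (at x) = frechet_derivative g (at x)" if "x \<in> U" for x
    by (rule frechet_derivative_transform_within_open[OF d[OF that] \<open>open U\<close> that]) (simp add: Suc.prems)
  have "g differentiable (at x)" if "x \<in> U" for x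
    using d[OF that] has_derivative_transform_within_open[OF _ \<open>open U\<close> that, of f _ UNIV g] Suc.prems(1)
    unfolding differentiable_def by blast
  moreover have "Ck_on k U (\<lambda>x. frechet_derivative g (at x) v)" for v
    by (rule Suc.IH[of "\<lambda>x. frechet_derivative f (at x) v"]) (use Suc.prems in \<open>simp_all add: eq\<close>)
  ultimately show ?case
    by simp
qed

lemma Ck_on_subset: "Ck_on k U f \<Longrightarrow> V \<subseteq> U \<Longrightarrow> Ck_on k V f"
  by (induction k arbitrary: f) (auto intro: continuous_on_subset)

lemma Ck_on_SucD: "Ck_on (Suc k) U f \<Longrightarrow> Ck_on k U f"
proof (induction k arbitrary: f)
  case 0
  then show ?case
    by (auto intro: continuous_at_imp_continuous_on differentiable_imp_continuous_within)
next
  case (Suc k)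
  then show ?case
    by (metis Ck_on.simps(2))
qed

text \<open>\<open>Ck_on\<close> is phrased with \<open>frechet_derivative\<close>. Here any
  explicit formula for the derivative may stand in, which is how the inductions on the order of
  differentiability proceed.\<close>

lemma Ck_on_SucI:
  assumes "open U" "\<And>x. x \<in> U \<Longrightarrow> (f has_derivative f' x) (at x)" "\<And>v. Ck_on k U (\<lambda>x. f' x v)"
  shows "Ck_on (Suc k) U f"
proof -
  have f: "f' x = frechet_derivative f (at x)" if "x \<in> U" for x
    by (rule frechet_derivative_at) (rule assms(2)[OF that])
  have "Ck_on k U (\<lambda>x. frechet_derivative f (at x) v)" for v
    by (rule Ck_on_cong[OF \<open>open U\<close> _ assms(3)[of v]]) (simp add: f)
  then show ?thesis
    using assms(2) by (auto simp: differentiable_def)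
qed

lemma Ck_on_derivative:
  assumes "Ck_on (Suc k) U f" "x \<in> U"
  shows "(f has_derivative frechet_derivative f (at x)) (at x)"
  using assms by (simp add: frechet_derivative_works[symmetric])

lemma Ck_on_const: "Ck_on k U (\<lambda>x. c)"
  by (induction k arbitrary: c) (auto simp: frechet_derivative_const)

lemma Ck_on_linear:
  assumes "open U" "bounded_linear f"
  shows "Ck_on k U f"
proof (cases k)
  case 0
  then show ?thesis using assms by (simp add: linear_continuous_on)
next
  case (Suc j)
  show ?thesis
    unfolding Suc
    by (rule Ck_on_SucI[OF \<open>open U\<close> bounded_linear_imp_has_derivative[OF assms(2)]]) (rule Ck_on_const)
qed

lemma Ck_on_add:
  assumes "open U" "Ck_on k U f" "Ck_on k U g"
  shows "Ck_on k U (\<lambda>x. f x + g x)"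
  using assms(2,3)
proof (induction k arbitrary: f g)
  case 0
  then show ?case by (simp add: continuous_on_add)
next
  case (Suc k)
  show ?case
  proof (rule Ck_on_SucI[OF \<open>open U\<close>])
    show "((\<lambda>x. f x + g x) has_derivative (\<lambda>v. frechet_derivative f (at x) v + frechet_derivative g (at x) v)) (at x)"
      if "x \<in> U" for x
      using Suc.prems that by (intro has_derivative_add Ck_on_derivative)
  qed (use Suc in auto)
qed

lemma (in bounded_bilinear) Ck_on_prod:
  fixes f :: "'d::euclidean_space \<Rightarrow> 'a"
  assumes "open U" "Ck_on k U f" "Ck_on k U g"
  shows "Ck_on k U (\<lambda>x. prod (f x) (g x))"
  using assms(2,3)
proof (induction k arbitrary: f g)
  case 0
  then show ?case by (simp add: continuous_on)
next
  case (Suc k)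
  note f = Ck_on_SucD[OF Suc.prems(1)] and g = Ck_on_SucD[OF Suc.prems(2)]
  show ?case
  proof (rule Ck_on_SucI[OF \<open>open U\<close>])
    show "((\<lambda>x. prod (f x) (g x)) has_derivative (\<lambda>v. prod (f x) (frechet_derivative g (at x) v) + prod (frechet_derivative f (at x) v) (g x))) (at x)"
      if "x \<in> U" for x
      using Suc.prems that by (intro FDERIV Ck_on_derivative)
    show "Ck_on k U (\<lambda>x. prod (f x) (frechet_derivative g (at x) v) + prod (frechet_derivative f (at x) v) (g x))" for v
      by (intro Ck_on_add[OF \<open>open U\<close>] Suc.IH f g) (use Suc.prems in auto)
  qed
qed

lemmas Ck_on_scaleR = bounded_bilinear.Ck_on_prod[OF bounded_bilinear_scaleR]
lemmas Ck_on_mult = bounded_bilinear.Ck_on_prod[OF bounded_bilinear_mult]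

lemma Ck_on_sum:
  assumes "open U" "\<And>i. i \<in> I \<Longrightarrow> Ck_on k U (f i)"
  shows "Ck_on k U (\<lambda>x. \<Sum>i\<in>I. f i x)"
  using assms(2)
  by (induction I rule: infinite_finite_induct) (auto intro: Ck_on_const Ck_on_add[OF \<open>open U\<close>])

lemma Ck_on_bounded_linear:
  assumes L: "bounded_linear L" and "open U" "Ck_on k U f"
  shows "Ck_on k U (\<lambda>x. L (f x))"
  using assms(3)
proof (induction k arbitrary: f)
  case 0
  then show ?case by (simp add: bounded_linear.continuous_on[OF L])
next
  case (Suc k)
  show ?case
  proof (rule Ck_on_SucI[OF \<open>open U\<close>])
    show "((\<lambda>x. L (f x)) has_derivative (\<lambda>v. L (frechet_derivative f (at x) v))) (at x)" if "x \<in> U" for x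
      using Suc.prems that by (intro bounded_linear.has_derivative[OF L] Ck_on_derivative)
  qed (use Suc in auto)
qed

lemma Ck_on_minus: "open U \<Longrightarrow> Ck_on k U f \<Longrightarrow> Ck_on k U (\<lambda>x. - f x)"
  by (rule Ck_on_bounded_linear[OF bounded_linear_minus[OF bounded_linear_ident]])

lemma Ck_on_diff: "open U \<Longrightarrow> Ck_on k U f \<Longrightarrow> Ck_on k U g \<Longrightarrow> Ck_on k U (\<lambda>x. f x - g x)"
  using Ck_on_add[OF _ _ Ck_on_minus, of U k f g] by simp

text \<open>The derivative -f'/f^2 contains the reciprocal again only undifferentiated, so the
  induction on \<open>k\<close> closes.\<close>

lemma Ck_on_inverse:
  fixes f :: "'a::euclidean_space \<Rightarrow> real"
  assumes "open U" "Ck_on k U f" "\<And>x. x \<in> U \<Longrightarrow> f x \<noteq> 0"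
  shows "Ck_on k U (\<lambda>x. inverse (f x))"
  using assms(2)
proof (induction k)
  case 0
  then show ?case using assms(3) by (simp add: continuous_on_inverse)
next
  case (Suc k)
  show ?case
  proof (rule Ck_on_SucI[OF \<open>open U\<close>])
    show "((\<lambda>x. inverse (f x)) has_derivative (\<lambda>v. - (inverse (f x) * frechet_derivative f (at x) v * inverse (f x)))) (at x)" if "x \<in> U" for x
      using Suc.prems that assms(3) by (intro Deriv.has_derivative_inverse Ck_on_derivative)
    show "Ck_on k U (\<lambda>x. - (inverse (f x) * frechet_derivative f (at x) v * inverse (f x)))" for v
      by (intro Ck_on_minus Ck_on_mult \<open>open U\<close> Suc.IH Ck_on_SucD[OF Suc.prems]) (use Suc.prems in auto)
  qed
qed

lemma frechet_derivative_sum_Basis: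
  assumes "f differentiable (at x)"
  shows "frechet_derivative f (at x) v = (\<Sum>b\<in>Basis. (v \<bullet> b) *\<^sub>R frechet_derivative f (at x) b)"
proof -
  have l: "linear (frechet_derivative f (at x))"
    using assms by (rule linear_frechet_derivative)
  have "frechet_derivative f (at x) v = frechet_derivative f (at x) (\<Sum>b\<in>Basis. (v \<bullet> b) *\<^sub>R b)"
    by (simp add: euclidean_representation)
  then show ?thesis
    by (simp only: linear_sum[OF l] linear_cmul[OF l])
qed

text \<open>In the chain rule the direction in which \<open>f\<close> is differentiated depends on
  \<open>x\<close>, whereas \<open>Ck_on\<close> controls fixed directions only. Expanding that
  direction in the basis gives a sum of products of components of the derivative of \<open>g\<close>
  and compositions of \<open>g\<close> with directional derivatives of \<open>f\<close>; the latter
  are covered by induction because \<open>f\<close> is arbitrary there.\<close>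

lemma Ck_on_compose:
  fixes g :: "'a::euclidean_space \<Rightarrow> 'b::euclidean_space" and f :: "'b \<Rightarrow> 'c::real_normed_vector"
  assumes "open U" "Ck_on k V f" "Ck_on k U g" "\<And>x. x \<in> U \<Longrightarrow> g x \<in> V"
  shows "Ck_on k U (\<lambda>x. f (g x))"
  using assms(2,3)
proof (induction k arbitrary: f)
  case 0
  then show ?case
    using assms(4) by (auto intro: continuous_on_compose2)
next
  case (Suc k)
  have df: "f differentiable (at (g x))" if "x \<in> U" for x
    using Suc.prems assms(4) that by simp
  show ?case
  proof (rule Ck_on_SucI[OF \<open>open U\<close>])
    fix x assume x: "x \<in> U"
    have "(f \<circ> g has_derivative frechet_derivative f (at (g x)) \<circ> frechet_derivative g (at x)) (at x)"
      using Suc.prems x assms(4) by (intro diff_chain_at Ck_on_derivative)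
    moreover have "frechet_derivative f (at (g x)) \<circ> frechet_derivative g (at x)
       = (\<lambda>v. \<Sum>b\<in>Basis. (frechet_derivative g (at x) v \<bullet> b) *\<^sub>R frechet_derivative f (at (g x)) b)"
      unfolding o_def by (rule ext) (rule frechet_derivative_sum_Basis[OF df[OF x]])
    ultimately show "((\<lambda>x. f (g x)) has_derivative (\<lambda>v. \<Sum>b\<in>Basis. (frechet_derivative g (at x) v \<bullet> b) *\<^sub>R frechet_derivative f (at (g x)) b)) (at x)"
      by (simp add: o_def)
  next
    fix v
    have 1: "Ck_on k U (\<lambda>x. frechet_derivative f (at (g x)) b)" for b
      by (rule Suc.IH[of "\<lambda>y. frechet_derivative f (at y) b"]) (use Suc.prems Ck_on_SucD in auto)
    have 2: "Ck_on k U (\<lambda>x. frechet_derivative g (at x) v \<bullet> b)" for b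
      by (rule Ck_on_bounded_linear[OF bounded_linear_inner_left \<open>open U\<close>]) (use Suc.prems in auto)
    show "Ck_on k U (\<lambda>x. \<Sum>b\<in>Basis. (frechet_derivative g (at x) v \<bullet> b) *\<^sub>R frechet_derivative f (at (g x)) b)"
      by (intro Ck_on_sum[OF \<open>open U\<close>] Ck_on_scaleR[OF \<open>open U\<close>] 1 2)
  qed
qed

lemma smooth_on_subset: "smooth_on U f \<Longrightarrow> V \<subseteq> U \<Longrightarrow> open V \<Longrightarrow> smooth_on V f"
  unfolding smooth_on_def using Ck_on_subset by blast

lemma smooth_on_cong: "smooth_on U f \<Longrightarrow> (\<And>x. x \<in> U \<Longrightarrow> f x = g x) \<Longrightarrow> smooth_on U g"
  unfolding smooth_on_def using Ck_on_cong by blast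

lemma smooth_on_compose:
  fixes g :: "'a::euclidean_space \<Rightarrow> 'b::euclidean_space"
  shows "smooth_on V f \<Longrightarrow> smooth_on U g \<Longrightarrow> (\<And>x. x \<in> U \<Longrightarrow> g x \<in> V) \<Longrightarrow> smooth_on U (\<lambda>x. f (g x))"
  unfolding smooth_on_def by (auto intro: Ck_on_compose)

lemma smooth_on_continuous: "smooth_on U f \<Longrightarrow> continuous_on U f"
  unfolding smooth_on_def by (metis Ck_on.simps(1))

lemma smooth_on_has_derivative:
  "smooth_on U f \<Longrightarrow> x \<in> U \<Longrightarrow> (f has_derivative frechet_derivative f (at x)) (at x)"
  unfolding smooth_on_def using Ck_on_derivative[of 0] by blast

lemma smooth_on_frechet_derivative:
  "smooth_on U f \<Longrightarrow> smooth_on U (\<lambda>x. frechet_derivative f (at x) v)"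
  unfolding smooth_on_def by (metis Ck_on.simps(2))

text \<open>\<Psi> replaces the \<open>k\<close>-th coordinate by \<open>h\<close>, and its
  derivative is invertible exactly where the \<open>k\<close>-th partial derivative of
  \<open>h\<close> is nonzero. The inverse function theorem supplies a differentiable local inverse.
  Its smoothness is a bootstrap: the derivative of \<psi> is a rational expression in the
  derivatives of \<open>h\<close> at \<psi>, so each order of regularity of \<psi> yields the
  next.\<close>

lemma coordinate_replacement:
  fixes h :: "real^'n::finite \<Rightarrow> real"
  assumes h: "smooth_on U h" and x0: "x0 \<in> U" and nz: "frechet_derivative h (at x0) (axis k 1) \<noteq> 0"
  defines "\<Psi> \<equiv> \<lambda>x. x + (h x - x $ k) *\<^sub>R axis k 1"
  obtains U' V \<psi> where "open U'" "U' \<subseteq> U" "x0 \<in> U'" "open V" "homeomorphism U' V \<Psi> \<psi>"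
    "smooth_on U' \<Psi>" "smooth_on V \<psi>" "\<And>x. \<Psi> x $ k = h x"
proof -
  let ?e = "axis k 1 :: real^'n"
  define D where "D x = frechet_derivative h (at x)" for x
  have "open U" using h by (simp add: smooth_on_def)
  have hd: "(h has_derivative D x) (at x)" if "x \<in> U" for x
    unfolding D_def by (rule smooth_on_has_derivative[OF h that])
  have DL: "bounded_linear (D x)" if "x \<in> U" for x
    using hd[OF that] by (rule has_derivative_bounded_linear)
  define \<Psi>' where "\<Psi>' x v = v + (D x v - v $ k) *\<^sub>R ?e" for x v
  have \<Psi>d: "(\<Psi> has_derivative \<Psi>' x) (at x)" if "x \<in> U" for x
    unfolding \<Psi>_def \<Psi>'_def[abs_def]
    by (intro derivative_intros hd[OF that] bounded_linear.has_derivative[OF bounded_linear_vec_nth])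
  have bl: "bounded_linear (\<Psi>' x)" if "x \<in> U" for x
    using \<Psi>d[OF that] by (rule has_derivative_bounded_linear)
  have smooth\<Psi>: "smooth_on U \<Psi>"
    unfolding smooth_on_def \<Psi>_def
    using h unfolding smooth_on_def
    by (auto intro!: Ck_on_add Ck_on_scaleR Ck_on_diff Ck_on_const Ck_on_linear[OF _ bounded_linear_ident]
        Ck_on_linear[OF _ bounded_linear_vec_nth])
  define F where "F x = Blinfun (\<Psi>' x)" for x
  have F: "blinfun_apply (F x) = \<Psi>' x" if "x \<in> U" for x
    unfolding F_def by (rule bounded_linear_Blinfun_apply[OF bl[OF that]])
  have contF: "continuous_on U F"
  proof (rule continuous_on_blinfun_componentwise)
    fix v :: "real^'n"
    have "continuous_on U (\<lambda>x. frechet_derivative \<Psi> (at x) v)"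
      by (rule smooth_on_continuous[OF smooth_on_frechet_derivative[OF smooth\<Psi>]])
    moreover have "frechet_derivative \<Psi> (at x) v = blinfun_apply (F x) v" if "x \<in> U" for x
      using frechet_derivative_at[OF \<Psi>d[OF that]] F[OF that] by simp
    ultimately show "continuous_on U (\<lambda>x. blinfun_apply (F x) v)"
      by (simp cong: continuous_on_cong)
  qed
  \<comment> \<open>The derivative is inverted by hand: \<open>v\<close> and \<open>w\<close> agree
    outside entry \<open>k\<close>, and w_k = D v is one linear equation for v_k with coefficient D
    e_k.\<close>
  have solve: "D x ?e \<noteq> 0 \<Longrightarrow> v = w + ((w $ k - D x (w - (w $ k) *\<^sub>R ?e)) / D x ?e - w $ k) *\<^sub>R ?e"
    if "\<Psi>' x v = w" "x \<in> U" for x v w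
  proof -
    assume nz: "D x ?e \<noteq> 0"
    have w: "w = v + (D x v - v $ k) *\<^sub>R ?e"
      using that by (simp add: \<Psi>'_def)
    have wk: "w $ k = D x v"
      by (simp add: w)
    have wv: "w - (w $ k) *\<^sub>R ?e = v - (v $ k) *\<^sub>R ?e"
      unfolding wk by (simp add: w algebra_simps)
    have "D x (w - (w $ k) *\<^sub>R ?e) = D x v - v $ k * D x ?e"
      unfolding wv using DL[OF \<open>x \<in> U\<close>] by (simp add: bounded_linear.linear linear_diff linear_cmul)
    then have "(w $ k - D x (w - (w $ k) *\<^sub>R ?e)) / D x ?e = v $ k"
      using nz by (simp add: wk)
    then have "w + ((w $ k - D x (w - (w $ k) *\<^sub>R ?e)) / D x ?e - w $ k) *\<^sub>R ?e = (w - (w $ k) *\<^sub>R ?e) + (v $ k) *\<^sub>R ?e"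
      by (simp add: algebra_simps)
    then show ?thesis by (simp add: wv)
  qed
  have lin: "linear (\<Psi>' x)" if "x \<in> U" for x
    using bl[OF that] by (rule bounded_linear.linear)
  have "inj (\<Psi>' x0)"
  proof -
    have "v = 0" if "\<Psi>' x0 v = 0" for v
      using solve[OF that x0] nz linear_0[OF bounded_linear.linear[OF DL[OF x0]]] by (simp add: D_def)
    then show ?thesis
      using linear_injective_0[OF lin[OF x0]] by blast
  qed
  then obtain L where L: "linear L" "L \<circ> \<Psi>' x0 = id"
    using linear_injective_left_inverse[OF lin[OF x0]] by blast
  define invf where "invf = Blinfun L"
  have "invf o\<^sub>L F x0 = id_blinfun"
    using L F[OF x0] by (intro blinfun_eqI)
      (simp add: invf_def bounded_linear_Blinfun_apply linear_conv_bounded_linear[symmetric] fun_eq_iff)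
  then have inv: "invf o\<^sub>L F x0 = id_blinfun" .
  have dF: "(\<Psi> has_derivative blinfun_apply (F x)) (at x)" if "x \<in> U" for x
    using \<Psi>d[OF that] F[OF that] by simp
  obtain U' V \<psi> \<psi>' where U': "open U'" "U' \<subseteq> U" "x0 \<in> U'" and V: "open V" "\<Psi> x0 \<in> V" and hom: "homeomorphism U' V \<Psi> \<psi>"
    and \<psi>d: "\<And>y. y \<in> V \<Longrightarrow> (\<psi> has_derivative (\<psi>' y)) (at y)"
    and \<psi>'_eq: "\<And>y. y \<in> V \<Longrightarrow> \<psi>' y = inv (blinfun_apply (F (\<psi> y)))"
    and bij: "\<And>y. y \<in> V \<Longrightarrow> bij (blinfun_apply (F (\<psi> y)))"
    by (rule inverse_function_theorem[OF \<open>open U\<close> dF contF x0 inv], assumption, rule that)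
  have \<psi>U: "\<psi> y \<in> U" if "y \<in> V" for y
    using hom U' that by (auto simp: homeomorphism_def)
  \<comment> \<open>The nonvanishing assumed at \<open>x0\<close> spreads to all of
    \<open>V\<close>: if D e_k were 0, then e_k would lie in the kernel of the derivative of \<Psi>,
    which is bijective there.\<close>
  have nzD: "D (\<psi> y) ?e \<noteq> 0" if "y \<in> V" for y
  proof
    assume "D (\<psi> y) ?e = 0"
    then have "\<Psi>' (\<psi> y) ?e = \<Psi>' (\<psi> y) 0"
      using linear_0[OF lin[OF \<psi>U[OF that]]] by (simp add: \<Psi>'_def)
    then have "?e = 0"
      using bij[OF that] F[OF \<psi>U[OF that]] by (metis bij_is_inj injD)
    then show False by simp
  qed
  \<comment> \<open>The solution formula from \<open>solve\<close>, evaluated at \<psi> y; division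
    is written as a product with \<open>inverse\<close> to fit \<open>Ck_on_inverse\<close>.\<close>
  define \<Phi> where "\<Phi> y w = w + ((w $ k - D (\<psi> y) (w - (w $ k) *\<^sub>R ?e)) * inverse (D (\<psi> y) ?e) - w $ k) *\<^sub>R ?e" for y w
  have \<psi>\<Phi>: "(\<psi> has_derivative \<Phi> y) (at y)" if "y \<in> V" for y
  proof -
    have "\<psi>' y w = \<Phi> y w" for w
    proof -
      have "\<Psi>' (\<psi> y) (\<psi>' y w) = w"
        using \<psi>'_eq[OF that] bij[OF that] F[OF \<psi>U[OF that]] by (simp add: bij_is_surj surj_f_inv_f)
      from solve[OF this \<psi>U[OF that] nzD[OF that]] show ?thesis
        by (simp add: \<Phi>_def divide_inverse)
    qed
    then have "\<psi>' y = \<Phi> y"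
      by (rule ext)
    then show ?thesis
      using \<psi>d[OF that] by simp
  qed
  have "Ck_on j V \<psi>" for j
  proof (induction j)
    case 0
    then show ?case using hom by (simp add: homeomorphism_def)
  next
    case (Suc j)
    have Dj: "Ck_on j V (\<lambda>y. D (\<psi> y) u)" for u
    proof (rule Ck_on_compose[OF V(1) _ Suc.IH \<psi>U])
      show "Ck_on j U (\<lambda>x. D x u)"
        using smooth_on_frechet_derivative[OF h] by (simp add: D_def smooth_on_def)
    qed
    show ?case
    proof (rule Ck_on_SucI[OF V(1) \<psi>\<Phi>])
      show "Ck_on j V (\<lambda>y. \<Phi> y w)" for w
        unfolding \<Phi>_def
        by (intro Ck_on_add Ck_on_scaleR Ck_on_diff Ck_on_mult Ck_on_inverse Ck_on_const Dj V(1) nzD Ck_on_linear[OF V(1) bounded_linear_ident]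
          Ck_on_linear[OF V(1) bounded_linear_vec_nth])
    qed
  qed
  then have "smooth_on V \<psi>"
    using V(1) by (simp add: smooth_on_def)
  moreover have "\<Psi> x $ k = h x" for x
    by (simp add: \<Psi>_def)
  ultimately show thesis
    using that[OF U' V(1) hom smooth_on_subset[OF smooth\<Psi> U'(2,1)]] by blast
qed

section \<open>Charts adapted to the Killing coordinate\<close>

lemma chart_inverse:
  assumes "is_chart X c" "q \<in> fst c"
  shows "inv_into (fst c) (snd c) (snd c q) = q"
  using assms by (simp add: is_chart_def homeomorphism_def)

lemma in_chart_eq [simp]:
  assumes "is_chart X c" "q \<in> fst c"
  shows "in_chart c f (snd c q) = f q"
  by (simp add: in_chart_def chart_inverse[OF assms])

lemma chart_inj: "is_chart X c \<Longrightarrow> inj_on (snd c) (fst c)"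
  by (metis chart_inverse inj_on_inverseI)

lemma chart_subset: "is_chart X c \<Longrightarrow> fst c \<subseteq> X"
  by (auto simp: is_chart_def dest: openin_imp_subset)

text \<open>By maximality of the atlas it is enough that the new chart is compatible with every old
  one, and its transition maps are the old ones composed with \<psi> on one side and \<Psi> on the
  other.\<close>

lemma reparametrized_chart:
  assumes M: "smooth_manifold X A" and c: "c \<in> A"
    and U': "open U'" "U' \<subseteq> chart_image c" and V: "open V" and hom: "homeomorphism U' V \<Psi> \<psi>"
    and s\<Psi>: "smooth_on U' \<Psi>" and s\<psi>: "smooth_on V \<psi>"
  shows "({q \<in> fst c. snd c q \<in> U'}, \<Psi> \<circ> snd c) \<in> A"
proof -
  let ?D = "{q \<in> fst c. snd c q \<in> U'}"
  let ?c = "(?D, \<Psi> \<circ> snd c)"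
  let ?inv = "inv_into (fst c) (snd c)"
  have chart: "is_chart X d" if "d \<in> A" for d
    using M that by (simp add: smooth_manifold_def)
  have homc: "homeomorphism (fst c) (chart_image c) (snd c) ?inv"
    using chart[OF c] by (simp add: is_chart_def)
  have cD: "snd c ` ?D = U'"
    using U'(2) by (auto simp: chart_image_def)
  have homD: "homeomorphism ?D U' (snd c) ?inv"
    by (rule homeomorphism_of_subsets[OF homc _ order_refl cD]) auto
  have hom': "homeomorphism ?D V (\<Psi> \<circ> snd c) (?inv \<circ> \<psi>)"
    by (rule homeomorphism_compose[OF homD hom])
  have img: "chart_image ?c = V"
    using hom' by (simp add: chart_image_def homeomorphism_def)
  \<comment> \<open>\<open>in_chart\<close> and \<open>is_chart\<close> use the chosen inverse
    \<open>inv_into\<close>; by injectivity it coincides with the explicit inverse on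
    \<open>V\<close>.\<close>
  have inv_c: "inv_into ?D (\<Psi> \<circ> snd c) y = ?inv (\<psi> y)" if "y \<in> V" for y
  proof -
    have "?inv (\<psi> y) \<in> ?D" "(\<Psi> \<circ> snd c) (?inv (\<psi> y)) = y"
      using hom' that by (auto simp: homeomorphism_def)
    moreover have "inj_on (\<Psi> \<circ> snd c) ?D"
      by (rule inj_on_inverseI) (rule homeomorphism_apply1[OF hom'])
    ultimately show ?thesis
      using inv_into_f_f[of "\<Psi> \<circ> snd c" ?D "?inv (\<psi> y)"] by simp
  qed
  have chart_c: "is_chart X ?c"
  proof -
    have "openin (top_of_set (fst c)) (fst c \<inter> snd c -` U')"
      using homc U'(1) by (intro continuous_openin_preimage_gen) (auto simp: homeomorphism_def)
    moreover have "openin (top_of_set X) (fst c)"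
      using chart[OF c] by (simp add: is_chart_def)
    ultimately have "openin (top_of_set X) (fst c \<inter> snd c -` U')"
      by (rule openin_trans)
    moreover have "fst c \<inter> snd c -` U' = ?D" by auto
    moreover have "homeomorphism ?D V (\<Psi> \<circ> snd c) (inv_into ?D (\<Psi> \<circ> snd c))"
      by (rule homeomorphism_cong[OF hom']) (simp_all add: inv_c)
    ultimately show ?thesis
      using V by (simp add: is_chart_def img)
  qed
  have "compatible ?c d" if d: "d \<in> A" for d
  proof -
    let ?W = "snd c ` (fst c \<inter> fst d)" and ?T = "in_chart c (snd d)"
    let ?W' = "snd d ` (fst c \<inter> fst d)" and ?T' = "in_chart d (snd c)"
    have T: "smooth_on ?W ?T" and T': "smooth_on ?W' ?T'"
      using M c d by (auto simp: smooth_manifold_def compatible_def)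
    have \<psi>\<Psi>: "\<psi> (\<Psi> x) = x" if "x \<in> U'" for x
      using hom that by (simp add: homeomorphism_def)
    have \<Psi>V: "\<Psi> x \<in> V" if "x \<in> U'" for x
      using hom that by (auto simp: homeomorphism_def)
    have \<psi>U: "\<psi> y \<in> U'" "\<Psi> (\<psi> y) = y" if "y \<in> V" for y
      using hom that by (auto simp: homeomorphism_def)
    \<comment> \<open>Writing the overlap as a preimage under \<psi> shows that it is open.\<close>
    have eq: "(\<Psi> \<circ> snd c) ` (?D \<inter> fst d) = V \<inter> \<psi> -` ?W"
    proof (intro subset_antisym subsetI)
      fix y assume "y \<in> (\<Psi> \<circ> snd c) ` (?D \<inter> fst d)"
      then show "y \<in> V \<inter> \<psi> -` ?W"
        by (auto simp: \<psi>\<Psi> \<Psi>V)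
    next
      fix y assume "y \<in> V \<inter> \<psi> -` ?W"
      then obtain q where "y \<in> V" "\<psi> y = snd c q" "q \<in> fst c" "q \<in> fst d"
        by auto
      then show "y \<in> (\<Psi> \<circ> snd c) ` (?D \<inter> fst d)"
        using \<psi>U[of y] by (intro image_eqI[of _ _ q]) auto
    qed
    have "open (V \<inter> \<psi> -` ?W)"
      using T smooth_on_continuous[OF s\<psi>] V by (intro continuous_open_preimage) (auto simp: smooth_on_def)
    then have s\<psi>': "smooth_on (V \<inter> \<psi> -` ?W) \<psi>"
      by (rule smooth_on_subset[OF s\<psi> Int_lower1])
    have 1: "smooth_on (V \<inter> \<psi> -` ?W) (in_chart ?c (snd d))"
    proof (rule smooth_on_cong[OF smooth_on_compose[OF T s\<psi>']])
      show "?T (\<psi> y) = in_chart ?c (snd d) y" if "y \<in> V \<inter> \<psi> -` ?W" for y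
        using that by (simp add: in_chart_def inv_c)
    qed simp
    have eq': "snd d ` (?D \<inter> fst d) = ?W' \<inter> ?T' -` U'"
      using chart[OF d] by (auto simp: in_chart_def chart_inverse)
    have "open (?W' \<inter> ?T' -` U')"
      using T' smooth_on_continuous[OF T'] U'(1) by (intro continuous_open_preimage) (auto simp: smooth_on_def)
    then have T'': "smooth_on (?W' \<inter> ?T' -` U') ?T'"
      by (rule smooth_on_subset[OF T' Int_lower1])
    have 2: "smooth_on (?W' \<inter> ?T' -` U') (in_chart d (\<Psi> \<circ> snd c))"
      by (rule smooth_on_cong[OF smooth_on_compose[OF s\<Psi> T'']]) (auto simp: in_chart_def)
    show ?thesis
      unfolding compatible_def using 1 2 by (simp only: fst_conv snd_conv eq eq' Int_commute[of "fst d"])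
  qed
  with chart_c show ?thesis
    using M unfolding smooth_manifold_def by blast
qed

text \<open>Since d\<theta> is nonzero at \<open>p\<close>, some coordinate of \<open>c\<close> can
  be exchanged for \<theta> near \<open>p\<close>. Only such charts are constrained by
  \<open>is_slice_volume\<close>.\<close>

lemma adapted_chart:
  assumes M: "smooth_manifold X A" and \<theta>: "smooth_function A \<theta>" and c: "c \<in> A" "p \<in> fst c"
    and nz: "differential \<theta> c p \<noteq> 0"
  obtains d k where "d \<in> A" "p \<in> fst d" "\<And>q. q \<in> fst d \<Longrightarrow> snd d q $ k = \<theta> q"
proof -
  let ?h = "in_chart c \<theta>"
  have chart: "is_chart X c"
    using M c by (simp add: smooth_manifold_def)
  have h: "smooth_on (chart_image c) ?h"
    using \<theta> c by (simp add: smooth_function_def)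
  have x0: "snd c p \<in> chart_image c"
    using c by (simp add: chart_image_def)
  obtain k where "differential \<theta> c p $ k \<noteq> 0"
    using nz by (auto simp: vec_eq_iff)
  then have nz': "frechet_derivative ?h (at (snd c p)) (axis k 1) \<noteq> 0"
    by (simp add: differential_def partial_def)
  obtain U' V \<psi> where U': "open U'" "U' \<subseteq> chart_image c" "snd c p \<in> U'" and V: "open V"
    and hom: "homeomorphism U' V (\<lambda>x. x + (?h x - x $ k) *\<^sub>R axis k 1) \<psi>"
    and s: "smooth_on U' (\<lambda>x. x + (?h x - x $ k) *\<^sub>R axis k 1)" "smooth_on V \<psi>"
    and "\<And>x. (x + (?h x - x $ k) *\<^sub>R axis k 1) $ k = ?h x"
    by (rule coordinate_replacement[OF h x0 nz']) (rule that)
  show thesis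
  proof (rule that[where k = k])
    show "({q \<in> fst c. snd c q \<in> U'}, (\<lambda>x. x + (?h x - x $ k) *\<^sub>R axis k 1) \<circ> snd c) \<in> A"
      by (rule reparametrized_chart[OF M c(1) U'(1,2) V hom s])
  qed (use U' c chart in auto)
qed

section \<open>The volume of the slice\<close>

lemma borel_measurable_vec_lambda:
  fixes f :: "'a \<Rightarrow> 'n::finite \<Rightarrow> real"
  assumes "\<And>i. (\<lambda>x. f x i) \<in> borel_measurable M"
  shows "(\<lambda>x. \<chi> i. f x i) \<in> borel_measurable M"
proof -
  have "(\<lambda>x. \<Sum>i\<in>UNIV. f x i *\<^sub>R (axis i 1 :: real^'n)) \<in> borel_measurable M"
    by (intro borel_measurable_sum borel_measurable_scaleR assms borel_measurable_const)
  moreover have "(\<Sum>i\<in>UNIV. f x i *\<^sub>R (axis i 1 :: real^'n)) = (\<chi> i. f x i)" for x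
    by (simp add: vec_eq_iff axis_def if_distrib[where f = "\<lambda>z. _ * z"] cong: if_cong)
  ultimately show ?thesis by simp
qed

lemma borel_measurable_vec_nth: "(\<lambda>x :: real^'n::finite. x $ i) \<in> borel_measurable borel"
  by (intro borel_measurable_continuous_onI continuous_intros)

lemma measurable_component_lborel:
  "i \<in> I \<Longrightarrow> (\<lambda>x. x i) \<in> borel_measurable (PiM I (\<lambda>_. lborel :: real measure))"
  using measurable_component_singleton[of i I "\<lambda>_. lborel"] by (simp cong: measurable_cong_sets)

lemma measurable_vec_PiM:
  "(\<lambda>y. \<chi> i. y i) \<in> borel_measurable (PiM (UNIV :: 'n::finite set) (\<lambda>_. lborel :: real measure))"
  using borel_measurable_vec_lambda[where f = "\<lambda>y. y" and M = "PiM (UNIV :: 'n set) (\<lambda>_. lborel :: real measure)",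
      OF measurable_component_lborel[OF UNIV_I]] .

text \<open>Links the product measure over an index set, in which the slice volume is written, to
  Lebesgue measure on vectors. It is enough to compare the two on boxes.\<close>

lemma lborel_vec: "(lborel :: (real^'n::finite) measure) = distr (PiM UNIV (\<lambda>_. lborel)) borel (\<lambda>y. \<chi> i. y i)"
proof (rule lborel_eqI)
  interpret finite_product_sigma_finite "\<lambda>_. lborel" "UNIV :: 'n set"
    by standard simp
  have m: "(\<lambda>y. \<chi> i. y i) \<in> borel_measurable (PiM (UNIV :: 'n set) (\<lambda>_. lborel :: real measure))"
    by (rule measurable_vec_PiM)
  fix l u :: "real^'n" assume le: "\<And>b. b \<in> Basis \<Longrightarrow> l \<bullet> b \<le> u \<bullet> b"
  have le': "l $ i \<le> u $ i" for i
    using le[of "axis i 1"] by (simp add: inner_axis axis_in_Basis_iff)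
  have "(\<lambda>y. \<chi> i. y i) -` box l u \<inter> space (PiM UNIV (\<lambda>_. lborel)) = (\<Pi>\<^sub>E i\<in>UNIV. {l $ i <..< u $ i})"
    by (auto simp: mem_box_cart space_PiM PiE_iff)
  then have "emeasure (distr (PiM UNIV (\<lambda>_. lborel)) borel (\<lambda>y. \<chi> i. y i)) (box l u)
     = (\<Prod>i\<in>UNIV. emeasure lborel {l $ i <..< u $ i})"
    using m by (simp add: emeasure_distr measure_times)
  also have "\<dots> = (\<Prod>i\<in>UNIV. ennreal ((u - l) $ i))"
    using le' by simp
  also have "\<dots> = ennreal (\<Prod>i\<in>UNIV. (u - l) $ i)"
    using le' by (intro prod_ennreal) simp
  finally show "emeasure (distr (PiM UNIV (\<lambda>_. lborel)) borel (\<lambda>y. \<chi> i. y i)) (box l u) = (\<Prod>b\<in>Basis. (u - l) \<bullet> b)"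
    by (simp only: prod_Basis_vec)
qed simp

definition hyperplane_proj :: "'n::finite \<Rightarrow> real^'n \<Rightarrow> real^'n" where
  "hyperplane_proj k x = (\<chi> i. if i = k then 0 else x $ i)"

lemma measurable_slice_point: "slice_point k \<in> borel_measurable (PiM (UNIV - {k}) (\<lambda>_. lborel))"
proof -
  have "(\<lambda>y. if i = k then 0 else y i) \<in> borel_measurable (PiM (UNIV - {k}) (\<lambda>_. lborel))" for i
    by (cases "i = k") (simp_all add: measurable_component_lborel)
  then show ?thesis
    unfolding slice_point_def[abs_def] by (rule borel_measurable_vec_lambda)
qed

lemma measurable_hyperplane_proj: "hyperplane_proj k \<in> borel_measurable borel"
  unfolding hyperplane_proj_def[abs_def]
  by (rule borel_measurable_vec_lambda) (simp add: borel_measurable_vec_nth)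

text \<open>By Fubini in the \<open>k\<close>-th variable: the added factor is the indicator of an
  interval of length 1, so it integrates out.\<close>

lemma nn_integral_thicken:
  fixes f :: "real^'n::finite \<Rightarrow> ennreal"
  assumes f: "f \<in> borel_measurable borel"
  shows "(\<integral>\<^sup>+ y. f (slice_point k y) \<partial>PiM (UNIV - {k}) (\<lambda>_. lborel))
    = (\<integral>\<^sup>+ x. f (hyperplane_proj k x) * indicator {0..1} (x $ k) \<partial>lborel)"
proof -
  interpret product_sigma_finite "\<lambda>_::'n. lborel :: real measure"
    by standard
  let ?v = "\<lambda>y. (\<chi> i. y i) :: real^'n"
  have v: "?v \<in> borel_measurable (PiM UNIV (\<lambda>_. lborel))"
    by (rule measurable_vec_PiM)
  define h where "h x = f (hyperplane_proj k x) * indicator {0..1::real} (x $ k)" for x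
  have h: "h \<in> borel_measurable borel"
    unfolding h_def
    by (intro borel_measurable_times_ennreal measurable_compose[OF measurable_hyperplane_proj f]
        measurable_compose[OF borel_measurable_vec_nth]) simp
  have ins: "insert k (UNIV - {k}) = (UNIV :: 'n set)" by auto
  have "(\<integral>\<^sup>+ x. h x \<partial>lborel) = (\<integral>\<^sup>+ y. h (?v y) \<partial>PiM UNIV (\<lambda>_. lborel))"
    by (subst lborel_vec) (use v h in \<open>simp add: nn_integral_distr\<close>)
  also have "\<dots> = (\<integral>\<^sup>+ y. \<integral>\<^sup>+ t. h (?v (y(k := t))) \<partial>lborel \<partial>PiM (UNIV - {k}) (\<lambda>_. lborel))"
    using product_nn_integral_insert[of "UNIV - {k}" k "\<lambda>y. h (?v y)"] measurable_compose[OF v h]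
    by (simp add: ins)
  also have "\<dots> = (\<integral>\<^sup>+ y. f (slice_point k y) \<partial>PiM (UNIV - {k}) (\<lambda>_. lborel))"
  proof (rule nn_integral_cong)
    fix y :: "'n \<Rightarrow> real"
    have "h (?v (y(k := t))) = f (slice_point k y) * indicator {0..1} t" for t
      by (simp add: h_def hyperplane_proj_def slice_point_def cong: if_cong)
    then show "(\<integral>\<^sup>+ t. h (?v (y(k := t))) \<partial>lborel) = f (slice_point k y)"
      by (simp add: nn_integral_cmult)
  qed
  finally show ?thesis
    by (simp add: h_def)
qed

text \<open>The row condition says that \<open>J\<close> carries the hyperplane v_k = 0 into w_l =
  0. \<open>Q\<close> is \<open>J\<close> with its \<open>k\<close>-th column replaced by the
  \<open>l\<close>-th basis vector, that is, the tangential block together with a single entry 1.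
  This matches the entry 1 which \<open>slice_gram\<close> puts in the normal direction.\<close>

lemma slice_gram_transform:
  fixes J M :: "real^'n::finite^'n"
  assumes row: "\<And>j. J $ l $ j = (if j = k then 1 else 0)"
  defines "Q \<equiv> \<chi> i j. if j = k then (if i = l then 1 else 0) else J $ i $ j"
  shows "slice_gram k (transpose J ** M ** J) = transpose Q ** slice_gram l M ** Q"
proof -
  have cong: "(transpose B ** S ** B) $ i $ j = (\<Sum>a\<in>UNIV. \<Sum>b\<in>UNIV. B $ a $ i * S $ a $ b * B $ b $ j)"
    for B S :: "real^'n^'n" and i j
    by (simp add: matrix_matrix_mult_def transpose_def sum_distrib_right) (rule sum.swap)
  have Q: "Q $ i $ j = (if j = k then (if i = l then 1 else 0) else J $ i $ j)" for i j
    by (simp add: Q_def)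
  have S: "slice_gram l M $ a $ b = (if a = l \<or> b = l then (if a = b then 1 else 0) else M $ a $ b)" for a b
    by (simp add: slice_gram_def)
  have "(transpose Q ** slice_gram l M ** Q) $ i $ j = slice_gram k (transpose J ** M ** J) $ i $ j" for i j
  proof -
    consider "i = k" | "j = k" | "i \<noteq> k" "j \<noteq> k" by blast
    then show ?thesis
    proof cases
      case 1
      have "(\<Sum>b\<in>UNIV. Q $ a $ i * slice_gram l M $ a $ b * Q $ b $ j) = (if a = l then Q $ l $ j else 0)" for a
        using 1 by (simp add: Q S if_distrib[where f = "\<lambda>z. z * _"] cong: if_cong)
      then have "(transpose Q ** slice_gram l M ** Q) $ i $ j = Q $ l $ j"
        unfolding cong by simp
      then show ?thesis
        using 1 by (simp add: Q row slice_gram_def)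
    next
      case 2
      have "Q $ a $ i * slice_gram l M $ a $ b * Q $ b $ j = (if b = l then (if a = l then Q $ l $ i else 0) else 0)" for a b
        using 2 by (simp add: Q S)
      then have "(transpose Q ** slice_gram l M ** Q) $ i $ j = Q $ l $ i"
        unfolding cong by simp
      then show ?thesis
        using 2 by (simp add: Q row slice_gram_def)
    next
      case 3
      have "(\<Sum>a\<in>UNIV. \<Sum>b\<in>UNIV. Q $ a $ i * slice_gram l M $ a $ b * Q $ b $ j) = (\<Sum>a\<in>UNIV. \<Sum>b\<in>UNIV. J $ a $ i * M $ a $ b * J $ b $ j)"
        using 3 by (intro sum.cong refl) (auto simp: Q S row)
      then show ?thesis
        using 3 by (simp add: slice_gram_def cong)
    qed
  qed
  then show ?thesis
    by (simp add: vec_eq_iff)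
qed

lemma continuous_on_det:
  fixes f :: "'a::topological_space \<Rightarrow> real^'n::finite^'n"
  assumes "\<And>i j. continuous_on U (\<lambda>x. f x $ i $ j)"
  shows "continuous_on U (\<lambda>x. det (f x))"
  unfolding det_def by (intro continuous_intros assms)

text \<open>The volume is constructed for a real tensor \<gamma>. In the application \<gamma> is the
  boundary metric of the dS metric, and the complex rotated metric is then shown to satisfy the same
  defining condition.\<close>

locale slice_manifold =
  fixes X :: "'p::{t2_space, second_countable_topology} set"
    and A :: "('p, 'n::finite) chart set"
    and \<theta> :: "'p \<Rightarrow> real"
    and \<gamma> :: "(real, 'p, 'n) tensor2"
  assumes manifold: "smooth_manifold X A"
    and theta: "smooth_function A \<theta>"
    and regular: "\<And>c p. c \<in> A \<Longrightarrow> p \<in> fst c \<Longrightarrow> differential \<theta> c p \<noteq> 0"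
    and tensor: "sym_tensor_field A \<gamma>"
begin

abbreviation slice_space :: "'p measure" where
  "slice_space \<equiv> restrict_space borel (slice X \<theta>)"

definition adapted :: "('p, 'n) chart \<Rightarrow> 'n \<Rightarrow> bool" where
  "adapted c k \<longleftrightarrow> c \<in> A \<and> (\<forall>p\<in>fst c. snd c p $ k = \<theta> p)"

definition slice_density :: "('p, 'n) chart \<Rightarrow> 'n \<Rightarrow> real^'n \<Rightarrow> real" where
  "slice_density c k x = sqrt (norm (det (slice_gram k (in_chart c (\<gamma> c) x))))"

definition chart_volume :: "('p, 'n) chart \<Rightarrow> 'n \<Rightarrow> 'p set \<Rightarrow> ennreal" where
  "chart_volume c k E = (\<integral>\<^sup>+ y. ennreal (slice_density c k (slice_point k y)) * indicator (snd c ` E) (slice_point k y)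
     \<partial>PiM (UNIV - {k}) (\<lambda>_. lborel))"

lemma is_slice_volume_iff:
  "is_slice_volume X A \<theta> \<gamma> \<mu> \<longleftrightarrow> sets \<mu> = sets slice_space \<and>
    (\<forall>c k. adapted c k \<longrightarrow> (\<forall>E\<in>sets \<mu>. E \<subseteq> fst c \<longrightarrow> emeasure \<mu> E = chart_volume c k E))"
  unfolding is_slice_volume_def adapted_def chart_volume_def slice_density_def by blast

lemma chart: "c \<in> A \<Longrightarrow> is_chart X c"
  using manifold by (simp add: smooth_manifold_def)

lemma open_chart_image: "c \<in> A \<Longrightarrow> open (chart_image c)"
  using chart by (simp add: is_chart_def)

text \<open>Images of Borel sets are awkward, so the image is rewritten as a preimage under the
  continuous inverse of the chart, cut down to the hyperplane where the coordinate \<theta>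
  vanishes.\<close>

lemma chart_image_slice_measurable:
  assumes c: "adapted c k" and E: "E \<in> sets slice_space" "E \<subseteq> fst c"
  shows "snd c ` E \<in> sets borel"
proof -
  let ?inv = "inv_into (fst c) (snd c)"
  have cA: "c \<in> A" using c by (simp add: adapted_def)
  obtain F where F: "F \<in> sets borel" "E = slice X \<theta> \<inter> F"
    using E by (auto simp: sets_restrict_space)
  have "continuous_on (chart_image c) ?inv"
    using chart[OF cA] by (simp add: is_chart_def homeomorphism_def)
  then have "?inv \<in> borel_measurable (restrict_space borel (chart_image c))"
    by (rule borel_measurable_continuous_on_restrict)
  from measurable_sets[OF this F(1)]
  have "?inv -` F \<inter> chart_image c \<in> sets (restrict_space borel (chart_image c))"
    by (simp add: space_restrict_space)
  then have 1: "?inv -` F \<inter> chart_image c \<in> sets borel"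
    using open_chart_image[OF cA] by (auto simp: sets_restrict_space_iff)
  have 2: "{x :: real^'n. x $ k = 0} \<in> sets borel"
    using measurable_sets[OF borel_measurable_vec_nth, of "{0}" k] by (simp add: vimage_def)
  have "snd c ` E = (?inv -` F \<inter> chart_image c) \<inter> {x. x $ k = 0}"
  proof (intro subset_antisym subsetI)
    fix x assume "x \<in> snd c ` E"
    then show "x \<in> (?inv -` F \<inter> chart_image c) \<inter> {x. x $ k = 0}"
      using E(2) F(2) c chart_inverse[OF chart[OF cA]] by (auto simp: chart_image_def slice_def adapted_def)
  next
    fix x assume "x \<in> (?inv -` F \<inter> chart_image c) \<inter> {x. x $ k = 0}"
    then obtain q where q: "q \<in> fst c" "x = snd c q" "q \<in> F" "snd c q $ k = 0"
      using chart_inverse[OF chart[OF cA]] by (auto simp: chart_image_def)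
    then have "q \<in> E"
      using F(2) c chart_subset[OF chart[OF cA]] by (auto simp: slice_def adapted_def)
    then show "x \<in> snd c ` E"
      using q by simp
  qed
  then show ?thesis
    using sets.Int[OF 1 2] by simp
qed

lemma continuous_slice_density:
  assumes "c \<in> A"
  shows "continuous_on (chart_image c) (slice_density c k)"
proof -
  have "continuous_on (chart_image c) (in_chart c (\<gamma> c))"
    using tensor assms by (intro smooth_on_continuous) (simp add: sym_tensor_field_def)
  then have "continuous_on (chart_image c) (\<lambda>x. in_chart c (\<gamma> c) x $ i $ j)" for i j
    by (intro continuous_intros)
  then have "continuous_on (chart_image c) (\<lambda>x. slice_gram k (in_chart c (\<gamma> c) x) $ i $ j)" for i j
    by (cases "i = k \<or> j = k") (simp_all add: slice_gram_def)
  then show ?thesis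
    unfolding slice_density_def[abs_def]
    by (intro continuous_on_real_sqrt continuous_on_norm continuous_on_det)
qed

text \<open>Outside the chart image the density is evaluated at an arbitrary value of
  \<open>inv_into\<close>. It is continuous on the open image only, to which the indicator confines
  it.\<close>

lemma slice_density_measurable:
  assumes c: "adapted c k" and E: "E \<in> sets slice_space" "E \<subseteq> fst c"
  shows "(\<lambda>x. slice_density c k x * indicator (snd c ` E) x) \<in> borel_measurable borel"
proof -
  have cA: "c \<in> A" using c by (simp add: adapted_def)
  have "(\<lambda>x. indicator (chart_image c) x *\<^sub>R slice_density c k x) \<in> borel_measurable borel"
    using open_chart_image[OF cA] by (intro borel_measurable_continuous_on_indicator continuous_slice_density cA) simp
  moreover have "(indicator (snd c ` E) :: real^'n \<Rightarrow> real) \<in> borel_measurable borel"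
    using chart_image_slice_measurable[OF assms] by simp
  ultimately have "(\<lambda>x. indicator (chart_image c) x *\<^sub>R slice_density c k x * indicator (snd c ` E) x) \<in> borel_measurable borel"
    by (rule borel_measurable_times)
  moreover have "indicator (chart_image c) x *\<^sub>R slice_density c k x * indicator (snd c ` E) x = slice_density c k x * indicator (snd c ` E) x" for x
    using E(2) by (auto simp: indicator_def chart_image_def)
  ultimately show ?thesis by (simp only:)
qed

lemma slice_density_measurable':
  assumes c: "adapted c k" and E: "E \<in> sets slice_space" "E \<subseteq> fst c"
  shows "(\<lambda>x. ennreal (slice_density c k x) * indicator (snd c ` E) x) \<in> borel_measurable borel"
proof -
  have "ennreal (slice_density c k x) * indicator (snd c ` E) x = ennreal (slice_density c k x * indicator (snd c ` E) x)" for x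
    by (simp add: indicator_def)
  then show ?thesis
    using slice_density_measurable[OF assms] by simp
qed

lemma chart_volume_thicken:
  assumes "adapted c k" "E \<in> sets slice_space" "E \<subseteq> fst c"
  shows "chart_volume c k E = (\<integral>\<^sup>+ x. ennreal (slice_density c k (hyperplane_proj k x)) *
     indicator {x. hyperplane_proj k x \<in> snd c ` E \<and> 0 \<le> x $ k \<and> x $ k \<le> 1} x \<partial>lborel)"
  unfolding chart_volume_def nn_integral_thicken[OF slice_density_measurable'[OF assms]]
  by (intro nn_integral_cong) (auto simp: indicator_def)

lemma thick_measurable:
  assumes "adapted c k" "E \<in> sets slice_space" "E \<subseteq> fst c"
  defines "S \<equiv> {x. hyperplane_proj k x \<in> snd c ` E \<and> 0 \<le> x $ k \<and> x $ k \<le> 1}"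
  shows "S \<in> sets borel" "(\<lambda>x. slice_density c k (hyperplane_proj k x) * indicator S x) \<in> borel_measurable borel"
proof -
  have "hyperplane_proj k -` (snd c ` E) \<in> sets borel"
    using measurable_sets[OF measurable_hyperplane_proj chart_image_slice_measurable[OF assms(1-3)]] by simp
  moreover have I: "(\<lambda>x :: real^'n. x $ k) -` {0..1} \<in> sets borel"
    using measurable_sets[OF borel_measurable_vec_nth, of "{0..1}" k] by simp
  ultimately have "hyperplane_proj k -` (snd c ` E) \<inter> (\<lambda>x. x $ k) -` {0..1} \<in> sets borel"
    by (rule sets.Int)
  also have "hyperplane_proj k -` (snd c ` E) \<inter> (\<lambda>x. x $ k) -` {0..1} = S"
    by (auto simp: S_def)
  finally show "S \<in> sets borel" .
  have "(\<lambda>x. slice_density c k (hyperplane_proj k x) * indicator (snd c ` E) (hyperplane_proj k x)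
     * indicator ((\<lambda>x :: real^'n. x $ k) -` {0..1}) x) \<in> borel_measurable borel"
    using I by (intro borel_measurable_times measurable_compose[OF measurable_hyperplane_proj slice_density_measurable[OF assms(1-3)]]) simp
  moreover have "slice_density c k (hyperplane_proj k x) * indicator (snd c ` E) (hyperplane_proj k x)
     * indicator ((\<lambda>x :: real^'n. x $ k) -` {0..1}) x = slice_density c k (hyperplane_proj k x) * indicator S x" for x
    by (auto simp: S_def indicator_def)
  ultimately show "(\<lambda>x. slice_density c k (hyperplane_proj k x) * indicator S x) \<in> borel_measurable borel"
    by simp
qed

end

context slice_manifold
begin

text \<open>Both distinguished coordinates are \<theta>, so the \<open>l\<close>-th component of the
  transition map is the \<open>k\<close>-th coordinate on the whole open overlap and has the same
  derivative.\<close>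

lemma adapted_derivative_row:
  assumes c: "adapted c k" and d: "adapted d l" and p: "p \<in> fst c \<inter> fst d"
  shows "jacobian c d p $ l $ j = (if j = k then 1 else 0)"
proof -
  let ?W = "snd c ` (fst c \<inter> fst d)" and ?T = "in_chart c (snd d)"
  have cA: "c \<in> A" and dA: "d \<in> A" using c d by (simp_all add: adapted_def)
  have T: "smooth_on ?W ?T"
    using manifold cA dA by (simp add: smooth_manifold_def compatible_def)
  have pW: "snd c p \<in> ?W" using p by simp
  have Tl: "?T x $ l = x $ k" if "x \<in> ?W" for x
    using that c d by (auto simp: in_chart_eq[OF chart[OF cA]] adapted_def)
  have "((\<lambda>x. ?T x $ l) has_derivative (\<lambda>v. frechet_derivative ?T (at (snd c p)) v $ l)) (at (snd c p))"
    by (intro bounded_linear.has_derivative[OF bounded_linear_vec_nth] smooth_on_has_derivative[OF T pW])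
  then have "((\<lambda>x. x $ k) has_derivative (\<lambda>v. frechet_derivative ?T (at (snd c p)) v $ l)) (at (snd c p))"
    using has_derivative_transform_within_open[of "\<lambda>x. ?T x $ l" _ "snd c p" UNIV ?W "\<lambda>x. x $ k"] T pW Tl
    by (simp add: smooth_on_def)
  moreover have "((\<lambda>x. x $ k) has_derivative (\<lambda>v. v $ k)) (at (snd c p))"
    by (rule bounded_linear_imp_has_derivative[OF bounded_linear_vec_nth])
  ultimately have "frechet_derivative ?T (at (snd c p)) v $ l = v $ k" for v
    using has_derivative_unique by (metis (no_types, lifting))
  then show ?thesis
    by (simp add: jacobian_def matrix_def axis_def)
qed

text \<open>
  Both integrals are thickened to \<open>n\<close> dimensions: the transition map restricted to the
  hyperplane is extended by the identity in the direction of \<open>\<theta>\<close>.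
\<close>

lemma chart_volume_transition:
  assumes c: "adapted c k" and d: "adapted d l"
    and E: "E \<in> sets slice_space" "E \<subseteq> fst c" "E \<subseteq> fst d"
  shows "chart_volume c k E = chart_volume d l E"
proof -
  let ?W = "snd c ` (fst c \<inter> fst d)" and ?T = "in_chart c (snd d)"
  let ?P = "hyperplane_proj k" and ?P' = "hyperplane_proj l"
  have cA: "c \<in> A" and dA: "d \<in> A" using c d by (simp_all add: adapted_def)
  have T: "smooth_on ?W ?T"
    using manifold cA dA by (simp add: smooth_manifold_def compatible_def)
  define S where "S = {x. ?P x \<in> snd c ` E \<and> 0 \<le> x $ k \<and> x $ k \<le> 1}"
  define S' where "S' = {x. ?P' x \<in> snd d ` E \<and> 0 \<le> x $ l \<and> x $ l \<le> 1}"
  \<comment> \<open>The transition map acts on the hyperplane part, and the thickening variable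
    moves unchanged from position \<open>k\<close> to position \<open>l\<close>.\<close>
  define \<Phi> where "\<Phi> x = ?T (?P x) + (x $ k) *\<^sub>R axis l 1" for x
  define \<Phi>' where "\<Phi>' x v = frechet_derivative ?T (at (?P x)) (?P v) + (v $ k) *\<^sub>R axis l 1" for x v
  have slice: "\<theta> q = 0" if "q \<in> E" for q
    using E(1) that by (auto simp: sets_restrict_space slice_def)
  have Tq: "?T (snd c q) = snd d q" if "q \<in> E" for q
    using that E(2) in_chart_eq[OF chart[OF cA]] by blast
  have dl: "snd d q $ l = 0" and ck: "snd c q $ k = 0" if "q \<in> E" for q
    using that E c d slice by (auto simp: adapted_def)
  have P'id: "?P' (x + t *\<^sub>R axis l 1) = x" if "x $ l = 0" for x t
    using that by (auto simp: hyperplane_proj_def vec_eq_iff axis_def)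
  have \<Phi>S: "?P' (\<Phi> x) = snd d q" "\<Phi> x $ l = x $ k" if "?P x = snd c q" "q \<in> E" for x q
    using that Tq[of q] dl[of q] by (simp_all add: \<Phi>_def P'id)
  have linP: "bounded_linear ?P"
    unfolding linear_conv_bounded_linear[symmetric]
    by (rule linearI) (auto simp: hyperplane_proj_def vec_eq_iff)
  have der: "(\<Phi> has_derivative \<Phi>' x) (at x within S)" if x: "x \<in> S" for x
  proof -
    obtain q where q: "?P x = snd c q" "q \<in> E" using x by (auto simp: S_def)
    have "(?T has_derivative frechet_derivative ?T (at (?P x))) (at (?P x))"
      by (rule smooth_on_has_derivative[OF T]) (use q E in auto)
    from diff_chain_at[OF bounded_linear_imp_has_derivative[OF linP] this]
    have "((\<lambda>x. ?T (?P x)) has_derivative (\<lambda>v. frechet_derivative ?T (at (?P x)) (?P v))) (at x)"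
      by (simp add: o_def)
    then have "(\<Phi> has_derivative \<Phi>' x) (at x)"
      unfolding \<Phi>_def[abs_def] \<Phi>'_def[abs_def]
      by (intro has_derivative_add has_derivative_scaleR_left bounded_linear_imp_has_derivative[OF bounded_linear_vec_nth])
    then show ?thesis by (rule has_derivative_at_withinI)
  qed
  have inj: "inj_on \<Phi> S"
  proof (rule inj_onI)
    fix x y assume xy: "x \<in> S" "y \<in> S" "\<Phi> x = \<Phi> y"
    obtain q where q: "?P x = snd c q" "q \<in> E" using xy by (auto simp: S_def)
    obtain r where r: "?P y = snd c r" "r \<in> E" using xy by (auto simp: S_def)
    have "snd d q = snd d r"
      using \<Phi>S(1)[OF q] \<Phi>S(1)[OF r] xy by simp
    then have "q = r"
      using inj_onD[OF chart_inj[OF chart[OF dA]]] q r E by blast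
    then have P: "?P x $ i = ?P y $ i" for i using q r by simp
    have xk: "x $ k = y $ k"
      using \<Phi>S(2)[OF q] \<Phi>S(2)[OF r] xy by simp
    have "x $ i = y $ i" for i
      using P[of i] xk by (cases "i = k") (simp_all add: hyperplane_proj_def)
    then show "x = y"
      by (simp add: vec_eq_iff)
  qed
  have img: "\<Phi> ` S = S'"
  proof (intro subset_antisym subsetI)
    fix y assume "y \<in> \<Phi> ` S"
    then show "y \<in> S'"
      using \<Phi>S by (fastforce simp: S_def S'_def)
  next
    fix y assume y: "y \<in> S'"
    then obtain q where q: "?P' y = snd d q" "q \<in> E" by (auto simp: S'_def)
    let ?x = "snd c q + (y $ l) *\<^sub>R axis k 1"
    have Px: "?P ?x = snd c q"
      using ck[OF q(2)] by (auto simp: hyperplane_proj_def vec_eq_iff axis_def)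
    have xk: "?x $ k = y $ l"
      using ck[OF q(2)] by simp
    have "y = ?P' y + (y $ l) *\<^sub>R axis l 1"
      by (auto simp: hyperplane_proj_def vec_eq_iff axis_def)
    also have "\<dots> = \<Phi> ?x"
      unfolding \<Phi>_def Px xk Tq[OF q(2)] q(1) ..
    finally have "y = \<Phi> ?x" .
    moreover have "?x \<in> S"
      using y q Px xk by (auto simp: S_def S'_def)
    ultimately show "y \<in> \<Phi> ` S" by blast
  qed
  \<comment> \<open>The determinant of the induced metric changes by the square of det Q, so its
    square root changes by |det Q|. This is the Jacobian of \<Phi>, because \<open>Q\<close> is the
    matrix of its derivative.\<close>
  have dens: "\<bar>det (matrix (\<Phi>' x))\<bar> * slice_density d l (?P' (\<Phi> x)) = slice_density c k (?P x)" if x: "x \<in> S" for x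
  proof -
    obtain q where q: "?P x = snd c q" "q \<in> E" using x by (auto simp: S_def)
    have qcd: "q \<in> fst c \<inter> fst d" using q E by auto
    define J where "J = jacobian c d q"
    define Q where "Q = (\<chi> i j. if j = k then (if i = l then 1 else 0) else J $ i $ j)"
    have \<gamma>: "\<gamma> c q = transpose J ** \<gamma> d q ** J"
      using tensor cA dA qcd unfolding sym_tensor_field_def J_def by blast
    have "matrix (\<Phi>' x) $ i $ j = Q $ i $ j" for i j
    proof (cases "j = k")
      case True
      \<comment> \<open>The projection kills the \<open>k\<close>-th direction, so only the added
        \<open>axis l 1\<close> contributes to the \<open>k\<close>-th column.\<close>
      have "?P (axis k 1) = 0"
        by (auto simp: hyperplane_proj_def vec_eq_iff axis_def)
      then have "frechet_derivative ?T (at (?P x)) (?P (axis k 1)) = 0"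
        using linear_0[OF has_derivative_linear[OF smooth_on_has_derivative[OF T]], of "?P x"] q qcd by simp
      then show ?thesis
        using True by (simp add: matrix_def \<Phi>'_def Q_def) (simp add: axis_def)
    next
      case False
      then have "?P (axis j 1) = axis j 1"
        by (auto simp: hyperplane_proj_def vec_eq_iff axis_def)
      then show ?thesis
        using False by (simp add: matrix_def \<Phi>'_def Q_def J_def jacobian_def q) (simp add: axis_def)
    qed
    then have mQ: "matrix (\<Phi>' x) = Q"
      by (simp add: vec_eq_iff)
    have "slice_gram k (\<gamma> c q) = transpose Q ** slice_gram l (\<gamma> d q) ** Q"
      unfolding \<gamma> Q_def by (rule slice_gram_transform) (simp add: J_def adapted_derivative_row[OF c d qcd])
    then have "det (slice_gram k (\<gamma> c q)) = (det Q)\<^sup>2 * det (slice_gram l (\<gamma> d q))"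
      by (simp add: det_mul det_transpose power2_eq_square)
    then have "sqrt (norm (det (slice_gram k (\<gamma> c q)))) = \<bar>det Q\<bar> * sqrt (norm (det (slice_gram l (\<gamma> d q))))"
      by (simp add: abs_mult real_sqrt_mult)
    then show ?thesis
      using qcd by (simp add: slice_density_def mQ q \<Phi>S(1)[OF q] in_chart_eq[OF chart[OF cA]] in_chart_eq[OF chart[OF dA]])
  qed
  note thick_c = thick_measurable[OF c E(1,2), folded S_def]
  note thick_d = thick_measurable[OF d E(1,3), folded S'_def]
  have "(\<integral>\<^sup>+ x. ennreal (\<bar>det (matrix (\<Phi>' x))\<bar> * slice_density d l (?P' (\<Phi> x))) * indicator S x \<partial>lborel)
    = (\<integral>\<^sup>+ y. ennreal (slice_density d l (?P' y)) * indicator (\<Phi> ` S) y \<partial>lborel)"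
  proof (rule nn_integral_change_of_variables[OF thick_c(1) der inj])
    show "0 \<le> slice_density d l (?P' y)" for y
      by (simp add: slice_density_def)
    have "\<bar>det (matrix (\<Phi>' x))\<bar> * slice_density d l (?P' (\<Phi> x)) * indicator S x = slice_density c k (?P x) * indicator S x" for x
      using dens by (simp add: indicator_def)
    then show "(\<lambda>x. \<bar>det (matrix (\<Phi>' x))\<bar> * slice_density d l (?P' (\<Phi> x)) * indicator S x) \<in> borel_measurable borel"
      using thick_c(2) by (simp only:)
    show "(\<lambda>y. slice_density d l (?P' y) * indicator (\<Phi> ` S) y) \<in> borel_measurable borel"
      using thick_d(2) by (simp add: img)
  qed
  moreover have "ennreal (\<bar>det (matrix (\<Phi>' x))\<bar> * slice_density d l (?P' (\<Phi> x))) * indicator S x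
    = ennreal (slice_density c k (?P x)) * indicator S x" for x
    using dens by (simp add: indicator_def)
  ultimately show ?thesis
    unfolding chart_volume_thicken[OF c E(1,2)] chart_volume_thicken[OF d E(1,3)] S_def[symmetric] S'_def[symmetric] img
    by (simp only:)
qed

text \<open>Injectivity of the chart keeps the images disjoint, so the indicators add up; the sum
  then passes through the integral of nonnegative functions.\<close>

lemma chart_volume_UN:
  assumes c: "adapted c k" and B: "range B \<subseteq> sets slice_space" "disjoint_family B" "\<And>n::nat. B n \<subseteq> fst c"
  shows "chart_volume c k (\<Union>n. B n) = (\<Sum>n. chart_volume c k (B n))"
proof -
  have cA: "c \<in> A" using c by (simp add: adapted_def)
  have inj: "inj_on (snd c) (fst c)"
    using chart_inj[OF chart[OF cA]] .
  have disj: "disjoint_family (\<lambda>n. snd c ` B n)"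
    using B(2,3) inj unfolding disjoint_family_on_def inj_on_def by blast
  have pt: "(\<Sum>n. ennreal (slice_density c k x) * indicator (snd c ` B n) x) = ennreal (slice_density c k x) * indicator (snd c ` (\<Union>n. B n)) x" for x
    by (simp add: suminf_indicator[OF disj] image_UN)
  have "(\<Sum>n. chart_volume c k (B n)) = (\<integral>\<^sup>+ y. (\<Sum>n. ennreal (slice_density c k (slice_point k y)) * indicator (snd c ` B n) (slice_point k y))
     \<partial>PiM (UNIV - {k}) (\<lambda>_. lborel))"
    unfolding chart_volume_def
    by (rule nn_integral_suminf[symmetric])
      (use measurable_compose[OF measurable_slice_point slice_density_measurable'[OF c]] B in blast)
  then show ?thesis
    unfolding chart_volume_def pt by simp
qed

section \<open>Existence and uniqueness of the volume measure\<close>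

lemma fst_chart_slice: "c \<in> A \<Longrightarrow> slice X \<theta> \<inter> fst c \<in> sets slice_space"
proof -
  assume "c \<in> A"
  then have "openin (top_of_set X) (fst c)"
    using chart by (simp add: is_chart_def)
  then obtain U where "open U" "fst c = X \<inter> U"
    by (auto simp: openin_open)
  then show ?thesis
    by (auto simp: sets_restrict_space slice_def intro!: image_eqI[of _ _ U])
qed

text \<open>Adapted charts exist around every point, and second countability (Lindelof) extracts a
  countable subcover. \<open>X\<close> is taken nonempty so that the subcover can be enumerated by
  all natural numbers.\<close>

lemma adapted_cover:
  assumes "X \<noteq> {}"
  obtains C \<kappa> where "\<And>i::nat. adapted (C i) (\<kappa> i)" "X = (\<Union>i. fst (C i))"
proof -
  let ?F = "{fst c | c k. adapted c k}"
  have UF: "\<Union>?F = X"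
  proof (intro subset_antisym subsetI)
    fix p assume "p \<in> \<Union>?F"
    then obtain c k where "adapted c k" "p \<in> fst c"
      by blast
    then show "p \<in> X"
      using chart_subset[OF chart] unfolding adapted_def by blast
  next
    fix p assume "p \<in> X"
    then obtain c where c: "c \<in> A" "p \<in> fst c"
      using manifold by (auto simp: smooth_manifold_def)
    obtain d k where d: "d \<in> A" "p \<in> fst d" "\<And>q. q \<in> fst d \<Longrightarrow> snd d q $ k = \<theta> q"
      by (rule adapted_chart[OF manifold theta c regular[OF c]]) (rule that)
    then have "adapted d k" by (simp add: adapted_def)
    then show "p \<in> \<Union>?F" using d(2) by blast
  qed
  have op: "openin (top_of_set X) S" if "S \<in> ?F" for S
    using that chart by (auto simp: adapted_def is_chart_def)
  obtain F' where F': "F' \<subseteq> ?F" "countable F'" "\<Union>F' = \<Union>?F"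
    using Lindelof_openin[OF op] by blast
  then have "F' \<noteq> {}" using assms UF by auto
  define f where "f = from_nat_into F'"
  have f: "range f = F'"
    unfolding f_def by (rule range_from_nat_into[OF \<open>F' \<noteq> {}\<close> F'(2)])
  have "\<exists>ck. adapted (fst ck) (snd ck) \<and> f i = fst (fst ck)" for i
    using f F'(1) by (fastforce simp: image_subset_iff)
  then obtain ck where "\<And>i. adapted (fst (ck i)) (snd (ck i)) \<and> f i = fst (fst (ck i))"
    by metis
  then show thesis
    using that[of "\<lambda>i. fst (ck i)" "\<lambda>i. snd (ck i)"] f F'(3) UF by auto
qed

text \<open>The slice is cut into countably many measurable pieces, each inside one adapted chart,
  and the local volumes of the pieces are summed. Agreement of local volumes on overlaps makes this
  sum correct in every adapted chart. Uniqueness holds because the condition prescribes the measure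
  of each part \<open>E \<inter> D i\<close>, hence of \<open>E\<close>.\<close>

lemma ex1_slice_volume: "\<exists>!\<mu>. is_slice_volume X A \<theta> \<gamma> \<mu>"
proof (cases "X = {}")
  case True
  then have sl: "slice X \<theta> = {}" by (simp add: slice_def)
  have sets_empty: "sets slice_space = {{}}"
    by (auto simp: sl sets_restrict_space)
  show ?thesis
  proof (rule ex1I[of _ slice_space])
    show "is_slice_volume X A \<theta> \<gamma> slice_space"
      unfolding is_slice_volume_iff using sets_empty by (auto simp: chart_volume_def)
    fix \<mu> assume "is_slice_volume X A \<theta> \<gamma> \<mu>"
    then have "sets \<mu> = sets slice_space" by (simp add: is_slice_volume_iff)
    then show "\<mu> = slice_space"
      by (rule measure_eqI) (use sets_empty \<open>sets \<mu> = sets slice_space\<close> in auto)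
  qed
next
  case False
  then obtain C \<kappa> where C: "\<And>i::nat. adapted (C i) (\<kappa> i)" and cov: "X = (\<Union>i. fst (C i))"
    using adapted_cover by blast
  \<comment> \<open>Disjoint pieces prevent points covered by several charts from being counted more
    than once.\<close>
  define D where "D = disjointed (\<lambda>i. slice X \<theta> \<inter> fst (C i))"
  have D_sets: "D i \<in> sets slice_space" for i
    using sets.range_disjointed_sets[of "\<lambda>i. slice X \<theta> \<inter> fst (C i)" slice_space] fst_chart_slice C
    by (auto simp: D_def adapted_def image_subset_iff)
  have D_disj: "disjoint_family D"
    unfolding D_def by (rule disjoint_family_disjointed)
  have D_sub: "D i \<subseteq> fst (C i)" for i
    unfolding D_def using disjointed_subset[of "\<lambda>i. slice X \<theta> \<inter> fst (C i)" i] by blast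
  have D_UN: "(\<Union>i. D i) = slice X \<theta>"
    unfolding D_def UN_disjointed_eq using cov by (auto simp: slice_def)
  have E_UN: "(\<Union>i. E \<inter> D i) = E" if "E \<in> sets slice_space" for E
    using that D_UN by (auto simp: sets_restrict_space)
  have E_disj: "disjoint_family (\<lambda>i. E \<inter> D i)" for E
    using D_disj by (auto simp: disjoint_family_on_def)
  define m where "m E = (\<Sum>i. chart_volume (C i) (\<kappa> i) (E \<inter> D i))" for E
  define \<mu> where "\<mu> = measure_of (space slice_space) (sets slice_space) m"
  have sets_\<mu>: "sets \<mu> = sets slice_space"
    unfolding \<mu>_def by (rule sets.sets_measure_of_eq)
  have em: "emeasure \<mu> E = m E" if "E \<in> sets slice_space" for E
    unfolding \<mu>_def
  proof (rule emeasure_measure_of_sigma[OF sets.sigma_algebra_axioms _ _ that])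
    show "positive (sets slice_space) m"
      by (simp add: positive_def m_def chart_volume_def)
    show "countably_additive (sets slice_space) m"
    proof (rule countably_additiveI)
      fix B :: "nat \<Rightarrow> 'p set"
      assume B: "range B \<subseteq> sets slice_space" "disjoint_family B"
      have "(\<Sum>n. m (B n)) = (\<Sum>n. \<Sum>i. chart_volume (C i) (\<kappa> i) (B n \<inter> D i))"
        by (simp add: m_def)
      \<comment> \<open>One of the two sums is read as an integral over counting measure, so that
        interchanging them is an interchange of sum and integral.\<close>
      also have "\<dots> = (\<integral>\<^sup>+ n. (\<Sum>i. chart_volume (C i) (\<kappa> i) (B n \<inter> D i)) \<partial>count_space UNIV)"
        by (rule nn_integral_count_space_nat[symmetric])
      also have "\<dots> = (\<Sum>i. \<integral>\<^sup>+ n. chart_volume (C i) (\<kappa> i) (B n \<inter> D i) \<partial>count_space UNIV)"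
        by (rule nn_integral_suminf) simp
      also have "\<dots> = (\<Sum>i. \<Sum>n. chart_volume (C i) (\<kappa> i) (B n \<inter> D i))"
        by (simp add: nn_integral_count_space_nat)
      also have "\<dots> = (\<Sum>i. chart_volume (C i) (\<kappa> i) (\<Union>n. B n \<inter> D i))"
      proof (rule suminf_cong)
        fix i
        show "(\<Sum>n. chart_volume (C i) (\<kappa> i) (B n \<inter> D i)) = chart_volume (C i) (\<kappa> i) (\<Union>n. B n \<inter> D i)"
        proof (rule chart_volume_UN[OF C, symmetric])
          show "range (\<lambda>n. B n \<inter> D i) \<subseteq> sets slice_space"
            using B(1) D_sets by (auto intro: sets.Int)
          show "disjoint_family (\<lambda>n. B n \<inter> D i)"
            using B(2) unfolding disjoint_family_on_def by blast
          show "B n \<inter> D i \<subseteq> fst (C i)" for n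
            using D_sub[of i] by blast
        qed
      qed
      also have "\<dots> = m (\<Union>n. B n)"
        by (simp add: m_def)
      finally show "(\<Sum>n. m (B n)) = m (\<Union>n. B n)" .
    qed
  qed
  have ex: "is_slice_volume X A \<theta> \<gamma> \<mu>"
    unfolding is_slice_volume_iff
  proof (intro conjI allI impI ballI sets_\<mu>)
    fix c k E assume c: "adapted c k" and E: "E \<in> sets \<mu>" "E \<subseteq> fst c"
    have E': "E \<in> sets slice_space" using E sets_\<mu> by simp
    have ED: "E \<inter> D i \<in> sets slice_space" for i
      using E' D_sets by (rule sets.Int)
    have "emeasure \<mu> E = (\<Sum>i. chart_volume (C i) (\<kappa> i) (E \<inter> D i))"
      by (simp add: em[OF E'] m_def)
    also have "\<dots> = (\<Sum>i. chart_volume c k (E \<inter> D i))"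
      by (intro suminf_cong chart_volume_transition[OF C c ED]) (use D_sub E in auto)
    also have "\<dots> = chart_volume c k (\<Union>i. E \<inter> D i)"
      by (rule chart_volume_UN[OF c _ E_disj, symmetric]) (use ED E in auto)
    finally show "emeasure \<mu> E = chart_volume c k E"
      by (simp only: E_UN[OF E'])
  qed
  moreover have "\<mu>' = \<mu>" if "is_slice_volume X A \<theta> \<gamma> \<mu>'" for \<mu>'
  proof -
    have sets': "sets \<mu>' = sets slice_space"
      using that by (simp add: is_slice_volume_iff)
    have *: "emeasure \<nu> E = (\<Sum>i. chart_volume (C i) (\<kappa> i) (E \<inter> D i))"
      if \<nu>: "is_slice_volume X A \<theta> \<gamma> \<nu>" and E: "E \<in> sets slice_space" for \<nu> E
    proof -
      have sets\<nu>: "sets \<nu> = sets slice_space"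
        using \<nu> by (simp add: is_slice_volume_iff)
      have ED: "E \<inter> D i \<in> sets \<nu>" for i
        unfolding sets\<nu> using E D_sets by (rule sets.Int)
      have "emeasure \<nu> (\<Union>i. E \<inter> D i) = (\<Sum>i. emeasure \<nu> (E \<inter> D i))"
        by (rule suminf_emeasure[OF _ E_disj, symmetric]) (use ED in blast)
      moreover have "emeasure \<nu> (E \<inter> D i) = chart_volume (C i) (\<kappa> i) (E \<inter> D i)" for i
        using \<nu> C ED D_sub unfolding is_slice_volume_iff by blast
      ultimately show ?thesis
        by (simp only: E_UN[OF E])
    qed
    show ?thesis
      by (rule measure_eqI) (use sets' sets_\<mu> *[OF that] *[OF ex] in auto)
  qed
  ultimately show ?thesis by blast
qed

text \<open>Existence and uniqueness enter the comparison of the masses through this inclusion: a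
  chart around the point of evaluation is available only on \<open>X\<close>.\<close>

lemma space_slice_volume: "space (slice_volume X A \<theta> \<gamma>) \<subseteq> X"
proof -
  have "is_slice_volume X A \<theta> \<gamma> (slice_volume X A \<theta> \<gamma>)"
    unfolding slice_volume_def by (rule theI'[OF ex1_slice_volume])
  then have "sets (slice_volume X A \<theta> \<gamma>) = sets slice_space"
    by (simp add: is_slice_volume_iff)
  from sets_eq_imp_space_eq[OF this] have "space (slice_volume X A \<theta> \<gamma>) = slice X \<theta>"
    by (simp add: space_restrict_space)
  then show ?thesis
    by (auto simp: slice_def)
qed

end

section \<open>Comparison of the masses\<close>

lemma det_complex_matrix: "det (complex_matrix M) = of_real (det M)"
  by (simp add: det_def)

text \<open>If d\<theta> is the \<open>k\<close>-th basis covector, the rotation matrix differs from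
  the identity only in its \<open>k\<close>-th column, and tangential entries of the metric use the
  other columns.\<close>

lemma wick_nth_adapted:
  assumes "differential \<theta> c p = axis k 1" "i \<noteq> k" "j \<noteq> k"
  shows "wick \<theta> K h c p $ i $ j = of_real (h c p $ i $ j)"
proof -
  have W: "wick_map \<theta> K c p $ a $ b = (if a = b then 1 else 0)" if "b \<noteq> k" for a b
    using that by (simp add: wick_map_def assms(1) axis_def)
  show ?thesis
    by (simp add: wick_congruence matrix_matrix_mult_def transpose_def W assms(2,3)
        if_distrib[where f = "\<lambda>x. x * _"] if_distrib[where f = "\<lambda>x. _ * x"] cong: if_cong)
qed

text \<open>The two defining conditions are shown to be equivalent, so the definite descriptions
  coincide without a separate construction for the complex metric.\<close>

lemma (in slice_manifold) slice_volume_wick: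
  assumes \<gamma>': "\<And>c p. c \<in> A \<Longrightarrow> p \<in> fst c \<Longrightarrow> \<gamma>' c p = wick \<theta> K \<gamma> c p"
  shows "slice_volume X A \<theta> \<gamma>' = slice_volume X A \<theta> \<gamma>"
proof -
  have eq: "ennreal (sqrt (norm (det (slice_gram k (in_chart c (\<gamma>' c) x))))) * indicator (snd c ` E) x
     = ennreal (sqrt (norm (det (slice_gram k (in_chart c (\<gamma> c) x))))) * indicator (snd c ` E) x"
    if c: "c \<in> A" "\<forall>p\<in>fst c. snd c p $ k = \<theta> p" and E: "E \<subseteq> fst c" for c k E x
  proof (cases "x \<in> snd c ` E")
    case True
    then obtain p where p: "p \<in> fst c" "x = snd c p"
      using E by auto
    note ic = in_chart_eq[OF chart[OF c(1)] p(1)]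
    \<comment> \<open>In such a chart \<theta> is the \<open>k\<close>-th coordinate function on the
      whole open image.\<close>
    have "differential \<theta> c p $ i = axis k 1 $ i" for i
    proof -
      have sp: "snd c p \<in> chart_image c"
        using p by (simp add: chart_image_def)
      have "in_chart c \<theta> y = y $ k" if "y \<in> chart_image c" for y
        using that c in_chart_eq[OF chart[OF c(1)]] by (auto simp: chart_image_def)
      then have "(in_chart c \<theta> has_derivative (\<lambda>v. v $ k)) (at (snd c p))"
        using has_derivative_transform_within_open[OF bounded_linear_imp_has_derivative[OF bounded_linear_vec_nth] open_chart_image[OF c(1)] sp]
        by metis
      from frechet_derivative_at[OF this] show ?thesis
        by (simp add: differential_def partial_def axis_def flip: fun_cong[of "\<lambda>v. v $ k"])
    qed
    then have d: "differential \<theta> c p = axis k 1"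
      by (simp add: vec_eq_iff)
    have "slice_gram k (\<gamma>' c p) = complex_matrix (slice_gram k (\<gamma> c p))"
      by (simp add: vec_eq_iff slice_gram_def \<gamma>'[OF c(1) p(1)] wick_nth_adapted[OF d])
    then show ?thesis
      by (simp add: p(2) ic det_complex_matrix)
  qed simp
  have "is_slice_volume X A \<theta> \<gamma>' \<mu> \<longleftrightarrow> is_slice_volume X A \<theta> \<gamma> \<mu>" for \<mu>
    unfolding is_slice_volume_def using eq by (simp cong: conj_cong imp_cong ball_cong)
  then show ?thesis
    by (simp add: slice_volume_def)
qed

theorem proposition5p1:
  fixes X :: "'p::{t2_space, second_countable_topology} set"
    and A :: "('p, 'n::finite) chart set"
    and M :: "'q::{t2_space, second_countable_topology} set"
    and N :: "'r::{t2_space, second_countable_topology} set"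
    and G :: real
  assumes "G > 0"
    and dS: "dS_plus M B gM V \<rho> \<pi> X A g_dS a_dS h_dS"
    and killing_infinity: "killing A (a_dS 0) K"
    and coordinate: "killing_coordinate X A K \<theta>"
    and AH: "AH_einstein_collar N C gN \<rho>' \<pi>' X A g_AH a_AH h_AH"
    and continuation: "AH_continuation A a_dS a_AH"
    and killing_AH: "killing C gN Z"
      "\<forall>c\<in>A. \<forall>q\<in>fst (fg_chart N \<rho>' \<pi>' c). Z (fg_chart N \<rho>' \<pi>' c) q = bulk_coords 0 (K c (\<pi>' q))"
    and AdS: "fg_expansion A (\<lambda>r. wick \<theta> K (g_AH r)) a_AdS h_AdS"
  shows "(odd (CARD('n)) \<longrightarrow>
           (CARD('n) mod 4 = 3 \<longrightarrow>
              complex_of_real (holographic_mass 1 G X A K \<theta> a_dS) = - holographic_mass (-1) G X A K \<theta> a_AdS) \<and>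
           (CARD('n) mod 4 = 1 \<longrightarrow>
              complex_of_real (holographic_mass 1 G X A K \<theta> a_dS) = holographic_mass (-1) G X A K \<theta> a_AdS)) \<and>
         (CARD('n) = 2 \<longrightarrow>
              complex_of_real (holographic_mass 1 G X A K \<theta> a_dS) = - holographic_mass (-1) G X A K \<theta> a_AdS) \<and>
         (CARD('n) = 4 \<longrightarrow>
              complex_of_real (holographic_mass 1 G X A K \<theta> a_dS) = holographic_mass (-1) G X A K \<theta> a_AdS)"
proof -
  have manifold: "smooth_manifold X A" and riem: "riemannian A (a_dS 0)"
    using dS by (auto simp: dS_plus_def)
  have dK: "differential \<theta> c p \<bullet> K c p = 1" if "c \<in> A" "p \<in> fst c" for c p
    using coordinate that by (simp add: killing_coordinate_def)
  interpret slice_manifold X A \<theta> "a_dS 0"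
  proof
    show "differential \<theta> c p \<noteq> 0" if "c \<in> A" "p \<in> fst c" for c p
      using dK[OF that] by auto
  qed (use manifold riem coordinate in \<open>auto simp: riemannian_def killing_coordinate_def\<close>)
  have exp: "fg_expansion A g_AH a_AH h_AH"
    using AH by (simp add: AH_einstein_collar_def)
  have a0: "a_AH 0 c p = a_dS 0 c p" if "c \<in> A" "p \<in> fst c" for c p
    using continuation that by (simp add: AH_continuation_def)
  have AdS_wick: "a_AdS j c p = wick \<theta> K (a_AH j) c p" if "c \<in> A" "p \<in> fst c" "j \<le> CARD('n)" for j c p
    by (rule fg_expansion_wick[OF exp AdS that])
  \<comment> \<open>The continuation keeps the boundary metric, so the AdS boundary metric is
    directly the rotation of the dS one.\<close>
  have AdS0: "a_AdS 0 c p = wick \<theta> K (a_dS 0) c p" if "c \<in> A" "p \<in> fst c" for c p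
    using AdS_wick[OF that, of 0] a0[OF that] by (simp add: wick_congruence)
  have volume_eq: "slice_volume X A \<theta> (a_AdS 0) = slice_volume X A \<theta> (a_dS 0)"
    by (rule slice_volume_wick[where K = K]) (rule AdS0)
  have pos: "bilin (a_dS 0 c p) v v > 0" if "c \<in> A" "p \<in> fst c" "v \<noteq> 0" for c p v
    using riem that by (simp add: riemannian_def)
  let ?n = "CARD('n)"
  \<comment> \<open>All claimed cases are one identity with the sign \<open>eps\<close>, which is
    real and equal to its own inverse.\<close>
  have main: "holographic_mass (-1) G X A K \<theta> a_AdS = of_real (eps ?n * holographic_mass 1 G X A K \<theta> a_dS)"
    if n: "odd ?n \<or> ?n = 2 \<or> ?n = 4"
  proof -
    define dens where "dens p = (let c = chart_at A p in
      bilin (stress_energy 1 G a_dS c p) (scalar_vec (K c p)) (unit_normal 1 \<theta> (a_dS 0) c p))" for p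
    have "(let c = chart_at A p in
      bilin (stress_energy (-1) G a_AdS c p) (scalar_vec (K c p)) (unit_normal (-1) \<theta> (a_AdS 0) c p))
      = of_real (eps ?n * dens p)" if "p \<in> X" for p
    proof -
      define c where "c = chart_at A p"
      have "p \<in> \<Union> (fst ` A)"
        using manifold \<open>p \<in> X\<close> by (simp add: smooth_manifold_def)
      then have "\<exists>c. c \<in> A \<and> p \<in> fst c"
        by blast
      then have "c \<in> A \<and> p \<in> fst c"
        unfolding c_def chart_at_def by (rule someI_ex)
      then have c: "c \<in> A" "p \<in> fst c"
        by simp_all
      have inv: "invertible (a_AH 0 c p)"
        using pos[OF c] by (simp add: a0[OF c] invertible_if_positive)
      have "stress_energy (-1) G a_AdS c p = - wick \<theta> K (stress_energy 1 G a_AH) c p"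
        by (rule stress_energy_wick[where a = a_AH and a' = a_AdS and K = K and \<theta> = \<theta> and c = c and p = p, OF inv dK[OF c] AdS_wick[OF c] n])
      moreover have "bilin (wick \<theta> K (stress_energy 1 G a_AH) c p) (scalar_vec (K c p)) (unit_normal (-1) \<theta> (a_AdS 0) c p)
        = - of_real (bilin (stress_energy 1 G a_AH c p) (K c p) (unit_normal 1 \<theta> (a_dS 0) c p))"
        by (rule wick_bilin_normal[where \<gamma> = "a_dS 0" and \<gamma>' = "a_AdS 0" and K = K and \<theta> = \<theta> and c = c and p = p, OF pos[OF c] dK[OF c] AdS0[OF c]])
      moreover have "bilin (- P) u v = - bilin P u v" for P :: "complex^'n^'n" and u v
        by (simp add: bilin_def sum_negf)
      ultimately show ?thesis
        by (simp add: dens_def Let_def flip: c_def)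
          (simp add: stress_energy_continuation[OF continuation c n] bilin_scaleR_matrix)
    qed
    \<comment> \<open>Both integrals are over the same measure and evaluate the integrand in the
      same chosen chart \<open>chart_at A p\<close>, so the pointwise identity suffices.\<close>
    then have "holographic_mass (-1) G X A K \<theta> a_AdS = (LINT p | slice_volume X A \<theta> (a_dS 0). complex_of_real (eps ?n * dens p))"
      unfolding holographic_mass_def volume_eq
      using space_slice_volume by (intro Bochner_Integration.integral_cong) auto
    \<comment> \<open>The constant factor and the embedding of the reals commute with the Bochner
      integral also when the integrand is not integrable, since both sides then have the default
      value 0.\<close>
    then show ?thesis
      by (simp add: holographic_mass_def dens_def)
  qed
  have "n mod 4 = 3 \<Longrightarrow> eps n = -1" "n mod 4 = 1 \<Longrightarrow> eps n = 1" "eps 2 = -1" "eps 4 = 1" for n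
    by (simp_all add: eps_def)
  then show ?thesis
    using main by simp
qed

end
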